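(* Let $(\mathcal W,\mathcal S)$ be an extended Coxeter system of star type. Then there is an extended Weyl system $(W,S)$ such that its hyperbolic cover $(\tilde W,\tilde S)$ is isomorphic to $(\mathcal W,\mathcal S)$. Conversely, every hyperbolic cover of an extended Weyl system is isomorphic to an extended Coxeter system of star type.
   Context: Isomorphic: for groups $G,G'$ generated by $X,X'$, $(G,X)$ and $(G',X')$ are isomorphic if there is a group isomorphism $G\to G'$ mapping $X$ bijectively onto $X'$. Extended Weyl systems: given integers $r\ge0$ and $p_1,\ldots,p_r\ge1$, let $Q=\{1,1^*\}\cup\{(i,j)\mid1\le i\le r,1\le j\le p_i\}$ be the vertex set of the diagram in which single edges join $(i,j)$ with $(i,j+1)$ ($1\le j<p_i$), $1$ with $(i,1)$, and $1^*$ with $(i,1)$, and $1,1^*$ are joined by a dotted double bond. $V$ is the real vector space with basis $B=\{\alpha_\nu\mid\nu\in Q\}$ and symmetric form with $(\alpha_\nu\mid\alpha_\nu)=2=(\alpha_1\mid\alpha_{1^*})$, $-1$ for single edges, $0$ otherwise; $s_\alpha(v)=v-\frac{2(\alpha\mid v)}{(\alpha\mid\alpha)}\alpha$ for $(\alpha\mid\alpha)\neq0$; $S=\{s_\alpha\mid\alpha\in B\}$, $W=\langle S\rangle\le\mathrm{GL}(V)$. The type is wild, tubular or domestic if the signature (positive, negative, zero) is $(|B|-2,1,1)$, $(|B|-2,0,2)$ or $(|B|-1,0,1)$, respectively. Hyperbolic cover: put $a=\alpha_{1^*}-\alpha_1$, $\overline B=B\setminus\{\alpha_{1^*}\}$.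 Domestic or wild type: $\tilde V=V\oplus\mathbb Ra'$ with $(\mathrm{span}_{\mathbb R}(\overline B)\mid a')=0$, $(a\mid a')=1$, $(a'\mid a')=0$. Tubular type: the diagram on $Q\setminus\{1^*\}$ is affine of type $\tilde D_4,\tilde E_6,\tilde E_7$ or $\tilde E_8$; let $\alpha_0\in\overline B$ be the simple root at the end vertex of an arm of maximal length (the affine node), $\tilde\alpha$ the highest root of the finite root system with simple system $\overline B\setminus\{\alpha_0\}$, $V_{\mathrm{fin}}=\mathrm{span}_{\mathbb R}(\overline B\setminus\{\alpha_0\})$, $b=\alpha_0+\tilde\alpha$, so $V=V_{\mathrm{fin}}\oplus\mathbb Ra\oplus\mathbb Rb$; let $\tilde V=V\oplus\mathbb Rb'$ with $(V_{\mathrm{fin}}\mid b')=0=(a\mid b')$, $(b\mid b')=1$, $(b'\mid b')=0$. In all types, with $\tilde s_\alpha$ the reflection of $\tilde V$ in $\alpha\in B$, $\tilde S=\{\tilde s_\alpha\mid\alpha\in B\}$ and $\tilde W=\langle\tilde S\rangle\le\mathrm{GL}(\tilde V)$, the pair $(\tilde W,\tilde S)$ is the hyperbolic cover of $(W,S)$. Extended Coxeter systems of star type: a star is a tree with at most one vertex of degree larger than $2$. Let $(\overline W,\overline S)$, $\overline S=\{s_1,\ldots,s_n\}$, be a (simply laced) Coxeter system whose Coxeter diagram $\overline\Gamma$ is a star, where $1$ labels a vertex of maximal degree (any vertex if $\overline\Gamma$ is a path). Let $\overline V$ be its geometric representation with basis of simple roots $\alpha_1,\ldots,\alpha_n$,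 $\langle\alpha_i\mid\alpha_i\rangle=2$, $\langle\alpha_i\mid\alpha_j\rangle=-1$ for adjacent $i,j$, $0$ otherwise, $\overline\Phi=\overline W\{\alpha_1,\ldots,\alpha_n\}$ and $L(\overline\Phi)=\mathrm{span}_{\mathbb Z}(\overline\Phi)$. Then $\mathcal W=\overline W\ltimes L(\overline\Phi)$, with elements $(\overline w,\lambda)$ and multiplication $(\overline w_1,\lambda_1)(\overline w_2,\lambda_2)=(\overline w_1\overline w_2,\overline w_2^{-1}(\lambda_1)+\lambda_2)$. With $s_i=(s_i,0)$ and $s_{1^*}=(s_1,\alpha_1)$, put $\mathcal S=\overline S\cup\{s_{1^*}\}$. *)

theory Defs
  imports
    "HOL-Analysis.Finite_Function_Topology"
    "HOL-Algebra.Bij"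
    "HOL-Algebra.Generated_Groups"
    "HOL-Algebra.Multiplicative_Group"
begin

section \<open>Linear groups, reflections and isomorphism of pairs\<close>

text \<open>
  A real vector space with a basis indexed by a set \<open>I\<close> is rendered as the span of the unit vectors
  \<open>simple_vec i\<close>, \<open>i \<in> I\<close>, inside the finitely supported functions, whose real vector
  space structure comes from \<^theory>\<open>HOL-Analysis.Finite_Function_Topology\<close>.
\<close>

definition simple_vec :: "'q \<Rightarrow> 'q \<Rightarrow>\<^sub>0 real" where
  "simple_vec i = Poly_Mapping.single i 1"

definition gram_form :: "('q \<Rightarrow> 'q \<Rightarrow> real) \<Rightarrow> ('q \<Rightarrow>\<^sub>0 real) \<Rightarrow> ('q \<Rightarrow>\<^sub>0 real) \<Rightarrow> real" where
  "gram_form g u v =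
     (\<Sum>i\<in>Poly_Mapping.keys u. \<Sum>j\<in>Poly_Mapping.keys v.
        Poly_Mapping.lookup u i * Poly_Mapping.lookup v j * g i j)"

text \<open>
  As in \<^const>\<open>BijGroup\<close>, the elements of \<open>GL(V)\<close> are extensional functions, i.e.\ undefined
  outside the subspace \<open>V\<close>.
\<close>

definition gen_lin :: "'v::real_vector set \<Rightarrow> ('v \<Rightarrow> 'v) monoid" where
  "gen_lin V = BijGroup V
     \<lparr>carrier := {f \<in> Bij V. (\<forall>u\<in>V. \<forall>v\<in>V. f (u + v) = f u + f v) \<and>
                              (\<forall>c. \<forall>v\<in>V. f (c *\<^sub>R v) = c *\<^sub>R f v)}\<rparr>"

definition reflection ::
    "'v::real_vector set \<Rightarrow> ('v \<Rightarrow> 'v \<Rightarrow> real) \<Rightarrow> 'v \<Rightarrow> 'v \<Rightarrow> 'v" where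
  "reflection V F a = (\<lambda>v\<in>V. v - (2 * F a v / F a a) *\<^sub>R a)"

definition pair_isomorphic ::
    "('a, 'm) monoid_scheme \<Rightarrow> 'a set \<Rightarrow> ('b, 'n) monoid_scheme \<Rightarrow> 'b set \<Rightarrow> bool" where
  "pair_isomorphic G X G' X' \<longleftrightarrow> (\<exists>h\<in>iso G G'. bij_betw h X X')"

definition has_signature ::
    "'v::real_vector set \<Rightarrow> ('v \<Rightarrow> 'v \<Rightarrow> real) \<Rightarrow> nat \<times> nat \<times> nat \<Rightarrow> bool" where
  "has_signature V F = (\<lambda>(pos, neg, zero).
     \<exists>D. finite D \<and> independent D \<and> span D = V \<and>
         (\<forall>x\<in>D. \<forall>y\<in>D. x \<noteq> y \<longrightarrow> F x y = 0) \<and>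
         card {x\<in>D. F x x > 0} = pos \<and>
         card {x\<in>D. F x x < 0} = neg \<and>
         card {x\<in>D. F x x = 0} = zero)"


section \<open>Extended Weyl systems\<close>

text \<open>
  The parameters \<open>r\<close> and \<open>p\<^sub>1, \<dots>, p\<^sub>r\<close> are given by the list \<open>p = [p\<^sub>1, \<dots>, p\<^sub>r]\<close>. Arms are
  numbered from \<open>0\<close>: the vertex \<open>(i, j)\<close> of the diagram is \<open>Arm (i - 1) j\<close>.
\<close>

datatype vertex = Centre | CentreStar | Arm nat nat

definition diagram_vertices_bar :: "nat list \<Rightarrow> vertex set" where
  "diagram_vertices_bar p = {Centre} \<union> {Arm i j | i j. i < length p \<and> 1 \<le> j \<and> j \<le> p ! i}"

definition diagram_vertices :: "nat list \<Rightarrow> vertex set" where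
  "diagram_vertices p = insert CentreStar (diagram_vertices_bar p)"

definition single_edge :: "vertex \<Rightarrow> vertex \<Rightarrow> bool" where
  "single_edge x y \<longleftrightarrow>
     (\<exists>i j. {x, y} = {Arm i j, Arm i (j + 1)}) \<or>
     (\<exists>i. {x, y} = {Centre, Arm i 1}) \<or>
     (\<exists>i. {x, y} = {CentreStar, Arm i 1})"

definition weyl_gram :: "vertex \<Rightarrow> vertex \<Rightarrow> real" where
  "weyl_gram x y =
     (if x = y \<or> {x, y} = {Centre, CentreStar} then 2
      else if single_edge x y then - 1 else 0)"

abbreviation weyl_form :: "(vertex \<Rightarrow>\<^sub>0 real) \<Rightarrow> (vertex \<Rightarrow>\<^sub>0 real) \<Rightarrow> real" where
  "weyl_form \<equiv> gram_form weyl_gram"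

definition weyl_basis :: "nat list \<Rightarrow> (vertex \<Rightarrow>\<^sub>0 real) set" where
  "weyl_basis p = simple_vec ` diagram_vertices p"

definition weyl_basis_bar :: "nat list \<Rightarrow> (vertex \<Rightarrow>\<^sub>0 real) set" where
  "weyl_basis_bar p = weyl_basis p - {simple_vec CentreStar}"

definition weyl_space :: "nat list \<Rightarrow> (vertex \<Rightarrow>\<^sub>0 real) set" where
  "weyl_space p = span (weyl_basis p)"

definition extended_Weyl_system ::
    "nat list \<Rightarrow> ((vertex \<Rightarrow>\<^sub>0 real) \<Rightarrow> (vertex \<Rightarrow>\<^sub>0 real)) monoid \<Rightarrow>
     ((vertex \<Rightarrow>\<^sub>0 real) \<Rightarrow> (vertex \<Rightarrow>\<^sub>0 real)) set \<Rightarrow> bool" where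
  "extended_Weyl_system p W S \<longleftrightarrow>
     (\<forall>k\<in>set p. 1 \<le> k) \<and>
     S = reflection (weyl_space p) weyl_form ` weyl_basis p \<and>
     W = gen_lin (weyl_space p) \<lparr>carrier := generate (gen_lin (weyl_space p)) S\<rparr>"

definition wild_type :: "nat list \<Rightarrow> bool" where
  "wild_type p \<longleftrightarrow> has_signature (weyl_space p) weyl_form (card (weyl_basis p) - 2, 1, 1)"

definition tubular_type :: "nat list \<Rightarrow> bool" where
  "tubular_type p \<longleftrightarrow> has_signature (weyl_space p) weyl_form (card (weyl_basis p) - 2, 0, 2)"

definition domestic_type :: "nat list \<Rightarrow> bool" where
  "domestic_type p \<longleftrightarrow> has_signature (weyl_space p) weyl_form (card (weyl_basis p) - 1, 0, 1)"


section \<open>Hyperbolic covers\<close>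

definition root_system_of ::
    "('v::real_vector \<Rightarrow> 'v \<Rightarrow> real) \<Rightarrow> 'v set \<Rightarrow> 'v set" where
  "root_system_of F \<Delta> =
     {w \<beta> | w \<beta>. w \<in> generate (gen_lin (span \<Delta>)) (reflection (span \<Delta>) F ` \<Delta>) \<and> \<beta> \<in> \<Delta>}"

definition is_highest_root ::
    "('v::real_vector \<Rightarrow> 'v \<Rightarrow> real) \<Rightarrow> 'v set \<Rightarrow> 'v \<Rightarrow> bool" where
  "is_highest_root F \<Delta> \<theta> \<longleftrightarrow>
     \<theta> \<in> root_system_of F \<Delta> \<and>
     (\<forall>\<beta>\<in>root_system_of F \<Delta>. \<exists>c. (\<forall>\<gamma>\<in>\<Delta>. 0 \<le> c \<gamma>) \<and> \<theta> - \<beta> = (\<Sum>\<gamma>\<in>\<Delta>. c \<gamma> *\<^sub>R \<gamma>))"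

text \<open>
  The space \<open>V \<oplus> \<real>a'\<close> (respectively \<open>V \<oplus> \<real>b'\<close>) is \<open>V \<times> \<real>\<close>, where \<open>v \<in> V\<close> is identified with
  \<open>(v, 0)\<close> and \<open>a'\<close> (respectively \<open>b'\<close>) is \<open>(0, 1)\<close>.
\<close>

type_synonym cover_vec = "(vertex \<Rightarrow>\<^sub>0 real) \<times> real"

definition cover_space :: "nat list \<Rightarrow> cover_vec set" where
  "cover_space p = weyl_space p \<times> UNIV"

definition radical_a :: "vertex \<Rightarrow>\<^sub>0 real" where
  "radical_a = simple_vec CentreStar - simple_vec Centre"

definition is_affine_node :: "nat list \<Rightarrow> vertex \<Rightarrow> bool" where
  "is_affine_node p x \<longleftrightarrow> (\<exists>i<length p. p ! i = Max (set p) \<and> x = Arm i (p ! i))"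

definition sym_bilinear_on ::
    "'v::real_vector set \<Rightarrow> ('v \<Rightarrow> 'v \<Rightarrow> real) \<Rightarrow> bool" where
  "sym_bilinear_on V F \<longleftrightarrow>
     (\<forall>u\<in>V. \<forall>v\<in>V. F u v = F v u) \<and>
     (\<forall>u\<in>V. \<forall>v\<in>V. \<forall>w\<in>V. F (u + v) w = F u w + F v w) \<and>
     (\<forall>c. \<forall>u\<in>V. \<forall>v\<in>V. F (c *\<^sub>R u) v = c * F u v)"

text \<open>
  Several arms may have maximal length, so the form is not determined by \<open>p\<close> alone in the tubular
  case: every choice of the affine node is admitted.
\<close>

definition is_cover_form :: "nat list \<Rightarrow> (cover_vec \<Rightarrow> cover_vec \<Rightarrow> real) \<Rightarrow> bool" where
  "is_cover_form p F \<longleftrightarrow>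
     sym_bilinear_on (cover_space p) F \<and>
     (\<forall>u\<in>weyl_space p. \<forall>v\<in>weyl_space p. F (u, 0) (v, 0) = weyl_form u v) \<and>
     F (0, 1) (0, 1) = 0 \<and>
     ((domestic_type p \<or> wild_type p) \<and>
        (\<forall>v\<in>span (weyl_basis_bar p). F (v, 0) (0, 1) = 0) \<and>
        F (radical_a, 0) (0, 1) = 1
      \<or>
      tubular_type p \<and>
        (\<exists>x \<theta>. is_affine_node p x \<and>
           is_highest_root weyl_form (weyl_basis_bar p - {simple_vec x}) \<theta> \<and>
           (\<forall>v\<in>span (weyl_basis_bar p - {simple_vec x}). F (v, 0) (0, 1) = 0) \<and>
           F (radical_a, 0) (0, 1) = 0 \<and>
           F (simple_vec x + \<theta>, 0) (0, 1) = 1))"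

definition hyperbolic_cover ::
    "nat list \<Rightarrow> (cover_vec \<Rightarrow> cover_vec) monoid \<Rightarrow> (cover_vec \<Rightarrow> cover_vec) set \<Rightarrow> bool" where
  "hyperbolic_cover p H X \<longleftrightarrow>
     (\<exists>F. is_cover_form p F \<and>
          X = (\<lambda>\<alpha>. reflection (cover_space p) F (\<alpha>, 0)) ` weyl_basis p \<and>
          H = gen_lin (cover_space p) \<lparr>carrier := generate (gen_lin (cover_space p)) X\<rparr>)"


section \<open>Coxeter systems\<close>

text \<open>The order of \<open>st\<close>; by the convention of \<^const>\<open>group.ord\<close>, the value \<open>0\<close> stands for \<open>\<infinity>\<close>.\<close>

definition coxeter_entry :: "('g, 'm) monoid_scheme \<Rightarrow> 'g \<Rightarrow> 'g \<Rightarrow> nat" where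
  "coxeter_entry G s t = group.ord G (s \<otimes>\<^bsub>G\<^esub> t)"

definition word_value :: "('g, 'm) monoid_scheme \<Rightarrow> 'g list \<Rightarrow> 'g" where
  "word_value G ws = foldr (\<otimes>\<^bsub>G\<^esub>) ws \<one>\<^bsub>G\<^esub>"

text \<open>
  The congruence on words over \<open>S\<close> generated by \<open>(st)\<^bsup>m(s,t)\<^esup> = 1\<close> for \<open>m(s,t)\<close> finite. Its relations
  for \<open>s = t\<close> are \<open>s\<^sup>2 = 1\<close>, so formal inverses are not needed: the words modulo this congruence
  form the group presented by the Coxeter relations. For \<open>m(s,t) = 0\<close>, i.e.\ infinite order, the
  inserted word is empty.
\<close>

inductive coxeter_equiv :: "('g, 'm) monoid_scheme \<Rightarrow> 'g set \<Rightarrow> 'g list \<Rightarrow> 'g list \<Rightarrow> bool"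
  for G S where
  refl: "coxeter_equiv G S ws ws"
| sym: "coxeter_equiv G S us vs \<Longrightarrow> coxeter_equiv G S vs us"
| trans: "coxeter_equiv G S us vs \<Longrightarrow> coxeter_equiv G S vs ws \<Longrightarrow> coxeter_equiv G S us ws"
| relator: "s \<in> S \<Longrightarrow> t \<in> S \<Longrightarrow>
    coxeter_equiv G S (us @ concat (replicate (coxeter_entry G s t) [s, t]) @ vs) (us @ vs)"

definition coxeter_system :: "('g, 'm) monoid_scheme \<Rightarrow> 'g set \<Rightarrow> bool" where
  "coxeter_system G S \<longleftrightarrow>
     group G \<and> S \<subseteq> carrier G \<and> generate G S = carrier G \<and>
     (\<forall>s\<in>S. group.ord G s = 2) \<and>
     (\<forall>us\<in>lists S. \<forall>vs\<in>lists S.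
        word_value G us = word_value G vs \<longleftrightarrow> coxeter_equiv G S us vs)"

definition simply_laced :: "('g, 'm) monoid_scheme \<Rightarrow> 'g set \<Rightarrow> bool" where
  "simply_laced G S \<longleftrightarrow> (\<forall>s\<in>S. \<forall>t\<in>S. s \<noteq> t \<longrightarrow> coxeter_entry G s t \<in> {2, 3})"

definition coxeter_edge :: "('g, 'm) monoid_scheme \<Rightarrow> 'g \<Rightarrow> 'g \<Rightarrow> bool" where
  "coxeter_edge G s t \<longleftrightarrow> s \<noteq> t \<and> coxeter_entry G s t \<noteq> 2"

definition degree_in :: "'v set \<Rightarrow> ('v \<Rightarrow> 'v \<Rightarrow> bool) \<Rightarrow> 'v \<Rightarrow> nat" where
  "degree_in V E x = card {y\<in>V. E x y}"

text \<open>Trees, stars and paths among the finite simple graphs, \<open>E\<close> being irreflexive and symmetric.\<close>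

definition is_tree :: "'v set \<Rightarrow> ('v \<Rightarrow> 'v \<Rightarrow> bool) \<Rightarrow> bool" where
  "is_tree V E \<longleftrightarrow>
     finite V \<and> V \<noteq> {} \<and>
     (\<forall>x\<in>V. \<forall>y\<in>V. (x, y) \<in> {(u, v). u \<in> V \<and> v \<in> V \<and> E u v}\<^sup>*) \<and>
     \<not> (\<exists>xs. set xs \<subseteq> V \<and> distinct xs \<and> 3 \<le> length xs \<and>
              successively E xs \<and> E (last xs) (hd xs))"

definition is_star :: "'v set \<Rightarrow> ('v \<Rightarrow> 'v \<Rightarrow> bool) \<Rightarrow> bool" where
  "is_star V E \<longleftrightarrow> is_tree V E \<and> card {x\<in>V. 2 < degree_in V E x} \<le> 1"

definition is_path :: "'v set \<Rightarrow> ('v \<Rightarrow> 'v \<Rightarrow> bool) \<Rightarrow> bool" where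
  "is_path V E \<longleftrightarrow> is_tree V E \<and> (\<forall>x\<in>V. degree_in V E x \<le> 2)"


section \<open>Extended Coxeter systems of star type\<close>

text \<open>
  The simple reflections themselves serve as indices: \<open>S = {s\<^sub>1, \<dots>, s\<^sub>n}\<close> and \<open>\<alpha>\<^sub>i\<close> is
  \<open>simple_vec s\<^sub>i\<close>. The element \<open>c \<in> S\<close> is the one labelled \<open>1\<close>.
\<close>

definition star_coxeter_datum :: "('g, 'm) monoid_scheme \<Rightarrow> 'g set \<Rightarrow> 'g \<Rightarrow> bool" where
  "star_coxeter_datum G S c \<longleftrightarrow>
     coxeter_system G S \<and> simply_laced G S \<and> is_star S (coxeter_edge G) \<and> c \<in> S \<and>
     (is_path S (coxeter_edge G) \<or>
      (\<forall>s\<in>S. degree_in S (coxeter_edge G) s \<le> degree_in S (coxeter_edge G) c))"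

definition geom_gram :: "('g, 'm) monoid_scheme \<Rightarrow> 'g \<Rightarrow> 'g \<Rightarrow> real" where
  "geom_gram G s t = (if s = t then 2 else if coxeter_edge G s t then - 1 else 0)"

definition geom_space :: "'g set \<Rightarrow> ('g \<Rightarrow>\<^sub>0 real) set" where
  "geom_space S = span (simple_vec ` S)"

text \<open>
  The geometric representation, i.e.\ the homomorphism into \<open>GL\<close> sending each \<open>s \<in> S\<close> to the
  reflection in \<open>\<alpha>\<^sub>s\<close>. On the carrier of a Coxeter group it exists and is unique.
\<close>

definition geom_rep ::
    "('g, 'm) monoid_scheme \<Rightarrow> 'g set \<Rightarrow> 'g \<Rightarrow> ('g \<Rightarrow>\<^sub>0 real) \<Rightarrow> ('g \<Rightarrow>\<^sub>0 real)" where
  "geom_rep G S = (SOME \<rho>. \<rho> \<in> hom G (gen_lin (geom_space S)) \<and>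
     (\<forall>s\<in>S. \<rho> s = reflection (geom_space S) (gram_form (geom_gram G)) (simple_vec s)))"

definition coxeter_roots :: "('g, 'm) monoid_scheme \<Rightarrow> 'g set \<Rightarrow> ('g \<Rightarrow>\<^sub>0 real) set" where
  "coxeter_roots G S = {geom_rep G S w (simple_vec s) | w s. w \<in> carrier G \<and> s \<in> S}"

definition root_lattice :: "('g, 'm) monoid_scheme \<Rightarrow> 'g set \<Rightarrow> ('g \<Rightarrow>\<^sub>0 real) set" where
  "root_lattice G S = module.span (\<lambda>(k::int) v. real_of_int k *\<^sub>R v) (coxeter_roots G S)"

definition extended_coxeter_group ::
    "('g, 'm) monoid_scheme \<Rightarrow> 'g set \<Rightarrow> ('g \<times> ('g \<Rightarrow>\<^sub>0 real)) monoid" where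
  "extended_coxeter_group G S =
     \<lparr>carrier = carrier G \<times> root_lattice G S,
      mult = (\<lambda>(w\<^sub>1, x\<^sub>1) (w\<^sub>2, x\<^sub>2).
        (w\<^sub>1 \<otimes>\<^bsub>G\<^esub> w\<^sub>2, geom_rep G S (inv\<^bsub>G\<^esub> w\<^sub>2) x\<^sub>1 + x\<^sub>2)),
      one = (\<one>\<^bsub>G\<^esub>, 0)\<rparr>"

definition extended_coxeter_gens :: "'g set \<Rightarrow> 'g \<Rightarrow> ('g \<times> ('g \<Rightarrow>\<^sub>0 real)) set" where
  "extended_coxeter_gens S c = (\<lambda>s. (s, 0)) ` S \<union> {(c, simple_vec c)}"

end

theory Submission
  imports Defs "HOL-Analysis.Linear_Algebra"
begin

text \<open>
  Let \<open>a\<close> be the difference of the two double vertices. It is isotropic and orthogonal to the simple roots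
  of the star, so on the cover the reflection in \<open>\<alpha>\<^sub>1 + a\<close> is the reflection in \<open>\<alpha>\<^sub>1\<close> times the Eichler
  transvection of \<open>\<alpha>\<^sub>1\<close> along \<open>a\<close>. The transvections of lattice vectors form an abelian group on which the
  Weyl group of the star acts as on the lattice, and \<open>(w, \<lambda>) \<mapsto> w E\<^sub>\<lambda>\<close> is the isomorphism. The orbit of
  \<open>\<alpha>\<^sub>1\<close> spans the lattice because the diagram is connected. Injectivity rests on Tits' theorem that
  the geometric representation is faithful and on the extra coordinate of the cover. In the tubular
  case the latter is the coefficient at the affine node: a radical vector with this coefficient zero
  vanishes, by the linear recursion along the arms.
\<close>

subsection \<open>Gram forms and reflections\<close>

text \<open>Tits' theorem is proved for words modulo the Coxeter congruence, in a group about whose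
  generators only the orders of pairwise products are known. This form serves twice: for the given
  Coxeter system, and for the converse, where a Coxeter group with prescribed diagram has to be
  made. There the reflection group of the star is taken, and faithfulness is what shows that the
  Coxeter relations present it.

  The covers of all types are handled at once, because pairing with the extra basis vector is a
  coordinate functional: the coordinate at the starred vertex, or at the affine node in the tubular
  type, whatever the highest root is. The extra vector separates transvections: inside V the vector
  a is radical, so the transvection of \<lambda> remembers only the functional (\<lambda>|.), and
  radical vectors of a tubular star would act trivially.

  Existence of a tubular cover requires a highest root. It is \<delta> - \<alpha>_0 with \<delta>
  the smallest positive integral radical vector, whose coefficients decrease linearly along each
  arm.\<close>

abbreviation "lookup \<equiv> Poly_Mapping.lookup"
abbreviation "keys \<equiv> Poly_Mapping.keys"
abbreviation "bar \<equiv> diagram_vertices_bar"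

lemma lookup_scaleR [simp]:
  fixes v :: "'q \<Rightarrow>\<^sub>0 real"
  shows "lookup (c *\<^sub>R v) i = c * lookup v i"
proof -
  have "finite {i. c * lookup v i \<noteq> 0}"
    by (rule finite_subset[OF _ finite_keys[of v]]) (auto simp: in_keys_iff)
  then show ?thesis
    by (simp add: scaleR_poly_mapping_def)
qed

lemma lookup_simple_vec: "lookup (simple_vec i) j = (if i = j then 1 else 0)"
  by (simp add: simple_vec_def lookup_single)

lemma inj_simple_vec: "inj simple_vec"
  by (rule injI) (metis lookup_simple_vec zero_neq_one)

lemma simple_vec_eq_iff [simp]: "simple_vec i = simple_vec j \<longleftrightarrow> i = j"
  using inj_simple_vec by (auto dest: injD)

lemma keys_sum_simple_vec: "keys (\<Sum>i\<in>A. c i *\<^sub>R simple_vec i) \<subseteq> A"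
proof
  fix k assume "k \<in> keys (\<Sum>i\<in>A. c i *\<^sub>R simple_vec i)"
  then have "(\<Sum>i\<in>A. c i * (if i = k then 1 else 0)) \<noteq> 0"
    by (simp add: in_keys_iff lookup_sum lookup_simple_vec)
  moreover have "(\<Sum>i\<in>A. c i * (if i = k then 1 else 0 :: real)) = 0" if "k \<notin> A"
    using that by (intro sum.neutral) auto
  ultimately show "k \<in> A" by blast
qed

lemma lookup_sum_simple_vec:
  assumes "finite A"
  shows "lookup (\<Sum>i\<in>A. c i *\<^sub>R simple_vec i) k = (if k \<in> A then c k else 0)"
  using assms by (simp add: lookup_sum lookup_simple_vec if_distrib[of "(*) _"] cong: if_cong)

lemma simple_vec_expansion:
  assumes "finite A" "keys v \<subseteq> A"
  shows "v = (\<Sum>i\<in>A. lookup v i *\<^sub>R simple_vec i)"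
  using assms by (intro poly_mapping_eqI) (auto simp: lookup_sum_simple_vec in_keys_iff)

lemma in_span_simple_vec: "v \<in> span (simple_vec ` A) \<longleftrightarrow> keys v \<subseteq> A"
proof
  assume "v \<in> span (simple_vec ` A)"
  moreover have "subspace {v :: 'a \<Rightarrow>\<^sub>0 real. keys v \<subseteq> A}"
    by (auto simp: subspace_def in_keys_iff subset_iff lookup_add) (metis add.right_neutral)
  moreover have "simple_vec ` A \<subseteq> {v. keys v \<subseteq> A}"
    by (auto simp: in_keys_iff lookup_simple_vec split: if_splits)
  ultimately show "keys v \<subseteq> A"
    using span_minimal by blast
next
  assume A: "keys v \<subseteq> A"
  have "(\<Sum>i\<in>keys v. lookup v i *\<^sub>R simple_vec i) \<in> span (simple_vec ` A)"
    using A by (intro span_sum span_scale span_base) auto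
  then show "v \<in> span (simple_vec ` A)"
    using simple_vec_expansion[of "keys v" v] by simp
qed

lemma independent_simple_vec: "independent (simple_vec ` A)"
  unfolding dependent_def
proof clarify
  fix i assume i: "i \<in> A" "simple_vec i \<in> span (simple_vec ` A - {simple_vec i})"
  have "simple_vec ` A - {simple_vec i} = simple_vec ` (A - {i})" by auto
  then have "keys (simple_vec i) \<subseteq> A - {i}"
    using i by (metis in_span_simple_vec)
  moreover have "i \<in> keys (simple_vec i)"
    by (simp add: in_keys_iff lookup_simple_vec)
  ultimately show False by blast
qed

text \<open>The defining sum runs over the supports, which change under addition. A common larger
  index set turns bilinearity into a computation with fixed sums.\<close>

lemma gram_form_superset:
  assumes "finite A" "finite B" "keys u \<subseteq> A" "keys v \<subseteq> B"
  shows "gram_form g u v =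
    (\<Sum>i\<in>A. \<Sum>j\<in>B. lookup u i * lookup v j * g i j)"
proof -
  have "gram_form g u v =
      (\<Sum>i\<in>keys u. \<Sum>j\<in>B. lookup u i * lookup v j * g i j)"
    unfolding gram_form_def
    using assms by (intro sum.cong refl sum.mono_neutral_left) (auto simp: in_keys_iff)
  also have "\<dots> = (\<Sum>i\<in>A. \<Sum>j\<in>B. lookup u i * lookup v j * g i j)"
    using assms by (intro sum.mono_neutral_left) (auto simp: in_keys_iff)
  finally show ?thesis .
qed

lemma gram_form_swap: "gram_form g u v = gram_form (\<lambda>i j. g j i) v u"
  unfolding gram_form_def by (subst sum.swap) (simp add: mult.commute)

lemma bilinear_gram_form: "bilinear (gram_form g)"
proof -
  have left: "linear (\<lambda>x. gram_form g x u)" for g and u :: "'a \<Rightarrow>\<^sub>0 real"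
  proof (rule linearI)
    fix v w :: "'a \<Rightarrow>\<^sub>0 real"
    let ?B = "keys v \<union> keys w"
    have "keys (v + w) \<subseteq> ?B" by (rule keys_add)
    then show "gram_form g (v + w) u = gram_form g v u + gram_form g w u"
      using gram_form_superset[of ?B "keys u" _ u g]
      by (simp add: lookup_add distrib_left distrib_right sum.distrib)
  next
    fix c and v :: "'a \<Rightarrow>\<^sub>0 real"
    have "keys (c *\<^sub>R v) \<subseteq> keys v"
      by (auto simp: in_keys_iff)
    then show "gram_form g (c *\<^sub>R v) u = c *\<^sub>R gram_form g v u"
      using gram_form_superset[of "keys v" "keys u" _ u g]
      by (simp add: sum_distrib_left mult.left_commute mult.assoc)
  qed
  have "linear (gram_form g u)" for u :: "'a \<Rightarrow>\<^sub>0 real"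
    using left[of "\<lambda>i j. g j i" u] by (simp add: gram_form_swap[of g u, abs_def])
  then show ?thesis using left by (simp add: bilinear_def)
qed

lemma gram_form_simple_vec: "gram_form g (simple_vec i) (simple_vec j) = g i j"
  using gram_form_superset[of "{i}" "{j}" "simple_vec i" "simple_vec j" g]
  by (simp add: simple_vec_def)

lemma gram_form_simple_vec_left:
  assumes "finite A" "keys v \<subseteq> A"
  shows "gram_form g (simple_vec i) v = (\<Sum>j\<in>A. lookup v j * g i j)"
  using gram_form_superset[of "{i}" A "simple_vec i" v g] assms
  by (simp add: simple_vec_def)

lemma gram_form_commute:
  assumes "\<And>i j. g i j = g j i"
  shows "gram_form g u v = gram_form g v u"
  using gram_form_swap[of g u v] assms by simp

text \<open>The denominator of \<open>reflection\<close> is dropped, since every root here has norm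
  2, and the map is total on the ambient type. Identities can so be checked without membership
  conditions; \<open>restrict\<close> re-enters only for elements of \<open>gen_lin\<close>.\<close>

definition root_refl :: "('v::real_vector \<Rightarrow> 'v \<Rightarrow> real) \<Rightarrow> 'v \<Rightarrow> 'v \<Rightarrow> 'v" where
  "root_refl F b v = v - F b v *\<^sub>R b"

text \<open>Letters are labels, and \<beta> says which vectors they stand for: the same word acts in
  the geometric representation, on the space of the diagram and on the cover.\<close>

definition word_refl ::
    "('v::real_vector \<Rightarrow> 'v \<Rightarrow> real) \<Rightarrow> ('s \<Rightarrow> 'v) \<Rightarrow> 's list \<Rightarrow> 'v \<Rightarrow> 'v" where
  "word_refl F \<beta> ws = foldr (\<lambda>s. root_refl F (\<beta> s)) ws"

lemma word_refl_Nil [simp]: "word_refl F \<beta> [] v = v"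
  by (simp add: word_refl_def)

lemma word_refl_Cons [simp]: "word_refl F \<beta> (s # ws) v = root_refl F (\<beta> s) (word_refl F \<beta> ws v)"
  by (simp add: word_refl_def)

lemma word_refl_append [simp]:
  "word_refl F \<beta> (us @ vs) v = word_refl F \<beta> us (word_refl F \<beta> vs v)"
  by (simp add: word_refl_def)

lemma reflection_eq_restrict:
  "F b b = 2 \<Longrightarrow> reflection V F b = restrict (root_refl F b) V"
  by (rule ext) (simp add: reflection_def root_refl_def)

locale sym_form =
  fixes F :: "'v::real_vector \<Rightarrow> 'v \<Rightarrow> real"
  assumes bilinear: "bilinear F" and sym: "F u v = F v u"
begin

lemmas form_simps = bilinear_ladd[OF bilinear] bilinear_radd[OF bilinear]
  bilinear_lmul[OF bilinear] bilinear_rmul[OF bilinear]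
  bilinear_lsub[OF bilinear] bilinear_rsub[OF bilinear]
  bilinear_lneg[OF bilinear] bilinear_rneg[OF bilinear]
  bilinear_lzero[OF bilinear] bilinear_rzero[OF bilinear]

lemma form_sum_left: "F (\<Sum>i\<in>A. k i *\<^sub>R b i) v = (\<Sum>i\<in>A. k i * F (b i) v)"
  using bilinear unfolding bilinear_def
  by (simp add: linear_sum[of "\<lambda>x. F x v"] linear_scale[of "\<lambda>x. F x v"])

lemma form_sum_right: "F v (\<Sum>i\<in>A. k i *\<^sub>R b i) = (\<Sum>i\<in>A. k i * F v (b i))"
  using form_sum_left[of k b A v] sym by simp

lemma linear_root_refl: "linear (root_refl F b)"
  by (rule linearI) (simp_all add: root_refl_def form_simps algebra_simps)

lemma root_refl_isometry:
  assumes "F b b = 2"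
  shows "F (root_refl F b u) (root_refl F b v) = F u v"
  using assms sym[of u b] by (simp add: root_refl_def form_simps algebra_simps)

lemma root_refl_involution [simp]:
  assumes "F b b = 2"
  shows "root_refl F b (root_refl F b v) = v"
proof -
  have "F b (v - F b v *\<^sub>R b) = - F b v"
    using assms by (simp add: form_simps)
  then show ?thesis
    by (simp add: root_refl_def)
qed

lemma root_refl_commute:
  assumes "F b c = 0"
  shows "root_refl F b (root_refl F c v) = root_refl F c (root_refl F b v)"
  using assms sym[of c b] by (simp add: root_refl_def form_simps algebra_simps)

text \<open>Both sides are the reflection in b + c, an expression symmetric in b and c.\<close>

lemma root_refl_braid:
  assumes "F b b = 2" "F c c = 2" "F b c = - 1"
  shows "root_refl F b (root_refl F c (root_refl F b v)) =
         root_refl F c (root_refl F b (root_refl F c v))"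
proof -
  have *: "root_refl F b (root_refl F c (root_refl F b v)) = v - (F b v + F c v) *\<^sub>R (b + c)"
    if "F b b = 2" "F b c = - 1" for b c
  proof -
    have "F c b = - 1" using that sym[of c b] by simp
    then have "root_refl F c (root_refl F b v) = v - F b v *\<^sub>R b - (F b v + F c v) *\<^sub>R c"
      by (simp add: root_refl_def form_simps)
    moreover have "F b (v - F b v *\<^sub>R b - (F b v + F c v) *\<^sub>R c) = F c v"
      using that by (simp add: form_simps)
    ultimately have "root_refl F b (root_refl F c (root_refl F b v)) =
        v - F b v *\<^sub>R b - (F b v + F c v) *\<^sub>R c - F c v *\<^sub>R b"
      by (simp add: root_refl_def[of F b "v - _ - _"])
    then show ?thesis by (simp add: algebra_simps)
  qed
  show ?thesis
    using *[of b c] *[of c b] assms sym[of c b] by (simp add: add.commute)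
qed

lemma linear_word_refl: "linear (word_refl F \<beta> ws)"
proof (induction ws)
  case Nil
  show ?case by (rule linearI) simp_all
next
  case (Cons s ws)
  have "word_refl F \<beta> (s # ws) = root_refl F (\<beta> s) \<circ> word_refl F \<beta> ws" by auto
  then show ?case using Cons linear_root_refl by (metis linear_compose)
qed

lemma word_refl_isometry:
  assumes "\<And>s. s \<in> set ws \<Longrightarrow> F (\<beta> s) (\<beta> s) = 2"
  shows "F (word_refl F \<beta> ws u) (word_refl F \<beta> ws v) = F u v"
  using assms by (induction ws) (simp_all add: root_refl_isometry)

lemma word_refl_rev:
  assumes "\<And>s. s \<in> set ws \<Longrightarrow> F (\<beta> s) (\<beta> s) = 2"
  shows "word_refl F \<beta> (rev ws) (word_refl F \<beta> ws v) = v"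
  using assms by (induction ws) simp_all

lemma word_refl_rev':
  assumes "\<And>s. s \<in> set ws \<Longrightarrow> F (\<beta> s) (\<beta> s) = 2"
  shows "word_refl F \<beta> ws (word_refl F \<beta> (rev ws) v) = v"
  using word_refl_rev[of "rev ws" \<beta> v] assms by simp

lemma word_refl_fixes:
  assumes "\<And>s. s \<in> set ws \<Longrightarrow> F (\<beta> s) v = 0"
  shows "word_refl F \<beta> ws v = v"
  using assms by (induction ws) (simp_all add: root_refl_def)

lemma word_refl_in_subspace:
  assumes "subspace U" "\<And>s. s \<in> set ws \<Longrightarrow> \<beta> s \<in> U" "v \<in> U"
  shows "word_refl F \<beta> ws v \<in> U"
  using assms(2,3)
  by (induction ws) (simp_all add: root_refl_def assms(1) subspace_diff subspace_scale)

end

subsection \<open>The geometric representation of a simply laced Coxeter system is faithful\<close>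

text \<open>Weaker than a Coxeter system: the orders of products of two generators are prescribed,
  but not that these relations present the group. The reflection group of a diagram can thus be fed
  into Tits' argument before it is known to be a Coxeter group.\<close>

locale simply_laced_gens =
  fixes G :: "('g, 'm) monoid_scheme" (structure) and S :: "'g set"
  assumes group: "group G" and gens_carrier: "S \<subseteq> carrier G"
    and gens_order: "s \<in> S \<Longrightarrow> group.ord G s = 2"
    and laced: "simply_laced G S" and finite_gens: "finite S"
begin

sublocale group G by (rule group)

abbreviation equ (infix "\<frown>" 50) where "us \<frown> vs \<equiv> coxeter_equiv G S us vs"

lemma gen_square: "s \<in> S \<Longrightarrow> s \<otimes>\<^bsub>G\<^esub> s = \<one>\<^bsub>G\<^esub>"
  using gens_order[of s] gens_carrier pow_ord_eq_1[of s]
  by (auto simp: numeral_2_eq_2)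

lemma entry_same: "s \<in> S \<Longrightarrow> coxeter_entry G s s = 1"
  by (simp add: coxeter_entry_def gen_square ord_id)

lemma gen_inv: "s \<in> S \<Longrightarrow> inv s = s"
  using gen_square gens_carrier by (metis inv_equality subsetD)

lemma entry_commute:
  assumes "s \<in> S" "t \<in> S" shows "coxeter_entry G s t = coxeter_entry G t s"
proof -
  have "inv (s \<otimes> t) = t \<otimes> s"
    using assms gens_carrier gen_inv by (simp add: inv_mult_group subset_iff)
  then show ?thesis
    using assms gens_carrier ord_inv[of "s \<otimes> t"] m_closed[of s t]
    by (simp add: coxeter_entry_def subset_iff)
qed

lemma edge_commute: "s \<in> S \<Longrightarrow> t \<in> S \<Longrightarrow> coxeter_edge G s t \<longleftrightarrow> coxeter_edge G t s"
  using entry_commute by (auto simp: coxeter_edge_def)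

lemma entry_edge: "s \<in> S \<Longrightarrow> t \<in> S \<Longrightarrow> coxeter_edge G s t \<Longrightarrow> coxeter_entry G s t = 3"
  using laced by (auto simp: coxeter_edge_def simply_laced_def)

lemma entry_no_edge:
  "s \<in> S \<Longrightarrow> t \<in> S \<Longrightarrow> s \<noteq> t \<Longrightarrow> \<not> coxeter_edge G s t \<Longrightarrow> coxeter_entry G s t = 2"
  by (auto simp: coxeter_edge_def)

section \<open>Calculus of words modulo the Coxeter relations\<close>

lemma equ_append:
  assumes "us \<frown> vs" shows "xs @ us @ ys \<frown> xs @ vs @ ys"
  using assms
proof induction
  case (relator s t us vs)
  then show ?case
    using coxeter_equiv.relator[of s S t G "xs @ us" "vs @ ys"] by simp
qed (blast intro: coxeter_equiv.intros)+

lemma equ_double: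
  assumes "us \<frown> us'" "vs \<frown> vs'" shows "us @ vs \<frown> us' @ vs'"
  using equ_append[OF assms(1), of "[]" vs] equ_append[OF assms(2), of us' "[]"]
  by (auto intro: coxeter_equiv.trans)

lemma equ_square: "s \<in> S \<Longrightarrow> [s, s] \<frown> []"
  using coxeter_equiv.relator[of s S s G "[]" "[]"] by (simp add: entry_same)

lemma equ_cancel: "s \<in> S \<Longrightarrow> xs @ s # s # ys \<frown> xs @ ys"
  using equ_append[OF equ_square, of s xs ys] by simp

lemma equ_rev: "set ws \<subseteq> S \<Longrightarrow> ws @ rev ws \<frown> []"
proof (induction ws)
  case (Cons s ws)
  then have "[s] @ (ws @ rev ws) @ [s] \<frown> [s] @ [] @ [s]"
    by (intro equ_append) simp
  then show ?case
    using Cons.prems equ_square by (auto intro: coxeter_equiv.trans)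
qed (simp add: coxeter_equiv.refl)

text \<open>The word s t s t t s reduces in two ways: its first four letters form a relator, and its
  repeated letters cancel from the middle. \<open>equ_braid\<close> treats s t s t s t t s t in the
  same manner.\<close>

lemma equ_commute:
  assumes "s \<in> S" "t \<in> S" "s \<noteq> t" "\<not> coxeter_edge G s t"
  shows "[s, t] \<frown> [t, s]"
proof -
  have "concat (replicate (coxeter_entry G s t) [s, t]) = [s, t, s, t]"
    using entry_no_edge[OF assms] by (simp add: numeral_eq_Suc)
  then have 1: "[s, t, s, t] @ [t, s] \<frown> [t, s]"
    using coxeter_equiv.relator[of s S t G "[]" "[t, s]"] assms by simp
  have 2: "[s, t, s, t] @ [t, s] \<frown> [s, t]"
    using equ_cancel[of t "[s, t, s]" "[s]"] equ_cancel[of s "[s, t]" "[]"] assms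
    by (auto intro: coxeter_equiv.trans)
  from 1 2 show ?thesis
    by (blast intro: coxeter_equiv.trans coxeter_equiv.sym)
qed

lemma equ_braid:
  assumes "s \<in> S" "t \<in> S" "coxeter_edge G s t"
  shows "[s, t, s] \<frown> [t, s, t]"
proof -
  have "concat (replicate (coxeter_entry G s t) [s, t]) = [s, t, s, t, s, t]"
    using entry_edge[OF assms] by (simp add: numeral_eq_Suc)
  then have 1: "[s, t, s, t, s, t] @ [t, s, t] \<frown> [t, s, t]"
    using coxeter_equiv.relator[of s S t G "[]" "[t, s, t]"] assms by simp
  have "[s, t, s, t, s, t, t, s, t] \<frown> [s, t, s, t, s, s, t]"
    using equ_cancel[of t "[s, t, s, t, s]" "[s, t]"] assms by simp
  moreover have "[s, t, s, t, s, s, t] \<frown> [s, t, s, t, t]"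
    using equ_cancel[of s "[s, t, s, t]" "[t]"] assms by simp
  moreover have "[s, t, s, t, t] \<frown> [s, t, s]"
    using equ_cancel[of t "[s, t, s]" "[]"] assms by simp
  ultimately have 2: "[s, t, s, t, s, t] @ [t, s, t] \<frown> [s, t, s]"
    by (auto intro: coxeter_equiv.trans)
  from 1 2 show ?thesis
    by (blast intro: coxeter_equiv.trans coxeter_equiv.sym)
qed

text \<open>Only the Gram matrix of the vectors matters: norm 2 makes the reflections involutions,
  and pairings -1 and 0 give the braid and the commutation relation. It is applied to the geometric
  representation, to the form of the diagram and to the cover.\<close>

lemma word_refl_respects_equiv:
  assumes F: "sym_form F"
    and gram: "\<And>s t. s \<in> S \<Longrightarrow> t \<in> S \<Longrightarrow> F (\<beta> s) (\<beta> t) = geom_gram G s t"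
    and "us \<frown> vs"
  shows "word_refl F \<beta> us = word_refl F \<beta> vs"
  using assms(3)
proof induction
  case (relator s t us vs)
  interpret sym_form F by (rule F)
  have norm: "F (\<beta> s) (\<beta> s) = 2" "F (\<beta> t) (\<beta> t) = 2"
    using relator gram by (auto simp: geom_gram_def)
  have "word_refl F \<beta> (concat (replicate (coxeter_entry G s t) [s, t])) v = v" for v
  proof (cases "s = t")
    case True
    then show ?thesis using norm relator by (simp add: entry_same)
  next
    case ne: False
    show ?thesis
    proof (cases "coxeter_edge G s t")
      case True
      then have "F (\<beta> s) (\<beta> t) = - 1" using relator gram ne by (auto simp: geom_gram_def)
      from root_refl_braid[OF norm this]
      show ?thesis using norm entry_edge[OF relator True] by (simp add: numeral_eq_Suc)
    next
      case False
      then have "F (\<beta> s) (\<beta> t) = 0" using relator gram ne by (auto simp: geom_gram_def)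
      from root_refl_commute[OF this]
      show ?thesis using norm entry_no_edge[OF relator ne False] by (simp add: numeral_eq_Suc)
    qed
  qed
  then show ?case by (simp add: fun_eq_iff)
qed auto

text \<open>The Gram matrix is cut off outside \<open>S\<close>, because symmetry of
  \<open>coxeter_edge\<close> is available only between elements of \<open>S\<close>, while
  \<open>sym_form\<close> asks for a form that is symmetric everywhere.\<close>

definition gens_gram :: "'g \<Rightarrow> 'g \<Rightarrow> real" where
  "gens_gram s t = (if s \<in> S \<and> t \<in> S then geom_gram G s t else 0)"

abbreviation act :: "'g list \<Rightarrow> ('g \<Rightarrow>\<^sub>0 real) \<Rightarrow> ('g \<Rightarrow>\<^sub>0 real)" where
  "act \<equiv> word_refl (gram_form gens_gram) simple_vec"

lemma gens_gram_commute: "gens_gram s t = gens_gram t s"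
  using edge_commute by (auto simp: gens_gram_def geom_gram_def)

sublocale gf: sym_form "gram_form gens_gram"
  by unfold_locales (simp_all add: bilinear_gram_form gram_form_commute gens_gram_commute)

lemma gens_gram_norm: "s \<in> S \<Longrightarrow> gens_gram s s = 2"
  by (simp add: gens_gram_def geom_gram_def)

lemma root_refl_simple:
  "root_refl (gram_form gens_gram) (simple_vec s) (simple_vec t) =
     simple_vec t - gens_gram s t *\<^sub>R simple_vec s"
  by (simp add: root_refl_def gram_form_simple_vec)

lemma act_respects_equiv: "us \<frown> vs \<Longrightarrow> act us = act vs"
  by (rule word_refl_respects_equiv[OF gf.sym_form_axioms])
     (auto simp: gram_form_simple_vec gens_gram_def)

text \<open>Length belongs to the congruence class of a word and not to its value in the group: in
  this locale two words with the same value may fail to be congruent.\<close>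

definition len :: "'g list \<Rightarrow> nat" where
  "len w = (LEAST n. \<exists>v. set v \<subseteq> S \<and> v \<frown> w \<and> length v = n)"

lemma len_witness:
  assumes "set w \<subseteq> S" obtains v where "set v \<subseteq> S" "v \<frown> w" "length v = len w"
proof -
  have "\<exists>n v. set v \<subseteq> S \<and> v \<frown> w \<and> length v = n"
    using assms coxeter_equiv.refl by blast
  from LeastI_ex[OF this] show ?thesis
    using that unfolding len_def by blast
qed

lemma len_le: "set v \<subseteq> S \<Longrightarrow> v \<frown> w \<Longrightarrow> len w \<le> length v"
  unfolding len_def by (rule Least_le) blast

lemma len_cong:
  assumes "v \<frown> w" shows "len v = len w"
proof -
  have "u \<frown> v \<longleftrightarrow> u \<frown> w" for u
    using assms by (meson coxeter_equiv.sym coxeter_equiv.trans)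
  then show ?thesis by (simp add: len_def)
qed

lemma len_append_le:
  assumes "set w \<subseteq> S" "set xs \<subseteq> S"
  shows "len (w @ xs) \<le> len w + length xs"
proof -
  obtain v where v: "set v \<subseteq> S" "v \<frown> w" "length v = len w"
    using len_witness assms by metis
  have "v @ xs \<frown> w @ xs" using v by (intro equ_double coxeter_equiv.refl)
  from len_le[OF _ this] show ?thesis using v assms by simp
qed

lemma len_last:
  assumes "set w \<subseteq> S" "len w \<noteq> 0"
  obtains v t where "set v \<subseteq> S" "t \<in> S" "w \<frown> v @ [t]" "len v = len w - 1"
proof -
  obtain u where u: "set u \<subseteq> S" "u \<frown> w" "length u = len w"
    using len_witness assms by metis
  then obtain v t where vt: "u = v @ [t]"
    using assms by (metis length_0_conv rev_exhaust)
  have "len v \<le> len w - 1"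
    using len_le[of v v] u vt by (simp add: coxeter_equiv.refl)
  moreover have "len w \<le> len v + 1"
    using len_append_le[of v "[t]"] u vt len_cong[OF u(2)] by simp
  ultimately show ?thesis
    using that[of v t] u vt coxeter_equiv.sym[of G S u w] by simp
qed

lemma len_0:
  assumes "set w \<subseteq> S" "len w = 0" shows "w \<frown> []"
  using assms len_witness[of w] by (metis coxeter_equiv.sym length_0_conv)

definition nonneg :: "('g \<Rightarrow>\<^sub>0 real) \<Rightarrow> bool" where
  "nonneg v \<longleftrightarrow> (\<forall>i. 0 \<le> lookup v i)"

lemma nonneg_add: "nonneg u \<Longrightarrow> nonneg v \<Longrightarrow> nonneg (u + v)"
  by (simp add: nonneg_def lookup_add)

text \<open>
  Tits' argument: the dihedral parabolic subgroup generated by \<open>s\<close> and the last letter of a reduced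
  word is of order 4 or 6, so the coset computation reduces to a few explicit words.
\<close>

lemma act_nonneg:
  assumes "set w \<subseteq> S" "s \<in> S" "len w \<le> len (w @ [s])"
  shows "nonneg (act w (simple_vec s))"
  using assms
proof (induction "len w" arbitrary: w s rule: less_induct)
  case less
  show ?case
  proof (cases "len w = 0")
    case True
    then have "act w = act []"
      using less.prems len_0 act_respects_equiv by blast
    then show ?thesis by (simp add: nonneg_def lookup_simple_vec)
  next
    case False
    then obtain v t where v: "set v \<subseteq> S" "t \<in> S" "w \<frown> v @ [t]" "len v = len w - 1"
      using len_last less.prems(1) by metis
    have IH: "nonneg (act u (simple_vec r))"
      if "len u < len w" "set u \<subseteq> S" "r \<in> S" "len u \<le> len (u @ [r])" for u r
      using less.hyps that by blast
    have w: "act w x = act v (act [t] x)" for x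
      using act_respects_equiv[OF v(3)] by simp
    have ws: "len w \<le> len (v @ [t, s])"
      using less.prems(3) len_cong[OF equ_double[OF v(3) coxeter_equiv.refl, of "[s]"]] by simp
    have "len (v @ [t]) = len w" using len_cong[OF v(3)] by simp
    then have vt: "nonneg (act v (simple_vec t))"
      using IH[of v t] v False by simp
    have ne: "t \<noteq> s"
    proof
      assume "t = s"
      then have "len (v @ [t, s]) = len v"
        using equ_cancel[of s v "[]"] less.prems(2) len_cong by fastforce
      then show False using ws v(4) False by simp
    qed
    show ?thesis
    proof (cases "coxeter_edge G s t")
      \<comment> \<open>Here t fixes \<alpha>_s, and since w s is congruent to v s t, the word v s
        cannot be shorter than v. The induction hypothesis then applies to v and s.\<close>
      case no: False
      have eq: "v @ [t, s] \<frown> v @ [s, t]"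
        using equ_append[OF equ_commute[OF v(2) less.prems(2) ne], of v "[]"] no edge_commute
          v(2) less.prems(2) by simp
      have "len v \<le> len (v @ [s])"
      proof -
        have "len w \<le> len ((v @ [s]) @ [t])" using ws len_cong[OF eq] by simp
        also have "\<dots> \<le> len (v @ [s]) + 1"
          using len_append_le[of "v @ [s]" "[t]"] v less.prems(2) by simp
        finally show ?thesis using v(4) by simp
      qed
      then have "nonneg (act v (simple_vec s))" using IH v False less.prems(2) by simp
      moreover have "act [t] (simple_vec s) = simple_vec s"
        using no ne edge_commute v(2) less.prems(2)
        by (simp add: root_refl_simple gens_gram_def geom_gram_def)
      ultimately show ?thesis by (simp add: w)
    next
      case yes: True
      have g: "gens_gram t s = - 1" "gens_gram s t = - 1"
        using yes ne edge_commute v(2) less.prems(2) by (auto simp: gens_gram_def geom_gram_def)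
      have w': "act w (simple_vec s) = act v (simple_vec s) + act v (simple_vec t)"
        by (simp add: w root_refl_simple g linear_add[OF gf.linear_word_refl])
      show ?thesis
      proof (cases "len v \<le> len (v @ [s])")
        case True
        then have "nonneg (act v (simple_vec s))" using IH v False less.prems(2) by simp
        then show ?thesis using vt w' nonneg_add by simp
      next
        \<comment> \<open>Now v s is shorter than v, so with u = v s the word w is congruent to u s
          t, and w \<alpha>_s = u \<alpha>_t. By the braid relation w s is congruent to u t s t,
          hence u t is not shorter than u, and the induction hypothesis applies to u and t.\<close>
        case short: False
        define u where "u = v @ [s]"
        have u: "set u \<subseteq> S" using v(1) less.prems(2) by (simp add: u_def)
        have u_len: "len u \<le> len w - 2" "len u < len w"
          using short v(4) False by (auto simp: u_def)
        have "len u \<le> len (u @ [t])"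
        proof -
          have "v @ [s, s] @ [t, s] \<frown> v @ [] @ [t, s]"
            using less.prems(2) by (intro equ_append equ_square)
          moreover have "(v @ [s]) @ [s, t, s] @ [] \<frown> (v @ [s]) @ [t, s, t] @ []"
            using less.prems(2) v(2) yes by (intro equ_append equ_braid)
          ultimately have "v @ [t, s] \<frown> (u @ [t]) @ [s, t]"
            by (auto simp: u_def intro: coxeter_equiv.trans coxeter_equiv.sym)
          then have "len w \<le> len ((u @ [t]) @ [s, t])" using ws len_cong by simp
          also have "\<dots> \<le> len (u @ [t]) + 2"
            using len_append_le[of "u @ [t]" "[s, t]"] u v(2) less.prems(2) by simp
          finally show ?thesis using u_len by simp
        qed
        then have "nonneg (act u (simple_vec t))"
          using IH u u_len v(2) by blast
        moreover have "act u (simple_vec t) = act w (simple_vec s)"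
          by (simp add: w' u_def root_refl_simple g linear_add[OF gf.linear_word_refl])
        ultimately show ?thesis by simp
      qed
    qed
  qed
qed

text \<open>Otherwise w is congruent to v t with v shorter. By the sign theorem v \<alpha>_t is
  nonnegative, but w \<alpha>_t = \<alpha>_t forces v \<alpha>_t = -\<alpha>_t.\<close>

lemma act_trivial:
  assumes "set w \<subseteq> S" "\<And>s. s \<in> S \<Longrightarrow> act w (simple_vec s) = simple_vec s"
  shows "w \<frown> []"
proof (rule ccontr)
  assume "\<not> w \<frown> []"
  then have "len w \<noteq> 0" using len_0 assms(1) by blast
  then obtain v t where v: "set v \<subseteq> S" "t \<in> S" "w \<frown> v @ [t]" "len v = len w - 1"
    using len_last assms(1) by metis
  have "len (v @ [t]) = len w" using len_cong[OF v(3)] by simp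
  then have "nonneg (act v (simple_vec t))"
    using act_nonneg[of v t] v by simp
  moreover have "act [t] (simple_vec t) = - simple_vec t"
    using v(2) by (simp add: root_refl_simple gens_gram_norm scaleR_2)
  then have "act w (simple_vec t) = - act v (simple_vec t)"
    using act_respects_equiv[OF v(3)] linear_neg[OF gf.linear_word_refl] by simp
  then have "act v (simple_vec t) = - simple_vec t"
    using assms(2)[OF v(2)] by (metis minus_minus)
  ultimately have "0 \<le> lookup (- simple_vec t :: 'g \<Rightarrow>\<^sub>0 real) t"
    by (metis nonneg_def)
  then show False by (simp add: lookup_simple_vec)
qed

lemma act_faithful:
  assumes "set us \<subseteq> S" "set vs \<subseteq> S" "\<And>s. s \<in> S \<Longrightarrow> act us (simple_vec s) = act vs (simple_vec s)"
  shows "us \<frown> vs"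
proof -
  have norm: "gram_form gens_gram (simple_vec s) (simple_vec s) = 2" if "s \<in> set vs" for s
    using that assms(2) by (auto simp: gram_form_simple_vec gens_gram_norm)
  have "rev vs @ us \<frown> []"
    using assms gf.word_refl_rev[OF norm] by (intro act_trivial) auto
  then have "vs @ rev vs @ us \<frown> vs"
    using equ_append[of "rev vs @ us" "[]" vs "[]"] by simp
  moreover have "vs @ rev vs @ us \<frown> us"
    using equ_append[OF equ_rev[OF assms(2)], of "[]" us] by simp
  ultimately show ?thesis
    by (blast intro: coxeter_equiv.trans coxeter_equiv.sym)
qed

end

subsection \<open>Words, linear groups and the root lattice\<close>

context group
begin

lemma word_value_closed: "set ws \<subseteq> carrier G \<Longrightarrow> word_value G ws \<in> carrier G"
  by (induction ws) (auto simp: word_value_def)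

lemma word_value_append:
  "set us \<subseteq> carrier G \<Longrightarrow> set vs \<subseteq> carrier G \<Longrightarrow>
     word_value G (us @ vs) = word_value G us \<otimes> word_value G vs"
proof (induction us)
  case Nil
  then show ?case using word_value_closed[of vs] by (simp add: word_value_def)
next
  case (Cons u us)
  then show ?case
    using word_value_closed[of us] word_value_closed[of vs] by (simp add: word_value_def m_assoc)
qed

lemma generate_involutions:
  assumes X: "X \<subseteq> carrier G" and inv: "\<And>x. x \<in> X \<Longrightarrow> x \<otimes> x = \<one>"
  shows "generate G X = word_value G ` lists X"
proof
  show "generate G X \<subseteq> word_value G ` lists X"
  proof
    fix h assume "h \<in> generate G X"
    then show "h \<in> word_value G ` lists X"
    proof induction
      case one
      have "word_value G [] = \<one>" by (simp add: word_value_def)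
      then show ?case by (metis image_eqI lists.Nil)
    next
      case (incl h)
      then have "word_value G [h] = h" "[h] \<in> lists X" using X by (auto simp: word_value_def)
      then show ?case by (metis image_eqI)
    next
      case (inv h)
      then have "inv h = h" using assms(2) X by (metis inv_equality subsetD)
      moreover have "word_value G [h] = h" "[h] \<in> lists X" using X inv by (auto simp: word_value_def)
      ultimately show ?case by (metis image_eqI)
    next
      case (eng h1 h2)
      then obtain us vs where "us \<in> lists X" "vs \<in> lists X" "h1 = word_value G us" "h2 = word_value G vs"
        by auto
      moreover from this have "word_value G (us @ vs) = h1 \<otimes> h2"
        using X by (subst word_value_append) auto
      ultimately show ?case by (metis append_in_lists_conv image_eqI)
    qed
  qed
  show "word_value G ` lists X \<subseteq> generate G X"
  proof (rule image_subsetI)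
    fix ws assume "ws \<in> lists X"
    then show "word_value G ws \<in> generate G X"
      by (induction rule: lists.induct) (auto simp: word_value_def intro: generate.intros)
  qed
qed

end

lemma group_gen_lin:
  fixes V :: "'v::real_vector set"
  assumes V: "subspace V"
  shows "group (gen_lin V)"
proof -
  interpret B: group "BijGroup V" by (rule group_BijGroup)
  let ?C = "{f \<in> Bij V. (\<forall>u\<in>V. \<forall>v\<in>V. f (u + v) = f u + f v) \<and>
                              (\<forall>c. \<forall>v\<in>V. f (c *\<^sub>R v) = c *\<^sub>R f v)}"
  have "subgroup ?C (BijGroup V)"
  proof (rule B.subgroupI)
    show "?C \<subseteq> carrier (BijGroup V)" by (auto simp: BijGroup_def)
    have "(\<lambda>x\<in>V. x) \<in> ?C"
      using V by (auto simp: id_Bij subspace_add subspace_scale)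
    then show "?C \<noteq> {}" by blast
  next
    fix f assume f: "f \<in> ?C"
    then have bij: "bij_betw f V V" by (simp add: Bij_def)
    let ?g = "inv_into V f"
    have g: "?g v \<in> V" "f (?g v) = v" if "v \<in> V" for v
      using that bij by (auto simp: bij_betw_def inv_into_into f_inv_into_f)
    have fg: "?g (f v) = v" if "v \<in> V" for v
      using that bij by (auto simp: bij_betw_def)
    have "?g (u + v) = ?g u + ?g v" if uv: "u \<in> V" "v \<in> V" for u v
    proof -
      have "f (?g u + ?g v) = u + v" using f g uv by auto
      then show ?thesis using fg[of "?g u + ?g v"] g uv V by (simp add: subspace_add)
    qed
    moreover have "?g (c *\<^sub>R v) = c *\<^sub>R ?g v" if uv: "v \<in> V" for c v
    proof -
      have "f (c *\<^sub>R ?g v) = c *\<^sub>R v" using f g uv by auto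
      then show ?thesis using fg[of "c *\<^sub>R ?g v"] g uv V by (simp add: subspace_scale)
    qed
    ultimately show "inv\<^bsub>BijGroup V\<^esub> f \<in> ?C"
      using f V by (auto simp: inv_BijGroup restrict_inv_into_Bij subspace_add subspace_scale)
  next
    fix f g assume fg: "f \<in> ?C" "g \<in> ?C"
    then have "g v \<in> V" if "v \<in> V" for v
      using that by (auto simp: Bij_def bij_betw_def)
    then show "f \<otimes>\<^bsub>BijGroup V\<^esub> g \<in> ?C"
      using fg V by (auto simp: BijGroup_def compose_Bij compose_def subspace_add subspace_scale)
        (auto simp: compose_Bij compose_def[symmetric])
  qed
  from subgroup.subgroup_is_group[OF this B.is_group] show ?thesis
    by (simp add: gen_lin_def)
qed

lemma one_gen_lin: "\<one>\<^bsub>gen_lin V\<^esub> = restrict (\<lambda>v. v) V"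
  by (simp add: gen_lin_def BijGroup_def)

lemma mult_gen_lin_restrict:
  assumes "restrict f V \<in> carrier (gen_lin V)" "restrict g V \<in> carrier (gen_lin V)"
  shows "restrict f V \<otimes>\<^bsub>gen_lin V\<^esub> restrict g V = restrict (f \<circ> g) V"
proof -
  have B: "restrict f V \<in> Bij V" "restrict g V \<in> Bij V"
    using assms by (auto simp: gen_lin_def)
  then have "g v \<in> V" if "v \<in> V" for v
    using that Bij_imp_funcset[OF B(2)] by (auto simp: Pi_iff)
  then show ?thesis
    using B by (auto simp: gen_lin_def BijGroup_def compose_def intro!: restrict_ext)
qed

lemma restrict_in_gen_lin:
  assumes "linear f" and V: "\<And>v. v \<in> V \<Longrightarrow> f v \<in> V" "\<And>v. v \<in> V \<Longrightarrow> g v \<in> V"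
    and "\<And>v. v \<in> V \<Longrightarrow> g (f v) = v" "\<And>v. v \<in> V \<Longrightarrow> f (g v) = v" and S: "subspace V"
  shows "restrict f V \<in> carrier (gen_lin V)"
proof -
  have "bij_betw f V V"
    using assms by (intro bij_betwI[where g = g]) auto
  then have "restrict f V \<in> Bij V"
    by (simp add: Bij_def cong: bij_betw_cong)
  then show ?thesis
    using S assms(1) by (auto simp: gen_lin_def subspace_add subspace_scale linear_add linear_scale)
qed

lemma module_int_scaleR: "Modules.module (\<lambda>(k::int) v :: 'v::real_vector. real_of_int k *\<^sub>R v)"
  by unfold_locales (simp_all add: scaleR_add_right scaleR_add_left)

context simply_laced_gens
begin

lemma subspace_geom_space: "subspace (geom_space S)"
  by (simp add: geom_space_def)

lemma geom_space_iff: "v \<in> geom_space S \<longleftrightarrow> keys v \<subseteq> S"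
  by (simp add: geom_space_def in_span_simple_vec)

lemma simple_in_geom_space: "s \<in> S \<Longrightarrow> simple_vec s \<in> geom_space S"
  by (simp add: geom_space_def span_base)

lemma act_in_geom_space: "set ws \<subseteq> S \<Longrightarrow> v \<in> geom_space S \<Longrightarrow> act ws v \<in> geom_space S"
  by (intro gf.word_refl_in_subspace[OF subspace_geom_space] simple_in_geom_space) auto

lemma gram_norm: "set ws \<subseteq> S \<Longrightarrow> s \<in> set ws \<Longrightarrow> gram_form gens_gram (simple_vec s) (simple_vec s) = 2"
  by (auto simp: gram_form_simple_vec gens_gram_norm)

text \<open>The linear map that replaces each \<alpha>_s by \<beta> s. It carries the geometric
  representation to any space in which the vectors \<beta> s have the same Gram matrix, even if they
  are linearly dependent there.\<close>

definition realise :: "('g \<Rightarrow> 'v::real_vector) \<Rightarrow> ('g \<Rightarrow>\<^sub>0 real) \<Rightarrow> 'v" where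
  "realise \<beta> v = (\<Sum>s\<in>S. lookup v s *\<^sub>R \<beta> s)"

lemma linear_realise: "linear (realise \<beta>)"
  by (rule linearI)
     (simp_all add: realise_def lookup_add scaleR_add_left sum.distrib scaleR_sum_right)

lemma realise_simple: "s \<in> S \<Longrightarrow> realise \<beta> (simple_vec s) = \<beta> s"
  using finite_gens
  by (simp add: realise_def lookup_simple_vec if_distrib[of "\<lambda>x. x *\<^sub>R _"] cong: if_cong)

lemma realise_in_subspace: "subspace U \<Longrightarrow> \<beta> ` S \<subseteq> U \<Longrightarrow> realise \<beta> v \<in> U"
  unfolding realise_def by (intro subspace_sum subspace_scale) auto

text \<open>A reflection only uses the pairings of its root, and the pairing of \<beta> s with the
  image of u equals that of \<alpha>_s with u because the Gram matrices agree on
  \<open>S\<close>.\<close>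

lemma realise_act:
  assumes F: "sym_form F"
    and gram: "\<And>s t. s \<in> S \<Longrightarrow> t \<in> S \<Longrightarrow> F (\<beta> s) (\<beta> t) = geom_gram G s t"
    and v: "v \<in> geom_space S" and ws: "set ws \<subseteq> S"
  shows "realise \<beta> (act ws v) = word_refl F \<beta> ws (realise \<beta> v)"
  using ws
proof (induction ws)
  case (Cons s ws)
  interpret sym_form F by (rule F)
  let ?u = "act ws v"
  have u: "keys ?u \<subseteq> S"
    using act_in_geom_space[OF _ v, of ws] Cons.prems by (simp add: geom_space_iff)
  have "F (\<beta> s) (realise \<beta> ?u) = (\<Sum>t\<in>S. lookup ?u t * F (\<beta> s) (\<beta> t))"
    by (simp add: realise_def form_sum_right)
  also have "\<dots> = gram_form gens_gram (simple_vec s) ?u"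
    using Cons.prems finite_gens u
    by (simp add: gram_form_simple_vec_left[of S] gram gens_gram_def)
  finally have "realise \<beta> (act (s # ws) v) = root_refl F (\<beta> s) (realise \<beta> ?u)"
    using Cons.prems realise_simple[of s \<beta>]
    by (simp add: root_refl_def linear_diff[OF linear_realise] linear_scale[OF linear_realise])
  then show ?case using Cons by simp
qed simp

end

locale simply_laced_coxeter =
  fixes G :: "('g, 'm) monoid_scheme" (structure) and S :: "'g set"
  assumes coxeter: "coxeter_system G S" and simply: "simply_laced G S" and finite: "finite S"
begin

sublocale simply_laced_gens G S
  using coxeter simply finite by (intro simply_laced_gens.intro) (auto simp: coxeter_system_def)

lemma word_value_eq_iff:
  "set us \<subseteq> S \<Longrightarrow> set vs \<subseteq> S \<Longrightarrow> word_value G us = word_value G vs \<longleftrightarrow> us \<frown> vs"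
  using coxeter by (auto simp: coxeter_system_def lists_eq_set)

definition word_of :: "'g \<Rightarrow> 'g list" where
  "word_of w = (SOME ws. set ws \<subseteq> S \<and> word_value G ws = w)"

lemma word_of:
  assumes "w \<in> carrier G"
  shows "set (word_of w) \<subseteq> S" "word_value G (word_of w) = w"
proof -
  have "w \<in> generate G S" using assms coxeter by (simp add: coxeter_system_def)
  then have "\<exists>ws. set ws \<subseteq> S \<and> word_value G ws = w"
    using generate_involutions[OF gens_carrier gen_square] by (auto simp: lists_eq_set)
  from someI_ex[OF this] show "set (word_of w) \<subseteq> S" "word_value G (word_of w) = w"
    by (simp_all add: word_of_def)
qed

lemma word_value_gens: "set ws \<subseteq> S \<Longrightarrow> word_value G ws \<in> carrier G"
  using word_value_closed gens_carrier by blast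

lemma equ_word_of: "set ws \<subseteq> S \<Longrightarrow> word_of (word_value G ws) \<frown> ws"
  using word_of[OF word_value_gens[of ws]] word_value_eq_iff by blast

lemma word_of_mult:
  assumes "v \<in> carrier G" "w \<in> carrier G"
  shows "word_of (v \<otimes> w) \<frown> word_of v @ word_of w"
proof -
  have "word_value G (word_of v @ word_of w) = v \<otimes> w"
    using word_of[OF assms(1)] word_of[OF assms(2)] gens_carrier
      word_value_append[of "word_of v" "word_of w"] by auto
  then show ?thesis
    using equ_word_of[of "word_of v @ word_of w"] word_of assms by simp
qed

lemma word_of_gen: "s \<in> S \<Longrightarrow> word_of s \<frown> [s]"
  using equ_word_of[of "[s]"] gens_carrier by (auto simp: word_value_def)

lemma word_of_one: "word_of \<one> \<frown> []"
  using equ_word_of[of "[]"] by (simp add: word_value_def)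

lemma act_in_gen_lin:
  assumes "set ws \<subseteq> S"
  shows "restrict (act ws) (geom_space S) \<in> carrier (gen_lin (geom_space S))"
  using assms gram_norm
  by (intro restrict_in_gen_lin[where g = "act (rev ws)"] gf.linear_word_refl subspace_geom_space
      act_in_geom_space gf.word_refl_rev gf.word_refl_rev') auto

lemma reflection_geom_gram:
  assumes "s \<in> S"
  shows "reflection (geom_space S) (gram_form (geom_gram G)) (simple_vec s) =
         restrict (act [s]) (geom_space S)"
proof (rule ext)
  fix v
  have "gram_form (geom_gram G) (simple_vec s) v = gram_form gens_gram (simple_vec s) v"
    if "v \<in> geom_space S"
    using that assms finite_gens
    by (simp add: geom_space_iff gram_form_simple_vec_left[of S] gens_gram_def)
  then show "reflection (geom_space S) (gram_form (geom_gram G)) (simple_vec s) v =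
      restrict (act [s]) (geom_space S) v"
    using assms
    by (simp add: reflection_def root_refl_def gram_form_simple_vec geom_gram_def)
qed

text \<open>The choice in \<open>geom_rep\<close> must be shown to have a candidate: w acts through
  a chosen word, which is multiplicative because the action depends only on the congruence class.
  After that, any homomorphism with the given values on the generators acts on words as stated, so
  it does not matter which one was chosen.\<close>

lemma geom_rep_word:
  assumes ws: "set ws \<subseteq> S"
  shows "geom_rep G S (word_value G ws) = restrict (act ws) (geom_space S)"
proof -
  let ?V = "geom_space S"
  interpret L: group "gen_lin ?V" by (rule group_gen_lin[OF subspace_geom_space])
  let ?P = "\<lambda>\<rho>. \<rho> \<in> hom G (gen_lin ?V) \<and>
     (\<forall>s\<in>S. \<rho> s = reflection ?V (gram_form (geom_gram G)) (simple_vec s))"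
  have "?P (\<lambda>w. restrict (act (word_of w)) ?V)"
  proof (intro conjI ballI homI)
    fix w assume "w \<in> carrier G"
    then show "restrict (act (word_of w)) ?V \<in> carrier (gen_lin ?V)"
      using word_of act_in_gen_lin by blast
  next
    fix v w assume vw: "v \<in> carrier G" "w \<in> carrier G"
    have "act (word_of (v \<otimes> w)) = act (word_of v) \<circ> act (word_of w)"
      using act_respects_equiv[OF word_of_mult[OF vw]] by auto
    then show "restrict (act (word_of (v \<otimes> w))) ?V =
        restrict (act (word_of v)) ?V \<otimes>\<^bsub>gen_lin ?V\<^esub> restrict (act (word_of w)) ?V"
      using word_of act_in_gen_lin vw by (subst mult_gen_lin_restrict) simp_all
  next
    fix s assume s: "s \<in> S"
    show "restrict (act (word_of s)) ?V = reflection ?V (gram_form (geom_gram G)) (simple_vec s)"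
      using act_respects_equiv[OF word_of_gen[OF s]] by (simp add: reflection_geom_gram s)
  qed
  from someI[of ?P, OF this] have P: "?P (geom_rep G S)"
    unfolding geom_rep_def .
  interpret \<rho>: group_hom G "gen_lin ?V" "geom_rep G S"
    using P by unfold_locales auto
  show ?thesis
    using ws
  proof (induction ws)
    case Nil
    have "act [] = (\<lambda>v. v)" by auto
    then show ?case by (simp add: word_value_def one_gen_lin)
  next
    case (Cons s ws)
    have "geom_rep G S (word_value G (s # ws)) =
        geom_rep G S s \<otimes>\<^bsub>gen_lin ?V\<^esub> geom_rep G S (word_value G ws)"
      using Cons.prems gens_carrier word_value_gens[of ws] by (auto simp: word_value_def)
    also have "\<dots> = restrict (act [s]) ?V \<otimes>\<^bsub>gen_lin ?V\<^esub> restrict (act ws) ?V"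
    proof -
      have "geom_rep G S s = restrict (act [s]) ?V"
        using Cons.prems P reflection_geom_gram by auto
      moreover have "geom_rep G S (word_value G ws) = restrict (act ws) ?V"
        using Cons by auto
      ultimately show ?thesis by metis
    qed
    also have "\<dots> = restrict (act [s] \<circ> act ws) ?V"
      using Cons.prems by (intro mult_gen_lin_restrict act_in_gen_lin) auto
    also have "act [s] \<circ> act ws = act (s # ws)" by auto
    finally show ?case .
  qed
qed

lemma geom_rep_apply:
  "w \<in> carrier G \<Longrightarrow> v \<in> geom_space S \<Longrightarrow> geom_rep G S w v = act (word_of w) v"
  using geom_rep_word[of "word_of w"] word_of by simp

lemma coxeter_roots_eq: "coxeter_roots G S = {act ws (simple_vec s) | ws s. set ws \<subseteq> S \<and> s \<in> S}"
proof (intro subset_antisym subsetI)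
  fix v assume "v \<in> coxeter_roots G S"
  then show "v \<in> {act ws (simple_vec s) | ws s. set ws \<subseteq> S \<and> s \<in> S}"
    unfolding coxeter_roots_def using geom_rep_apply simple_in_geom_space word_of by fastforce
next
  fix v assume "v \<in> {act ws (simple_vec s) | ws s. set ws \<subseteq> S \<and> s \<in> S}"
  then obtain ws s where v: "v = act ws (simple_vec s)" "set ws \<subseteq> S" "s \<in> S" by blast
  then have "v = geom_rep G S (word_value G ws) (simple_vec s)"
    by (simp add: geom_rep_word simple_in_geom_space)
  then show "v \<in> coxeter_roots G S"
    unfolding coxeter_roots_def using v word_value_gens by blast
qed

section \<open>The root lattice\<close>

interpretation Z: Modules.module "\<lambda>(k::int) v :: 'g \<Rightarrow>\<^sub>0 real. real_of_int k *\<^sub>R v"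
  by (rule module_int_scaleR)

text \<open>Integer multiples are replaced by repeated addition and negation. This matches the
  properties proved by it: membership of transvections in a group is stable under sums and negatives
  of the lattice vector.\<close>

lemma lattice_induct [consumes 1, case_names zero root add uminus]:
  assumes x: "x \<in> root_lattice G S" and zero: "P 0"
    and root: "\<And>ws s. set ws \<subseteq> S \<Longrightarrow> s \<in> S \<Longrightarrow> P (act ws (simple_vec s))"
    and add: "\<And>x y. P x \<Longrightarrow> P y \<Longrightarrow> P (x + y)" and uminus: "\<And>x. P x \<Longrightarrow> P (- x)"
  shows "P x"
proof -
  have "x \<in> Z.span (coxeter_roots G S)" using x by (simp add: root_lattice_def)
  then show ?thesis
  proof (induction rule: Z.span_induct_alt)
    case base
    then show ?case by (rule zero)
  next
    case (step k v y)
    then have v: "P v" using root by (auto simp: coxeter_roots_eq)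
    have nat: "P (real n *\<^sub>R v)" for n
      by (induction n) (simp_all add: zero add v algebra_simps)
    have "P (real_of_int k *\<^sub>R v)"
    proof (cases k)
      case (nonneg n)
      then show ?thesis using nat[of n] by simp
    next
      case (neg n)
      have "real_of_int k *\<^sub>R v = - (real (Suc n) *\<^sub>R v)"
        unfolding scaleR_minus_left[symmetric] using neg by simp
      then show ?thesis using uminus nat by metis
    qed
    then show ?case using add step by blast
  qed
qed

lemma lattice_zero: "0 \<in> root_lattice G S"
  by (simp add: root_lattice_def Z.span_zero)

lemma lattice_add: "x \<in> root_lattice G S \<Longrightarrow> y \<in> root_lattice G S \<Longrightarrow> x + y \<in> root_lattice G S"
  by (simp add: root_lattice_def Z.span_add)

lemma lattice_uminus: "x \<in> root_lattice G S \<Longrightarrow> - x \<in> root_lattice G S"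
  by (simp add: root_lattice_def Z.span_neg)

lemma lattice_root: "set ws \<subseteq> S \<Longrightarrow> s \<in> S \<Longrightarrow> act ws (simple_vec s) \<in> root_lattice G S"
  unfolding root_lattice_def by (rule Z.span_base) (auto simp: coxeter_roots_eq)

lemma lattice_in_geom_space:
  assumes "x \<in> root_lattice G S" shows "x \<in> geom_space S"
  using assms
proof (induction rule: lattice_induct)
  case zero
  then show ?case using subspace_geom_space subspace_0 by blast
next
  case (root ws s)
  then show ?case by (simp add: act_in_geom_space simple_in_geom_space)
qed (simp_all add: subspace_geom_space subspace_add subspace_neg)

lemma lattice_act:
  assumes "x \<in> root_lattice G S" "set us \<subseteq> S" shows "act us x \<in> root_lattice G S"
  using assms(1)
proof (induction rule: lattice_induct)
  case zero
  then show ?case using linear_0[OF gf.linear_word_refl] lattice_zero by metis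
next
  case (root ws s)
  then show ?case using lattice_root[of "us @ ws" s] assms(2) by simp
next
  case (add x y)
  then show ?case by (simp add: linear_add[OF gf.linear_word_refl] lattice_add)
next
  case (uminus x)
  then show ?case by (simp add: linear_neg[OF gf.linear_word_refl] lattice_uminus)
qed

end

subsection \<open>Isometry groups generated by reflections and transvections\<close>

text \<open>
  The Eichler transvection \<open>E l\<close> belongs to an isotropic vector \<open>a\<close> and a vector \<open>l\<close> orthogonal to it.
  On the domestic and wild covers \<open>F a\<close> does not vanish, on the tubular ones it does, but the
  commutation rules are the same.
\<close>

locale transvection_extension =
  simply_laced_coxeter G S + sym_form F
  for G :: "('g, 'm) monoid_scheme" (structure) and S :: "'g set"
    and F :: "'v::real_vector \<Rightarrow> 'v \<Rightarrow> real" +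
  fixes \<beta> :: "'g \<Rightarrow> 'v" and a :: 'v and U :: "'v set" and c :: 'g
  assumes U: "subspace U" and \<beta>_U: "s \<in> S \<Longrightarrow> \<beta> s \<in> U" and a_U: "a \<in> U"
    and aa: "F a a = 0" and a\<beta>: "s \<in> S \<Longrightarrow> F a (\<beta> s) = 0"
    and gram: "s \<in> S \<Longrightarrow> t \<in> S \<Longrightarrow> F (\<beta> s) (\<beta> t) = geom_gram G s t"
    and c: "c \<in> S"
    and conn: "s \<in> S \<Longrightarrow> (c, s) \<in> {(u, v). u \<in> S \<and> v \<in> S \<and> coxeter_edge G u v}\<^sup>*"
    and realise_indep: "v \<in> geom_space S \<Longrightarrow> realise \<beta> v = k *\<^sub>R a \<Longrightarrow> v = 0"
    and transvection_faithful:
      "v \<in> geom_space S \<Longrightarrow>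
        (\<And>x. x \<in> U \<Longrightarrow> \<exists>k. F a x *\<^sub>R realise \<beta> v = (F (realise \<beta> v) x + k * F a x) *\<^sub>R a) \<Longrightarrow> v = 0"
begin

abbreviation T where "T \<equiv> realise \<beta>"
abbreviation W where "W \<equiv> word_refl F \<beta>"

lemma norm: "s \<in> S \<Longrightarrow> F (\<beta> s) (\<beta> s) = 2"
  by (simp add: gram geom_gram_def)

lemma norm_set: "set ws \<subseteq> S \<Longrightarrow> s \<in> set ws \<Longrightarrow> F (\<beta> s) (\<beta> s) = 2"
  by (auto simp: norm)

lemma T_U: "T v \<in> U"
  by (rule realise_in_subspace) (auto simp: U \<beta>_U)

lemma aT: "F a (T v) = 0"
  by (simp add: realise_def form_sum_right a\<beta>)

lemma W_a: "set ws \<subseteq> S \<Longrightarrow> W ws a = a"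
  by (intro word_refl_fixes) (metis a\<beta> subsetD sym)

lemma W_cong: "us \<frown> vs \<Longrightarrow> W us = W vs"
  by (rule word_refl_respects_equiv[OF sym_form_axioms gram])

lemma T_act: "v \<in> geom_space S \<Longrightarrow> set ws \<subseteq> S \<Longrightarrow> T (act ws v) = W ws (T v)"
  by (rule realise_act[OF sym_form_axioms gram])

text \<open>The coefficient F l l / 2 is what makes l \<mapsto> E l additive: composing E l with E m
  produces the cross term F l m, the polarisation of this quadratic term.\<close>

definition E :: "'v \<Rightarrow> 'v \<Rightarrow> 'v" where
  "E l x = x + F a x *\<^sub>R l - F l x *\<^sub>R a - (F l l / 2 * F a x) *\<^sub>R a"

lemma linear_E: "linear (E l)"
  by (rule linearI) (simp_all add: E_def form_simps algebra_simps add_divide_distrib)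

lemma E_zero: "E 0 x = x"
  by (simp add: E_def form_simps)

lemma T_zero: "T 0 = 0"
  by (rule linear_0[OF linear_realise])

lemma E_add:
  assumes "F a l = 0" "F a m = 0"
  shows "E (l + m) x = E l (E m x)"
proof -
  have la: "F l a = 0" and ml: "F m l = F l m" using assms sym by metis+
  have 1: "F a (E m x) = F a x" using assms aa by (simp add: E_def form_simps)
  have 2: "F l (E m x) = F l x + F a x * F l m" by (simp add: E_def form_simps la)
  have "E l (E m x) = E m x + F a x *\<^sub>R l - (F l x + F a x * F l m) *\<^sub>R a - (F l l / 2 * F a x) *\<^sub>R a"
    by (simp only: E_def[of l "E m x"] 1 2)
  also have "\<dots> = E (l + m) x"
    using assms la ml by (simp add: E_def form_simps algebra_simps add_divide_distrib)
  finally show ?thesis ..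
qed

lemma E_uminus:
  assumes "F a l = 0"
  shows "E (- l) (E l x) = x" "E l (E (- l) x) = x"
  using E_add[of "- l" l x] E_add[of l "- l" x] assms by (simp_all add: E_zero form_simps)

text \<open>A word is an isometry that fixes a, and E l is built from F, a and l alone. This is the
  conjugation rule behind the semidirect product.\<close>

lemma W_E:
  assumes "set ws \<subseteq> S"
  shows "W ws (E l x) = E (W ws l) (W ws x)"
proof -
  have 1: "F (W ws u) (W ws v) = F u v" for u v
    using word_refl_isometry[OF norm_set[OF assms]] .
  have 2: "F a (W ws v) = F a v" for v
    using 1[of a v] W_a[OF assms] by simp
  show ?thesis
    by (simp add: E_def 1 2 W_a[OF assms] linear_add[OF linear_word_refl]
        linear_diff[OF linear_word_refl] linear_scale[OF linear_word_refl])
qed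

lemma E_U: "x \<in> U \<Longrightarrow> E (T v) x \<in> U"
  unfolding E_def by (intro subspace_add subspace_diff subspace_scale U T_U a_U)

lemma E_generator: "root_refl F (\<beta> c + a) x = root_refl F (\<beta> c) (E (\<beta> c) x)"
proof -
  have \<beta>a: "F (\<beta> c) a = 0" using a\<beta>[OF c] sym by metis
  have "F (\<beta> c) (E (\<beta> c) x) = F (\<beta> c) x + 2 * F a x"
    using norm[OF c] by (simp add: E_def form_simps \<beta>a)
  then have "root_refl F (\<beta> c) (E (\<beta> c) x) = E (\<beta> c) x - (F (\<beta> c) x + 2 * F a x) *\<^sub>R \<beta> c"
    by (simp only: root_refl_def)
  also have "\<dots> = x - (F (\<beta> c) x + F a x) *\<^sub>R (\<beta> c + a)"
    using norm[OF c] by (simp add: E_def algebra_simps) (simp add: mult.commute scaleR_2 scaleR_add_right flip: scaleR_scaleR)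
  finally show ?thesis by (simp add: root_refl_def form_simps)
qed

abbreviation GL where "GL \<equiv> gen_lin U"

sublocale GL: group GL by (rule group_gen_lin[OF U])

definition X where
  "X = insert (restrict (root_refl F (\<beta> c + a)) U) ((\<lambda>s. restrict (root_refl F (\<beta> s)) U) ` S)"

lemma root_refl_in_GL:
  assumes "F b b = 2" "b \<in> U"
  shows "restrict (root_refl F b) U \<in> carrier GL"
proof -
  have "root_refl F b v \<in> U" if "v \<in> U" for v
    unfolding root_refl_def using assms that by (intro subspace_diff subspace_scale U)
  then show ?thesis
    using assms linear_root_refl U by (intro restrict_in_gen_lin[where g = "root_refl F b"]) auto
qed

lemma norm_star: "F (\<beta> c + a) (\<beta> c + a) = 2"
  using norm[OF c] a\<beta>[OF c] aa sym[of "\<beta> c" a] by (simp add: form_simps)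

lemma X_GL: "X \<subseteq> carrier GL"
  unfolding X_def using norm_star norm \<beta>_U a_U c U
  by (auto intro!: root_refl_in_GL subspace_add simp del: restrict_apply)

lemma X_involution:
  assumes "x \<in> X" shows "x \<otimes>\<^bsub>GL\<^esub> x = \<one>\<^bsub>GL\<^esub>"
proof -
  obtain b where b: "x = restrict (root_refl F b) U" "F b b = 2"
    using assms norm norm_star unfolding X_def by blast
  then have "x \<otimes>\<^bsub>GL\<^esub> x = restrict (root_refl F b \<circ> root_refl F b) U"
    using assms X_GL by (metis mult_gen_lin_restrict subsetD)
  also have "root_refl F b \<circ> root_refl F b = (\<lambda>x. x)" using b by auto
  finally show ?thesis by (simp only: one_gen_lin)
qed

section \<open>Transvections of lattice vectors inside the generated group\<close>

definition gen :: "('v \<Rightarrow> 'v) \<Rightarrow> bool" where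
  "gen f \<longleftrightarrow> restrict f U \<in> generate GL X"

lemma gen_GL: "gen f \<Longrightarrow> restrict f U \<in> carrier GL"
  unfolding gen_def using GL.generate_in_carrier X_GL by blast

lemma gen_comp: "gen f \<Longrightarrow> gen g \<Longrightarrow> gen (f \<circ> g)"
  using mult_gen_lin_restrict[OF gen_GL gen_GL, of f g] generate.eng
  unfolding gen_def by metis

lemma gen_inverse:
  assumes f: "gen f" and g: "linear g" "\<And>x. x \<in> U \<Longrightarrow> g x \<in> U" "\<And>x. x \<in> U \<Longrightarrow> f x \<in> U"
    and fg: "\<And>x. f (g x) = x" "\<And>x. g (f x) = x"
  shows "gen g"
proof -
  have gGL: "restrict g U \<in> carrier GL"
    using g fg U by (intro restrict_in_gen_lin[where g = f]) auto
  have "g \<circ> f = (\<lambda>x. x)" using fg by auto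
  then have "restrict g U \<otimes>\<^bsub>GL\<^esub> restrict f U = \<one>\<^bsub>GL\<^esub>"
    using mult_gen_lin_restrict[OF gGL gen_GL[OF f]] by (simp add: one_gen_lin)
  then have "restrict g U = inv\<^bsub>GL\<^esub> (restrict f U)"
    using GL.inv_equality gGL gen_GL[OF f] by metis
  then show ?thesis
    using GL.generate_m_inv_closed[OF X_GL] f unfolding gen_def by metis
qed

lemma gen_id: "gen (\<lambda>x. x)"
  unfolding gen_def using generate.one[of GL X] by (simp add: one_gen_lin)

lemma gen_W: "set ws \<subseteq> S \<Longrightarrow> gen (W ws)"
proof (induction ws)
  case Nil
  have "W [] = (\<lambda>x. x)" by auto
  then show ?case using gen_id by simp
next
  case (Cons s ws)
  then have "gen (root_refl F (\<beta> s))"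
    unfolding gen_def X_def by (intro generate.incl) auto
  moreover have "W (s # ws) = root_refl F (\<beta> s) \<circ> W ws" by auto
  ultimately show ?case using Cons gen_comp by (metis set_subset_Cons subset_trans)
qed

lemma gen_conj:
  assumes "set ws \<subseteq> S" "gen (E l)" shows "gen (E (W ws l))"
proof -
  have "E (W ws l) = W ws \<circ> (E l \<circ> W (rev ws))"
    using W_E[OF assms(1), of l] word_refl_rev'[of ws \<beta>, OF norm_set[OF assms(1)]]
    by (simp add: fun_eq_iff)
  then show ?thesis using assms gen_W[of ws] gen_W[of "rev ws"] gen_comp by (metis set_rev)
qed

text \<open>The product of the two generators attached to c is the transvection of \<beta> c. For
  adjacent s and t the word s t carries \<beta> s to \<beta> t, so conjugating by it moves
  transvections along a path of the diagram starting at c.\<close>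

lemma gen_E_root:
  assumes "s \<in> S" shows "gen (E (\<beta> s))"
  using conn[OF assms]
proof (induction rule: rtrancl_induct)
  case base
  have "E (\<beta> c) = root_refl F (\<beta> c) \<circ> root_refl F (\<beta> c + a)"
    using E_generator norm[OF c] by (simp add: fun_eq_iff)
  moreover have "gen (root_refl F (\<beta> c))" "gen (root_refl F (\<beta> c + a))"
    unfolding gen_def X_def using c by (auto intro!: generate.incl simp del: restrict_apply)
  ultimately show ?case using gen_comp by metis
next
  case (step s t)
  then have st: "s \<in> S" "t \<in> S" "coxeter_edge G s t" by auto
  then have "F (\<beta> s) (\<beta> t) = - 1"
    by (auto simp: gram geom_gram_def coxeter_edge_def)
  moreover from this have "F (\<beta> t) (\<beta> s) = - 1" using sym by metis
  ultimately have "W [s, t] (\<beta> s) = \<beta> t"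
    using norm st by (simp add: root_refl_def form_simps)
  then show ?case using gen_conj[of "[s, t]" "\<beta> s"] step st by simp
qed

lemma gen_E_lattice:
  assumes "x \<in> root_lattice G S" shows "gen (E (T x))"
  using assms
proof (induction rule: lattice_induct)
  case zero
  have "E (T 0) = (\<lambda>x. x)" by (auto simp: E_zero T_zero)
  then show ?case using gen_id by simp
next
  case (root ws s)
  then show ?case
    using gen_conj[OF _ gen_E_root, of ws s] by (simp add: T_act simple_in_geom_space realise_simple)
next
  case (add x y)
  have "E (T (x + y)) = E (T x) \<circ> E (T y)"
    by (simp add: fun_eq_iff linear_add[OF linear_realise] E_add aT)
  then show ?case using add gen_comp by metis
next
  case (uminus x)
  have neg: "T (- x) = - T x" by (rule linear_neg[OF linear_realise])
  show ?case
  proof (rule gen_inverse[OF uminus linear_E E_U E_U])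
    show "E (T x) (E (T (- x)) u) = u" "E (T (- x)) (E (T x) u) = u" for u
      using E_uminus[OF aT] by (simp_all only: neg)
  qed
qed

section \<open>The isomorphism with the extended Coxeter group\<close>

abbreviation EG where "EG \<equiv> extended_coxeter_group G S"

definition \<psi> :: "'g \<times> ('g \<Rightarrow>\<^sub>0 real) \<Rightarrow> 'v \<Rightarrow> 'v" where
  "\<psi> = (\<lambda>(w, x). restrict (W (word_of w) \<circ> E (T x)) U)"

lemma \<psi>_generate: "p \<in> carrier EG \<Longrightarrow> \<psi> p \<in> generate GL X"
  using gen_comp[OF gen_W gen_E_lattice] word_of
  by (auto simp: \<psi>_def extended_coxeter_group_def gen_def[symmetric] simp del: restrict_apply)

lemma EG_closed:
  assumes "p \<in> carrier EG" "q \<in> carrier EG" shows "p \<otimes>\<^bsub>EG\<^esub> q \<in> carrier EG"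
proof -
  obtain w x v y where pq: "p = (w, x)" "q = (v, y)" by fastforce
  then have *: "w \<in> carrier G" "v \<in> carrier G" "x \<in> root_lattice G S" "y \<in> root_lattice G S"
    using assms by (auto simp: extended_coxeter_group_def)
  then have "geom_rep G S (inv v) x \<in> root_lattice G S"
    using word_of by (simp add: geom_rep_apply lattice_in_geom_space lattice_act)
  then show ?thesis
    using * pq by (simp add: extended_coxeter_group_def lattice_add)
qed

text \<open>Moving a transvection to the right past v gives E_x v = v E_y with y the image of x
  under the inverse of v, which explains the inverse in the multiplication rule. The word chosen for
  inv v need not be the reversed word of v; it inverts the action because the two chosen words
  together are congruent to the empty word.\<close>

lemma \<psi>_mult:
  assumes "p \<in> carrier EG" "q \<in> carrier EG"
  shows "\<psi> (p \<otimes>\<^bsub>EG\<^esub> q) = \<psi> p \<otimes>\<^bsub>GL\<^esub> \<psi> q"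
proof -
  obtain w x v y where pq: "p = (w, x)" "q = (v, y)" by fastforce
  then have *: "w \<in> carrier G" "v \<in> carrier G" "x \<in> root_lattice G S" "y \<in> root_lattice G S"
    using assms by (auto simp: extended_coxeter_group_def)
  let ?x = "geom_rep G S (inv v) x"
  have x: "x \<in> geom_space S" using * lattice_in_geom_space by blast
  have Sw: "set (word_of w) \<subseteq> S" "set (word_of v) \<subseteq> S" "set (word_of (inv v)) \<subseteq> S"
    using * word_of by simp_all
  have "word_of v @ word_of (inv v) \<frown> []"
    using word_of_mult[of v "inv v"] word_of_one *
    by (simp, metis coxeter_equiv.sym coxeter_equiv.trans)
  then have vv: "W (word_of v) (W (word_of (inv v)) u) = u" for u
    using W_cong by (metis word_refl_Nil word_refl_append)
  have Tx: "T ?x = W (word_of (inv v)) (T x)"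
    using * x Sw by (simp add: geom_rep_apply T_act)
  have "W (word_of (w \<otimes> v)) (E (T (?x + y)) u) =
      W (word_of w) (E (T x) (W (word_of v) (E (T y) u)))" for u
  proof -
    have "W (word_of (w \<otimes> v)) (E (T (?x + y)) u) =
        W (word_of w) (W (word_of v) (E (T ?x) (E (T y) u)))"
      using W_cong[OF word_of_mult[of w v]] *
      by (simp add: linear_add[OF linear_realise] E_add aT)
    also have "\<dots> = W (word_of w) (E (T x) (W (word_of v) (E (T y) u)))"
      by (simp add: W_E[OF Sw(2)] Tx vv)
    finally show ?thesis .
  qed
  then have "\<psi> (w \<otimes> v, ?x + y) = restrict ((W (word_of w) \<circ> E (T x)) \<circ> (W (word_of v) \<circ> E (T y))) U"
    by (auto simp: \<psi>_def fun_eq_iff)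
  also have "\<dots> = \<psi> p \<otimes>\<^bsub>GL\<^esub> \<psi> q"
    unfolding \<psi>_def pq prod.case
    using gen_comp[OF gen_W gen_E_lattice] gen_GL Sw * by (intro mult_gen_lin_restrict[symmetric]) blast+
  finally show ?thesis by (simp add: extended_coxeter_group_def pq)
qed

lemma \<psi>_gens: "\<psi> ` extended_coxeter_gens S c = X"
proof -
  have W1: "W (word_of s) = root_refl F (\<beta> s)" if "s \<in> S" for s
    using W_cong[OF word_of_gen[OF that]] by auto
  have "\<psi> (s, 0) = restrict (root_refl F (\<beta> s)) U" if "s \<in> S" for s
    using that by (auto simp: \<psi>_def W1 E_zero T_zero fun_eq_iff)
  moreover have "\<psi> (c, simple_vec c) = restrict (root_refl F (\<beta> c + a)) U"
    using c by (auto simp: \<psi>_def W1 realise_simple E_generator fun_eq_iff)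
  ultimately show ?thesis
    by (auto simp: extended_coxeter_gens_def X_def image_image)
qed

lemma gens_EG: "extended_coxeter_gens S c \<subseteq> carrier EG"
  using gens_carrier lattice_zero lattice_root[of "[]" c] c
  by (auto simp: extended_coxeter_gens_def extended_coxeter_group_def)

text \<open>On a simple root \<beta> s a transvection adds only a multiple of a, so by
  \<open>realise_indep\<close> the words of w and v act alike on all \<alpha>_s, and faithfulness
  gives w = v. After cancelling w, comparing the formulas of the two remaining transvections yields
  the hypothesis of \<open>transvection_faithful\<close> for x - y.\<close>

lemma \<psi>_inj: "inj_on \<psi> (carrier EG)"
proof (rule inj_onI)
  fix p q assume pq0: "p \<in> carrier EG" "q \<in> carrier EG" and eq: "\<psi> p = \<psi> q"
  obtain w x v y where pq: "p = (w, x)" "q = (v, y)" by fastforce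
  then have *: "w \<in> carrier G" "v \<in> carrier G" "x \<in> root_lattice G S" "y \<in> root_lattice G S"
    using pq0 by (auto simp: extended_coxeter_group_def)
  have Sw: "set (word_of w) \<subseteq> S" "set (word_of v) \<subseteq> S"
    using * word_of by simp_all
  have eq': "W (word_of w) (E (T x) u) = W (word_of v) (E (T y) u)" if "u \<in> U" for u
    using fun_cong[OF eq, of u] that by (simp add: \<psi>_def pq)
  have "act (word_of w) (simple_vec s) = act (word_of v) (simple_vec s)" if s: "s \<in> S" for s
  proof -
    let ?k = "F (T x) (\<beta> s)" and ?m = "F (T y) (\<beta> s)"
    have "W (word_of w) (\<beta> s - ?k *\<^sub>R a) = W (word_of v) (\<beta> s - ?m *\<^sub>R a)"
      using eq'[OF \<beta>_U[OF s]] a\<beta>[OF s] by (simp add: E_def)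
    then have "T (act (word_of w) (simple_vec s)) - ?k *\<^sub>R a = T (act (word_of v) (simple_vec s)) - ?m *\<^sub>R a"
      using Sw s by (simp add: T_act simple_in_geom_space realise_simple linear_diff[OF linear_word_refl]
        linear_scale[OF linear_word_refl] W_a)
    then have "T (act (word_of w) (simple_vec s) - act (word_of v) (simple_vec s)) = (?k - ?m) *\<^sub>R a"
      by (simp add: linear_diff[OF linear_realise] algebra_simps)
    then have "act (word_of w) (simple_vec s) - act (word_of v) (simple_vec s) = 0"
      using Sw s
      by (intro realise_indep subspace_diff subspace_geom_space act_in_geom_space simple_in_geom_space)
    then show ?thesis by simp
  qed
  then have "word_of w \<frown> word_of v" using Sw act_faithful by blast
  then have "word_value G (word_of w) = word_value G (word_of v)"
    using word_value_eq_iff[OF Sw] by simp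
  then have wv: "w = v" using * word_of by simp
  have E_eq: "E (T x) u = E (T y) u" if "u \<in> U" for u
  proof -
    have cancel: "W (rev (word_of w)) (W (word_of w) z) = z" for z
      by (rule word_refl_rev[OF norm_set[OF Sw(1)]])
    have "W (word_of w) (E (T x) u) = W (word_of w) (E (T y) u)"
      using eq'[OF that] wv by simp
    from arg_cong[OF this, of "W (rev (word_of w))"] show ?thesis
      by (simp only: cancel)
  qed
  have "x - y = 0"
  proof (rule transvection_faithful)
    show "x - y \<in> geom_space S"
      using * lattice_in_geom_space subspace_geom_space by (simp add: subspace_diff)
    fix u assume u: "u \<in> U"
    \<comment> \<open>The difference of the quadratic terms of the two transvections.\<close>
    let ?k = "(F (T x) (T x) - F (T y) (T y)) / 2"
    have "F a u *\<^sub>R T (x - y) = (F (T (x - y)) u + ?k * F a u) *\<^sub>R a"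
      using E_eq[OF u] unfolding E_def
      by (simp add: linear_diff[OF linear_realise] form_simps algebra_simps diff_divide_distrib)
    then show "\<exists>k. F a u *\<^sub>R T (x - y) = (F (T (x - y)) u + k * F a u) *\<^sub>R a" by blast
  qed
  then show "p = q" using wv pq by simp
qed

lemma \<psi>_surj: "\<psi> ` carrier EG = generate GL X"
proof
  show "\<psi> ` carrier EG \<subseteq> generate GL X" using \<psi>_generate by blast
  have "word_value GL xs \<in> \<psi> ` carrier EG" if "set xs \<subseteq> X" for xs
    using that
  proof (induction xs)
    case Nil
    have "(\<one>, 0) \<in> carrier EG" by (simp add: extended_coxeter_group_def lattice_zero)
    moreover have "\<psi> (\<one>, 0) = \<one>\<^bsub>GL\<^esub>"
      using W_cong[OF word_of_one]
      by (auto simp: \<psi>_def E_zero T_zero one_gen_lin fun_eq_iff)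
    ultimately show ?case by (metis foldr_Nil id_apply image_eqI word_value_def)
  next
    case (Cons f fs)
    then obtain p where p: "p \<in> carrier EG" "f = \<psi> p"
      using \<psi>_gens gens_EG by fastforce
    obtain q where q: "q \<in> carrier EG" "word_value GL fs = \<psi> q" using Cons by auto
    have "word_value GL (f # fs) = \<psi> (p \<otimes>\<^bsub>EG\<^esub> q)"
      using p q by (simp add: word_value_def \<psi>_mult)
    then show ?case using EG_closed p q by blast
  qed
  then show "generate GL X \<subseteq> \<psi> ` carrier EG"
    using GL.generate_involutions[OF X_GL X_involution] by (auto simp: lists_eq_set)
qed

theorem pair_isomorphic_extension:
  "pair_isomorphic (GL\<lparr>carrier := generate GL X\<rparr>) X EG (extended_coxeter_gens S c)"
proof -
  let ?h = "inv_into (carrier EG) \<psi>"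
  have bij: "bij_betw \<psi> (carrier EG) (generate GL X)"
    using \<psi>_inj \<psi>_surj by (simp add: bij_betw_def)
  have h\<psi>: "?h (\<psi> p) = p" if "p \<in> carrier EG" for p
    using that \<psi>_inj by simp
  have "?h \<in> hom (GL\<lparr>carrier := generate GL X\<rparr>) EG"
  proof (rule homI)
    fix f g assume "f \<in> carrier (GL\<lparr>carrier := generate GL X\<rparr>)" "g \<in> carrier (GL\<lparr>carrier := generate GL X\<rparr>)"
    then have "f \<in> \<psi> ` carrier EG" "g \<in> \<psi> ` carrier EG"
      by (simp_all add: \<psi>_surj)
    then obtain p q where "p \<in> carrier EG" "f = \<psi> p" "q \<in> carrier EG" "g = \<psi> q"
      by blast
    then show "?h (f \<otimes>\<^bsub>GL\<lparr>carrier := generate GL X\<rparr>\<^esub> g) = ?h f \<otimes>\<^bsub>EG\<^esub> ?h g"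
      by (simp add: h\<psi> EG_closed flip: \<psi>_mult)
  next
    fix f assume "f \<in> carrier (GL\<lparr>carrier := generate GL X\<rparr>)"
    then have "f \<in> \<psi> ` carrier EG" by (simp add: \<psi>_surj)
    then show "?h f \<in> carrier EG" by (rule inv_into_into)
  qed
  moreover have "bij_betw ?h (generate GL X) (carrier EG)"
    using bij by (rule bij_betw_inv_into)
  ultimately have "?h \<in> iso (GL\<lparr>carrier := generate GL X\<rparr>) EG"
    by (simp add: iso_def)
  moreover have "bij_betw ?h X (extended_coxeter_gens S c)"
    by (rule bij_betw_inv_into_subset[OF bij gens_EG \<psi>_gens])
  ultimately show ?thesis unfolding pair_isomorphic_def by blast
qed

end

subsection \<open>Star-shaped trees\<close>

lemma diagram_vertices_bar_simps [simp]:
  "Centre \<in> bar p"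
  "CentreStar \<notin> bar p"
  "Arm i j \<in> bar p \<longleftrightarrow> i < length p \<and> 1 \<le> j \<and> j \<le> p ! i"
  by (auto simp: diagram_vertices_bar_def)

lemma finite_bar: "finite (bar p)"
proof -
  have "bar p \<subseteq> insert Centre (\<Union>i<length p. Arm i ` {..p ! i})"
    by (auto simp: diagram_vertices_bar_def)
  then show ?thesis by (rule finite_subset) auto
qed

lemma single_edge_simps [simp]:
  "\<not> single_edge Centre Centre"
  "single_edge Centre (Arm i j) \<longleftrightarrow> j = 1"
  "single_edge (Arm i j) Centre \<longleftrightarrow> j = 1"
  "single_edge (Arm i j) (Arm k l) \<longleftrightarrow> i = k \<and> (l = j + 1 \<or> j = l + 1)"
  "single_edge CentreStar (Arm i j) \<longleftrightarrow> j = 1"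
  "single_edge (Arm i j) CentreStar \<longleftrightarrow> j = 1"
  "\<not> single_edge Centre CentreStar"
  "\<not> single_edge CentreStar Centre"
  "\<not> single_edge CentreStar CentreStar"
  by (auto simp: single_edge_def doubleton_eq_iff)

lemma single_edge_commute: "single_edge x y \<longleftrightarrow> single_edge y x"
  unfolding single_edge_def by (simp add: insert_commute)

abbreviation edges_on :: "'v set \<Rightarrow> ('v \<Rightarrow> 'v \<Rightarrow> bool) \<Rightarrow> ('v \<times> 'v) set" where
  "edges_on V E \<equiv> {(u, v). u \<in> V \<and> v \<in> V \<and> E u v}"

lemma diagram_connected_Centre:
  assumes "x \<in> bar p"
  shows "(Centre, x) \<in> (edges_on (bar p) single_edge)\<^sup>*"
proof (cases x)
  case (Arm i j)
  have "j \<le> p ! i \<Longrightarrow> i < length p \<Longrightarrow> 1 \<le> j \<Longrightarrow>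
      (Centre, Arm i j) \<in> (edges_on (bar p) single_edge)\<^sup>*" for j
  proof (induction j)
    case (Suc j)
    show ?case
    proof (cases "j = 0")
      case True
      then have "(Centre, Arm i (Suc j)) \<in> edges_on (bar p) single_edge"
        using Suc.prems by simp
      then show ?thesis by (rule r_into_rtrancl)
    next
      case False
      then have "(Arm i j, Arm i (Suc j)) \<in> edges_on (bar p) single_edge"
        using Suc.prems by simp
      then show ?thesis using Suc False by (intro rtrancl_into_rtrancl[OF Suc.IH]) auto
    qed
  qed simp
  then show ?thesis using assms Arm by simp
qed (use assms in simp_all)

lemma diagram_connected:
  assumes "x \<in> bar p" "y \<in> bar p"
  shows "(x, y) \<in> (edges_on (bar p) single_edge)\<^sup>*"
proof -
  let ?R = "edges_on (bar p) single_edge"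
  have "sym ?R" by (auto simp: sym_def single_edge_commute)
  then have "sym (?R\<^sup>*)" by (rule sym_rtrancl)
  then have "(x, Centre) \<in> ?R\<^sup>*" using diagram_connected_Centre[OF assms(1)] by (rule symD)
  then show ?thesis using diagram_connected_Centre[OF assms(2)] by (rule rtrancl_trans)
qed

lemma edges_on_image:
  assumes "(x, y) \<in> (edges_on V E)\<^sup>*" "\<And>u v. u \<in> V \<Longrightarrow> v \<in> V \<Longrightarrow> E u v \<Longrightarrow> E' (\<phi> u) (\<phi> v)"
  shows "(\<phi> x, \<phi> y) \<in> (edges_on (\<phi> ` V) E')\<^sup>*"
  using assms(1)
proof induction
  case (step y z)
  then have "(\<phi> y, \<phi> z) \<in> edges_on (\<phi> ` V) E'" using assms(2) by auto
  with step.IH show ?case by (rule rtrancl_into_rtrancl)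
qed simp

lemma simple_path_exists:
  assumes "(x, y) \<in> (edges_on V E)\<^sup>*" "x \<in> V"
  shows "\<exists>xs. xs \<noteq> [] \<and> hd xs = x \<and> last xs = y \<and> distinct xs \<and> set xs \<subseteq> V \<and> successively E xs"
  using assms(1)
proof induction
  case base
  then show ?case using assms(2) by (intro exI[of _ "[x]"]) simp
next
  case (step y z)
  then obtain xs where xs: "xs \<noteq> []" "hd xs = x" "last xs = y" "distinct xs" "set xs \<subseteq> V" "successively E xs"
    by blast
  show ?case
  proof (cases "z \<in> set xs")
    case True
    then obtain us vs where "xs = (us @ [z]) @ vs" by (auto dest: split_list)
    moreover from this xs(6) have "successively E (us @ [z])"
      by (simp only: successively_append_iff)
    ultimately show ?thesis
      using xs by (intro exI[of _ "us @ [z]"]) (cases us; auto)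
  next
    case False
    then show ?thesis
      using xs step.hyps by (intro exI[of _ "xs @ [z]"]) (auto simp: successively_append_iff)
  qed
qed

text \<open>An isomorphism from the diagram without its starred vertex onto a graph. The bound on
  the arm lengths is included so that the list found along with it is an admissible parameter of an
  extended Weyl system.\<close>

definition diagram_embedding ::
    "nat list \<Rightarrow> (vertex \<Rightarrow> 'v) \<Rightarrow> 'v set \<Rightarrow> ('v \<Rightarrow> 'v \<Rightarrow> bool) \<Rightarrow> bool" where
  "diagram_embedding p \<phi> A E \<longleftrightarrow>
     (\<forall>k\<in>set p. 1 \<le> k) \<and> bij_betw \<phi> (bar p) A \<and>
     (\<forall>x\<in>bar p. \<forall>y\<in>bar p. E (\<phi> x) (\<phi> y) \<longleftrightarrow> single_edge x y)"

lemma diagram_embedding_extend: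
  assumes emb: "diagram_embedding p \<phi> A E" and p': "\<forall>k\<in>set p'. 1 \<le> k"
    and bar: "bar p' = insert x0 (bar p)" "x0 \<notin> bar p"
    and l: "l \<notin> A" "\<not> E l l"
    and edge: "\<And>x. x \<in> bar p \<Longrightarrow> E (\<phi> x) l \<longleftrightarrow> single_edge x x0"
      "\<And>x. x \<in> bar p \<Longrightarrow> E l (\<phi> x) \<longleftrightarrow> single_edge x x0"
    and x0: "\<not> single_edge x0 x0"
  shows "diagram_embedding p' (\<phi>(x0 := l)) (insert l A) E"
proof -
  have bij: "bij_betw \<phi> (bar p) A" using emb by (simp add: diagram_embedding_def)
  then have "bij_betw (\<phi>(x0 := l)) (bar p) A"
    by (rule bij_betw_cong[THEN iffD1, rotated]) (use bar in auto)
  then have "bij_betw (\<phi>(x0 := l)) (bar p \<union> {x0}) (A \<union> {l})"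
    by (rule bij_betw_combine) (use l in \<open>auto simp: bij_betw_def\<close>)
  then have "bij_betw (\<phi>(x0 := l)) (bar p') (insert l A)"
    by (simp add: bar(1))
  moreover have "E ((\<phi>(x0 := l)) x) ((\<phi>(x0 := l)) y) \<longleftrightarrow> single_edge x y"
    if "x \<in> bar p'" "y \<in> bar p'" for x y
  proof -
    have "x = x0 \<or> x \<noteq> x0 \<and> x \<in> bar p" "y = x0 \<or> y \<noteq> x0 \<and> y \<in> bar p"
      using that bar by auto
    moreover have "E (\<phi> x) (\<phi> y) \<longleftrightarrow> single_edge x y"
      if "x \<in> bar p" "y \<in> bar p"
      using emb that by (simp add: diagram_embedding_def)
    ultimately show ?thesis
      using edge(1)[of x] edge(2)[of y] l(2) x0 single_edge_commute[of y x0] by auto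
  qed
  ultimately show ?thesis using p' by (simp add: diagram_embedding_def)
qed

text \<open>Two different neighbours of l in the connected set A would be joined by a simple path
  inside A, and l closes this path to a cycle.\<close>

lemma tree_unique_attachment:
  assumes tree: "is_tree V E" and A: "A \<subseteq> V" "\<And>x y. x \<in> A \<Longrightarrow> y \<in> A \<Longrightarrow> (x, y) \<in> (edges_on A E)\<^sup>*"
    and l: "l \<in> V" "l \<notin> A" and uv: "u \<in> A" "v \<in> A" "E l u" "E v l"
  shows "u = v"
proof (rule ccontr)
  assume ne: "u \<noteq> v"
  obtain xs where xs: "xs \<noteq> []" "hd xs = u" "last xs = v" "distinct xs" "set xs \<subseteq> A" "successively E xs"
    using simple_path_exists[OF A(2)[OF uv(1,2)] uv(1)] by blast
  have "2 \<le> length xs"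
    using xs(1-3) ne by (cases xs rule: list.exhaust; cases "tl xs") auto
  then have "set (l # xs) \<subseteq> V \<and> distinct (l # xs) \<and> 3 \<le> length (l # xs) \<and>
      successively E (l # xs) \<and> E (last (l # xs)) (hd (l # xs))"
    using xs A l uv by (auto simp: successively_Cons)
  then show False using tree unfolding is_tree_def by blast
qed

text \<open>Connectedness provides a missing vertex l adjacent to the embedded part, and it is
  attached at exactly one vertex. At the centre it opens a new arm of length 1; elsewhere it must
  sit at the tip of an arm, which becomes longer by one.\<close>

lemma star_embedding_step:
  assumes tree: "is_tree V E"
    and sym: "\<And>x y. x \<in> V \<Longrightarrow> y \<in> V \<Longrightarrow> E x y \<longleftrightarrow> E y x" and irrefl: "\<And>x. \<not> E x x"
    and c: "c \<in> V" and deg: "\<And>x. x \<in> V \<Longrightarrow> x \<noteq> c \<Longrightarrow> degree_in V E x \<le> 2"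
    and emb: "diagram_embedding p \<phi> A E" "\<phi> Centre = c" and A: "A \<subseteq> V" "A \<noteq> V"
  shows "\<exists>p' \<phi>' l. l \<in> V - A \<and> diagram_embedding p' \<phi>' (insert l A) E \<and> \<phi>' Centre = c"
proof -
  have fin: "finite V" using tree by (simp add: is_tree_def)
  have bij: "bij_betw \<phi> (bar p) A"
    and edges: "\<And>x y. x \<in> bar p \<Longrightarrow> y \<in> bar p \<Longrightarrow> E (\<phi> x) (\<phi> y) \<longleftrightarrow> single_edge x y"
    using emb by (auto simp: diagram_embedding_def)
  have img: "A = \<phi> ` bar p" and inj: "inj_on \<phi> (bar p)"
    using bij by (auto simp: bij_betw_def)
  have cA: "c \<in> A" using emb(2) img by auto
  have conn: "(x, y) \<in> (edges_on A E)\<^sup>*" if xy: "x \<in> A" "y \<in> A" for x y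
  proof -
    obtain x' y' where "x' \<in> bar p" "y' \<in> bar p" "x = \<phi> x'" "y = \<phi> y'"
      using xy img by auto
    then show ?thesis
      using edges_on_image[OF diagram_connected[of x' p y'], of E \<phi>] edges img by auto
  qed
  obtain l u where lu: "u \<in> A" "l \<in> V" "l \<notin> A" "E u l"
  proof (rule ccontr)
    assume no: "\<not> thesis"
    note obtained = that
    have closed: "v \<in> A" if "u \<in> A" "v \<in> V" "E u v" for u v using that obtained no by blast
    obtain s where s: "s \<in> V" "s \<notin> A" using A by blast
    then have "(c, s) \<in> (edges_on V E)\<^sup>*" using tree c by (simp add: is_tree_def)
    then have "s \<in> A"
      by induction (use cA closed in auto)
    then show False using s by simp
  qed
  have uniq: "v = u" if "v \<in> A" "E v l" for v
    using tree_unique_attachment[OF tree A(1) conn lu(2,3), of u v] that lu sym[of u l] A by auto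
  obtain x where x: "x \<in> bar p" "u = \<phi> x" using lu img by auto
  have E_l: "E (\<phi> y) l \<longleftrightarrow> y = x" "E l (\<phi> y) \<longleftrightarrow> y = x" if "y \<in> bar p" for y
    using that uniq[of "\<phi> y"] lu x sym[of "\<phi> y" l] inj A(1) img by (auto dest: inj_onD)
  have pos: "\<forall>k\<in>set p. 1 \<le> k" using emb by (simp add: diagram_embedding_def)
  show ?thesis
  proof (cases x)
    case Centre
    have mem: "y \<in> bar (p @ [1]) \<longleftrightarrow> y = Arm (length p) 1 \<or> y \<in> bar p" for y
      by (cases y) (auto simp: nth_append less_Suc_eq)
    have bar: "bar (p @ [1]) = insert (Arm (length p) 1) (bar p)"
      using mem by blast
    have nbr: "single_edge y (Arm (length p) 1) \<longleftrightarrow> y = x" if "y \<in> bar p" for y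
      using that Centre by (cases y) auto
    have "diagram_embedding (p @ [1]) (\<phi>(Arm (length p) 1 := l)) (insert l A) E"
      by (rule diagram_embedding_extend[OF emb(1) _ bar _ lu(3) irrefl])
        (use pos in \<open>auto simp: E_l nbr simp del: One_nat_def\<close>)
    moreover have "(\<phi>(Arm (length p) 1 := l)) Centre = c" using emb(2) by simp
    ultimately show ?thesis using lu by blast
  next
    case CentreStar
    then show ?thesis using x by simp
  next
    case (Arm i j)
    have ij: "i < length p" "1 \<le> j" "j \<le> p ! i" using x Arm by auto
    have j: "j = p ! i"
    proof (rule ccontr)
      \<comment> \<open>An inner vertex of an arm already has two neighbours in A, so l would be a
        third one, against the degree bound away from c.\<close>
      assume "j \<noteq> p ! i"
      define y where "y = (if j = 1 then Centre else Arm i (j - 1))"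
      define z where "z = Arm i (j + 1)"
      have yz: "y \<in> bar p" "z \<in> bar p" "y \<noteq> z" "single_edge x y" "single_edge x z"
        using ij \<open>j \<noteq> p ! i\<close> Arm by (auto simp: y_def z_def)
      then have "E u (\<phi> y)" "E u (\<phi> z)" "\<phi> y \<noteq> \<phi> z" "\<phi> y \<in> A" "\<phi> z \<in> A"
        using x edges inj img by (auto dest: inj_onD)
      then have sub: "{\<phi> y, \<phi> z, l} \<subseteq> {w \<in> V. E u w}" and three: "card {\<phi> y, \<phi> z, l} = 3"
        using lu A by (auto simp: card_insert_if)
      have "u \<noteq> c" using x Arm emb(2) inj by (metis diagram_vertices_bar_simps(1) inj_onD vertex.distinct(3))
      then have "card {w \<in> V. E u w} \<le> 2" using deg[of u] lu A by (auto simp: degree_in_def)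
      moreover have "card {\<phi> y, \<phi> z, l} \<le> card {w \<in> V. E u w}"
        using fin sub by (intro card_mono) auto
      ultimately show False using three by simp
    qed
    have mem: "y \<in> bar (p[i := j + 1]) \<longleftrightarrow> y = Arm i (j + 1) \<or> y \<in> bar p" for y
      using ij(1) j by (cases y) (auto simp: nth_list_update)
    have bar: "bar (p[i := j + 1]) = insert (Arm i (j + 1)) (bar p)"
      using mem by blast
    have nbr: "single_edge y (Arm i (j + 1)) \<longleftrightarrow> y = x" if "y \<in> bar p" for y
      using that Arm ij j by (cases y) auto
    have p': "\<forall>k\<in>set (p[i := j + 1]). 1 \<le> k"
      using pos set_update_subset_insert[of p i "j + 1"] by auto
    have new: "Arm i (j + 1) \<notin> bar p" using j by simp
    have "diagram_embedding (p[i := j + 1]) (\<phi>(Arm i (j + 1) := l)) (insert l A) E"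
      by (rule diagram_embedding_extend[OF emb(1) p' bar new lu(3) irrefl]) (simp_all only: E_l nbr, simp)
    moreover have "(\<phi>(Arm i (j + 1) := l)) Centre = c" using emb(2) by simp
    ultimately show ?thesis using lu by blast
  qed
qed

theorem star_tree_is_diagram:
  assumes tree: "is_tree V E"
    and sym: "\<And>x y. x \<in> V \<Longrightarrow> y \<in> V \<Longrightarrow> E x y \<longleftrightarrow> E y x" and irrefl: "\<And>x. \<not> E x x"
    and c: "c \<in> V" and deg: "\<And>x. x \<in> V \<Longrightarrow> x \<noteq> c \<Longrightarrow> degree_in V E x \<le> 2"
  obtains p \<phi> where "diagram_embedding p \<phi> V E" "\<phi> Centre = c"
proof -
  have fin: "finite V" using tree by (simp add: is_tree_def)
  have "\<exists>p \<phi> A. A \<subseteq> V \<and> card A = Suc n \<and> diagram_embedding p \<phi> A E \<and> \<phi> Centre = c"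
    if "Suc n \<le> card V" for n
    using that
  proof (induction n)
    case 0
    have "bar [] = {Centre}" by (auto simp: diagram_vertices_bar_def)
    then have "diagram_embedding [] (\<lambda>_. c) {c} E"
      using irrefl by (auto simp: diagram_embedding_def bij_betw_def)
    then show ?case using c by (intro exI[of _ "[]"] exI[of _ "\<lambda>_. c"] exI[of _ "{c}"]) simp
  next
    case (Suc n)
    then obtain p \<phi> A where A: "A \<subseteq> V" "card A = Suc n" "diagram_embedding p \<phi> A E" "\<phi> Centre = c"
      by auto
    then have "A \<noteq> V" using Suc.prems by auto
    from star_embedding_step[OF tree sym irrefl c deg A(3,4,1) this]
    obtain p' \<phi>' l where *: "l \<in> V - A" "diagram_embedding p' \<phi>' (insert l A) E" "\<phi>' Centre = c" by blast
    moreover have "finite A" using A(1) fin by (rule finite_subset)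
    then have "card (insert l A) = Suc (Suc n)" using A * by simp
    ultimately show ?case using A(1) by (intro exI[of _ p'] exI[of _ \<phi>'] exI[of _ "insert l A"]) auto
  qed
  moreover have "card V \<noteq> 0" using fin c by auto
  ultimately obtain p \<phi> A where "A \<subseteq> V" "card A = card V" "diagram_embedding p \<phi> A E" "\<phi> Centre = c"
    by (metis Suc_pred' gr0I order_refl)
  then show ?thesis using that card_subset_eq[OF fin] by metis
qed

text \<open>On a cycle, both neighbours of a vertex of maximal depth would be its parent.\<close>

lemma acyclic_by_depth:
  fixes d :: "'v \<Rightarrow> nat"
  assumes adj: "\<And>x y. x \<in> V \<Longrightarrow> y \<in> V \<Longrightarrow> E x y \<Longrightarrow> E y x \<and> (d y = Suc (d x) \<or> d x = Suc (d y))"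
    and parent: "\<And>x y z. x \<in> V \<Longrightarrow> y \<in> V \<Longrightarrow> z \<in> V \<Longrightarrow> E x y \<Longrightarrow> E x z \<Longrightarrow> d x = Suc (d y) \<Longrightarrow> d x = Suc (d z) \<Longrightarrow> y = z"
    and xs: "set xs \<subseteq> V" "distinct xs" "3 \<le> length xs" "successively E xs" "E (last xs) (hd xs)"
  shows False
proof -
  let ?n = "length xs"
  define nx where "nx i = (if Suc i < ?n then Suc i else 0)" for i
  define pv where "pv i = (if i = 0 then ?n - 1 else i - 1)" for i
  have E_nx: "E (xs ! i) (xs ! nx i)" if "i < ?n" for i
  proof (cases "Suc i < ?n")
    case True
    then show ?thesis using xs(4) by (simp add: successively_conv_nth nx_def)
  next
    case False
    then have "i = ?n - 1" using that by simp
    moreover have "xs \<noteq> []" using xs(3) by auto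
    ultimately show ?thesis using xs(5) by (simp add: nx_def last_conv_nth hd_conv_nth)
  qed
  have "Max (d ` set xs) \<in> d ` set xs" using xs(3) by (intro Max_in) auto
  then obtain m where m: "m \<in> set xs" "d m = Max (d ` set xs)" by (metis imageE)
  have max: "d y \<le> d m" if "y \<in> set xs" for y using that m(2) by simp
  obtain k where k: "k < ?n" "m = xs ! k" using m(1) by (metis in_set_conv_nth)
  have lt: "nx k < ?n" "pv k < ?n" "nx (pv k) = k" "nx k \<noteq> pv k"
    using k xs(3) by (auto simp: nx_def pv_def)
  have E1: "E m (xs ! nx k)" using E_nx[of k] k by simp
  have E2: "E m (xs ! pv k)" using E_nx[of "pv k"] k lt adj xs(1) by (metis nth_mem subsetD)
  have down: "d m = Suc (d (xs ! i))" if i: "E m (xs ! i)" "i < ?n" for i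
  proof -
    have "xs ! i \<in> set xs" using i(2) by simp
    then have "xs ! i \<in> V" "d (xs ! i) \<le> d m" "m \<in> V" using xs(1) max m(1) by auto
    then show ?thesis using adj[of m "xs ! i"] i(1) by linarith
  qed
  have "xs ! nx k \<in> V" "xs ! pv k \<in> V" "m \<in> V" using xs(1) m(1) lt by auto
  then have "xs ! nx k = xs ! pv k"
    using E1 E2 down[OF E1 lt(1)] down[OF E2 lt(2)] by (intro parent[of m])
  then show False using lt xs(2) by (simp add: nth_eq_iff_index_eq)
qed

fun depth :: "vertex \<Rightarrow> nat" where
  "depth (Arm i j) = j" | "depth _ = 0"

lemma depth_adjacent:
  assumes "x \<in> bar p" "y \<in> bar p" "single_edge x y"
  shows "depth y = Suc (depth x) \<or> depth x = Suc (depth y)"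
  using assms by (cases x; cases y) auto

lemma depth_parent:
  assumes "y \<in> bar p" "z \<in> bar p"
    "single_edge x y" "single_edge x z" "depth x = Suc (depth y)" "depth x = Suc (depth z)"
  shows "y = z"
  using assms by (cases x; cases y; cases z) auto

lemma diagram_is_tree:
  assumes emb: "diagram_embedding p \<phi> V E"
  shows "is_tree V E"
proof -
  have bij: "bij_betw \<phi> (bar p) V"
    and edges: "\<And>x y. x \<in> bar p \<Longrightarrow> y \<in> bar p \<Longrightarrow> E (\<phi> x) (\<phi> y) \<longleftrightarrow> single_edge x y"
    using emb by (auto simp: diagram_embedding_def)
  have img: "V = \<phi> ` bar p" and inj: "inj_on \<phi> (bar p)"
    using bij by (auto simp: bij_betw_def)
  define \<pi> where "\<pi> = inv_into (bar p) \<phi>"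
  have \<pi>: "\<pi> v \<in> bar p" "\<phi> (\<pi> v) = v" if "v \<in> V" for v
    using that img by (auto simp: \<pi>_def inv_into_into f_inv_into_f)
  have E: "E u v \<longleftrightarrow> single_edge (\<pi> u) (\<pi> v)" if "u \<in> V" "v \<in> V" for u v
    using edges[of "\<pi> u" "\<pi> v"] \<pi> that by simp
  have "finite V" "V \<noteq> {}"
    using img finite_bar diagram_vertices_bar_simps(1)[of p] by (simp, blast)
  moreover have "(x, y) \<in> (edges_on V E)\<^sup>*" if "x \<in> V" "y \<in> V" for x y
    using edges_on_image[OF diagram_connected[of "\<pi> x" p "\<pi> y"], of E \<phi>] edges img \<pi> that by auto
  moreover have False
    if "set xs \<subseteq> V" "distinct xs" "3 \<le> length xs" "successively E xs" "E (last xs) (hd xs)" for xs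
  proof (rule acyclic_by_depth[OF _ _ that])
    fix x y assume xy: "x \<in> V" "y \<in> V" "E x y"
    then show "E y x \<and> (depth (\<pi> y) = Suc (depth (\<pi> x)) \<or> depth (\<pi> x) = Suc (depth (\<pi> y)))"
      using depth_adjacent[OF \<pi>(1) \<pi>(1), of x y] single_edge_commute by (simp add: E)
  next
    fix x y z assume xyz: "x \<in> V" "y \<in> V" "z \<in> V" "E x y" "E x z"
      "depth (\<pi> x) = Suc (depth (\<pi> y))" "depth (\<pi> x) = Suc (depth (\<pi> z))"
    then have "\<pi> y = \<pi> z"
      using depth_parent[OF \<pi>(1) \<pi>(1), of y z "\<pi> x"] by (simp add: E)
    then show "y = z" using \<pi>(2)[OF xyz(2)] \<pi>(2)[OF xyz(3)] by metis
  qed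
  ultimately show ?thesis unfolding is_tree_def by blast
qed

lemma diagram_degree:
  assumes emb: "diagram_embedding p \<phi> V E" and x: "x \<in> V" "x \<noteq> \<phi> Centre"
  shows "degree_in V E x \<le> 2"
proof -
  have edges: "\<And>x y. x \<in> bar p \<Longrightarrow> y \<in> bar p \<Longrightarrow> E (\<phi> x) (\<phi> y) \<longleftrightarrow> single_edge x y"
    and img: "V = \<phi> ` bar p"
    using emb by (auto simp: diagram_embedding_def bij_betw_def)
  obtain z where z: "z \<in> bar p" "x = \<phi> z" using x img by auto
  then obtain i j where ij: "z = Arm i j" using x by (cases z) auto
  have "{y \<in> V. E x y} \<subseteq> {\<phi> (if j = 1 then Centre else Arm i (j - 1)), \<phi> (Arm i (j + 1))}"
  proof
    fix y assume "y \<in> {y \<in> V. E x y}"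
    then obtain w where w: "w \<in> bar p" "y = \<phi> w" "single_edge z w"
      using img edges z by auto
    then have "w = (if j = 1 then Centre else Arm i (j - 1)) \<or> w = Arm i (j + 1)"
      using z ij by (cases w) auto
    then show "y \<in> {\<phi> (if j = 1 then Centre else Arm i (j - 1)), \<phi> (Arm i (j + 1))}"
      using w by blast
  qed
  then have "degree_in V E x \<le> card {\<phi> (if j = 1 then Centre else Arm i (j - 1)), \<phi> (Arm i (j + 1))}"
    unfolding degree_in_def by (intro card_mono) auto
  also have "\<dots> \<le> 2" by (simp add: card_insert_if)
  finally show ?thesis .
qed

subsection \<open>The form of the diagram\<close>

lemma weyl_gram_commute: "weyl_gram x y = weyl_gram y x"
  by (simp add: weyl_gram_def single_edge_commute insert_commute eq_commute)

lemma weyl_gram_same [simp]: "weyl_gram x x = 2"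
  by (simp add: weyl_gram_def)

lemma weyl_gram_bar:
  assumes "x \<in> bar p" "y \<in> bar p"
  shows "weyl_gram x y = (if x = y then 2 else if single_edge x y then - 1 else 0)"
proof -
  have "{x, y} \<noteq> {Centre, CentreStar}"
    using assms by (auto simp: doubleton_eq_iff)
  then show ?thesis by (simp add: weyl_gram_def)
qed

text \<open>The dotted bond carries the value 2, the same as the diagonal, so the rows of the two
  double vertices coincide. This is what puts a into the radical.\<close>

lemma weyl_gram_CentreStar: "weyl_gram CentreStar y = weyl_gram Centre y"
  by (cases y) (auto simp: weyl_gram_def doubleton_eq_iff)

interpretation weyl: sym_form weyl_form
  by unfold_locales (simp_all add: bilinear_gram_form gram_form_commute weyl_gram_commute)

lemma weyl_form_simple: "weyl_form (simple_vec x) (simple_vec y) = weyl_gram x y"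
  by (rule gram_form_simple_vec)

lemma weyl_form_radical_a: "weyl_form radical_a v = 0"
proof -
  have "weyl_form (simple_vec CentreStar) v = weyl_form (simple_vec Centre) v"
    by (simp add: gram_form_simple_vec_left[of "keys v"] weyl_gram_CentreStar)
  then show ?thesis by (simp add: radical_a_def weyl.form_simps)
qed

lemma finite_diagram_vertices: "finite (diagram_vertices p)"
  by (simp add: diagram_vertices_def finite_bar)

lemma weyl_basis_bar_eq: "weyl_basis_bar p = simple_vec ` bar p"
  by (auto simp: weyl_basis_bar_def weyl_basis_def diagram_vertices_def)

lemma weyl_space_iff: "v \<in> weyl_space p \<longleftrightarrow> keys v \<subseteq> diagram_vertices p"
  by (simp add: weyl_space_def weyl_basis_def in_span_simple_vec)

lemma weyl_space_bar_iff: "v \<in> span (weyl_basis_bar p) \<longleftrightarrow> keys v \<subseteq> bar p"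
  by (simp add: weyl_basis_bar_eq in_span_simple_vec)

text \<open>The centre counts as position 0 of every arm, so that pairing with an arm vertex is a
  three-term expression also for j = 1. For vectors supported on the diagram the coordinate past the
  tip is 0, and the tip follows the same rule.\<close>

definition arm_coord :: "(vertex \<Rightarrow>\<^sub>0 real) \<Rightarrow> nat \<Rightarrow> nat \<Rightarrow> real" where
  "arm_coord v i j = lookup v (if j = 0 then Centre else Arm i j)"

lemma weyl_form_arm:
  assumes v: "keys v \<subseteq> bar p" and j: "1 \<le> j"
  shows "weyl_form (simple_vec (Arm i j)) v =
    2 * arm_coord v i j - arm_coord v i (j - 1) - arm_coord v i (j + 1)"
proof -
  let ?f = "\<lambda>y. lookup v y * weyl_gram (Arm i j) y"
  define N where "N = {Arm i j, if j = 1 then Centre else Arm i (j - 1), Arm i (j + 1)}"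
  have out: "?f y = 0" if "y \<in> (bar p \<union> N) - N" for y
  proof -
    have "y \<in> bar p" "y \<notin> N" using that by auto
    then have "weyl_gram (Arm i j) y = 0"
      by (cases y) (auto simp: weyl_gram_def N_def doubleton_eq_iff split: if_splits)
    then show ?thesis by simp
  qed
  \<comment> \<open>The index set is enlarged by N since the successor of a tip is no vertex of the
    diagram; the coefficients of v at such points are 0.\<close>
  have "weyl_form (simple_vec (Arm i j)) v = (\<Sum>y\<in>bar p \<union> N. ?f y)"
    using v by (intro gram_form_simple_vec_left) (auto simp: N_def finite_bar)
  also have "\<dots> = (\<Sum>y\<in>N. ?f y)"
    using out by (intro sum.mono_neutral_right) (auto simp: N_def finite_bar)
  also have "\<dots> = 2 * arm_coord v i j - arm_coord v i (j - 1) - arm_coord v i (j + 1)"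
  proof (cases "j = 1")
    case True
    then show ?thesis
      by (simp add: N_def arm_coord_def weyl_gram_def doubleton_eq_iff)
  next
    case False
    then have "Suc 0 < j" "j \<noteq> j - Suc 0" using j by simp_all
    then show ?thesis
      by (simp add: N_def arm_coord_def weyl_gram_def doubleton_eq_iff)
  qed
  finally show ?thesis .
qed

lemma weyl_form_Centre:
  assumes v: "keys v \<subseteq> bar p"
  shows "weyl_form (simple_vec Centre) v =
    2 * lookup v Centre - (\<Sum>i<length p. lookup v (Arm i 1))"
proof -
  let ?f = "\<lambda>y. lookup v y * weyl_gram Centre y"
  define N where "N = (\<lambda>i. Arm i 1) ` {..<length p}"
  have N: "finite N" "Centre \<notin> N" by (auto simp: N_def)
  have out: "?f y = 0" if "y \<in> (bar p \<union> insert Centre N) - insert Centre N" for y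
  proof -
    have "y \<in> bar p" "y \<notin> insert Centre N" using that by auto
    then have "weyl_gram Centre y = 0"
      by (cases y) (auto simp: weyl_gram_def N_def doubleton_eq_iff split: if_splits)
    then show ?thesis by simp
  qed
  have "weyl_form (simple_vec Centre) v = (\<Sum>y\<in>bar p \<union> insert Centre N. ?f y)"
    using v by (intro gram_form_simple_vec_left) (auto simp: N_def finite_bar)
  also have "\<dots> = (\<Sum>y\<in>insert Centre N. ?f y)"
    using out by (intro sum.mono_neutral_right) (auto simp: N_def finite_bar)
  also have "\<dots> = 2 * lookup v Centre + (\<Sum>y\<in>N. ?f y)"
    using N by simp
  also have "(\<Sum>y\<in>N. ?f y) = (\<Sum>i<length p. ?f (Arm i 1))"
    unfolding N_def by (subst sum.reindex) (auto simp: inj_on_def)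
  also have "\<dots> = - (\<Sum>i<length p. lookup v (Arm i 1))"
    by (simp add: weyl_gram_def doubleton_eq_iff sum_negf)
  finally show ?thesis by simp
qed

text \<open>A vanishing second difference makes x an affine function of the position, and the zero
  at n + 1 leaves only a scale factor, the value at the tip.\<close>

lemma arm_recursion:
  fixes x :: "nat \<Rightarrow> real"
  assumes rec: "\<And>j. 1 \<le> j \<Longrightarrow> j \<le> n \<Longrightarrow> 2 * x j - x (j - 1) - x (j + 1) = 0" and end0: "x (n + 1) = 0"
  shows "k \<le> n \<Longrightarrow> x (n - k) = (real k + 1) * x n"
proof (induction k rule: less_induct)
  case (less k)
  consider "k = 0" | "k = 1" | l where "k = l + 2"
    by (metis Suc_eq_plus1 add_2_eq_Suc' not0_implies_Suc One_nat_def)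
  then show ?case
  proof cases
    case 1
    then show ?thesis by simp
  next
    case 2
    then show ?thesis using rec[of n] end0 less.prems by simp
  next
    case 3
    have "x (n - (l + 1)) = (real (l + 1) + 1) * x n" "x (n - l) = (real l + 1) * x n"
      using less 3 by simp_all
    moreover have "2 * x (n - (l + 1)) - x (n - (l + 2)) - x (n - l) = 0"
    proof -
      have "n - (l + 1) - 1 = n - (l + 2)" "n - (l + 1) + 1 = n - l" "1 \<le> n - (l + 1)"
        using less.prems 3 by linarith+
      then show ?thesis using rec[of "n - (l + 1)"] by simp
    qed
    ultimately show ?thesis using 3 by (simp add: algebra_simps)
  qed
qed

text \<open>The tip coefficient of arm i0 determines the centre coefficient, and on any arm the
  centre coefficient is p_i + 1 times the tip coefficient. One vanishing tip therefore spreads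
  through the centre to all arms.\<close>

lemma weyl_radical_vanishes:
  assumes v: "keys v \<subseteq> bar p"
    and rad: "\<And>y. y \<in> bar p \<Longrightarrow> weyl_form (simple_vec y) v = 0"
    and i0: "i0 < length p" "1 \<le> p ! i0" "lookup v (Arm i0 (p ! i0)) = 0"
  shows "v = 0"
proof -
  have zero: "lookup v y = 0" if "y \<notin> bar p" for y
    using v that by (auto simp: in_keys_iff)
  have arm: "arm_coord v i (p ! i - k) = (real k + 1) * arm_coord v i (p ! i)"
    if "i < length p" "k \<le> p ! i" for i k
  proof (rule arm_recursion[OF _ _ that(2)])
    show "2 * arm_coord v i j - arm_coord v i (j - 1) - arm_coord v i (j + 1) = 0"
      if "1 \<le> j" "j \<le> p ! i" for j
      using weyl_form_arm[OF v that(1), of i] rad[of "Arm i j"] that \<open>i < length p\<close> by simp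
    show "arm_coord v i (p ! i + 1) = 0"
      by (simp add: arm_coord_def zero)
  qed
  have "arm_coord v i0 (p ! i0) = 0" using i0 by (simp add: arm_coord_def)
  then have "arm_coord v i0 0 = 0" using arm[OF i0(1) order_refl] by simp
  then have c: "lookup v Centre = 0" by (simp add: arm_coord_def)
  have "lookup v (Arm i j) = 0" if "i < length p" "1 \<le> j" "j \<le> p ! i" for i j
  proof -
    have "arm_coord v i 0 = (real (p ! i) + 1) * arm_coord v i (p ! i)"
      using arm[OF that(1) order_refl] by simp
    then have "arm_coord v i (p ! i) = 0" using c by (simp add: arm_coord_def)
    then have "arm_coord v i j = 0" using arm[OF that(1), of "p ! i - j"] that by simp
    then show ?thesis using that by (simp add: arm_coord_def)
  qed
  then have "lookup v y = 0" for y
    using zero[of y] c by (cases y) auto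
  then show ?thesis by (intro poly_mapping_eqI) simp
qed

subsection \<open>The form of a hyperbolic cover\<close>

abbreviation "refls F \<equiv> word_refl F (\<lambda>b. b)"

text \<open>\<open>root_system_of\<close> is phrased with a generated group of extensional maps;
  here its elements become words in total reflections, on which induction is possible.\<close>

lemma reflections_generate:
  fixes F :: "'v::real_vector \<Rightarrow> 'v \<Rightarrow> real"
  assumes F: "sym_form F" and V: "subspace V" and R: "R \<subseteq> V" "\<And>b. b \<in> R \<Longrightarrow> F b b = 2"
  shows "generate (gen_lin V) (reflection V F ` R) =
    {restrict (refls F bs) V | bs. set bs \<subseteq> R}"
proof -
  interpret sym_form F by (rule F)
  interpret group "gen_lin V" by (rule group_gen_lin[OF V])
  have refl: "reflection V F b = restrict (root_refl F b) V" if "b \<in> R" for b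
    using R(2)[OF that] by (rule reflection_eq_restrict)
  have W_V: "refls F bs v \<in> V" if "set bs \<subseteq> R" "v \<in> V" for bs v
    using that R by (intro word_refl_in_subspace[OF V]) auto
  have carr: "restrict (refls F bs) V \<in> carrier (gen_lin V)" if "set bs \<subseteq> R" for bs
    using that R(2) W_V[of bs] W_V[of "rev bs"]
    by (intro restrict_in_gen_lin[where g = "refls F (rev bs)"] linear_word_refl V
        word_refl_rev word_refl_rev') auto
  have single: "reflection V F b = restrict (refls F [b]) V" if "b \<in> R" for b
    using refl[OF that] by (auto simp: fun_eq_iff)
  have X: "reflection V F ` R \<subseteq> carrier (gen_lin V)"
    using carr[of "[_]"] single by auto
  have comp: "restrict (refls F bs) V \<otimes>\<^bsub>gen_lin V\<^esub> restrict (refls F cs) V =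
      restrict (refls F (bs @ cs)) V" if "set bs \<subseteq> R" "set cs \<subseteq> R" for bs cs
    using mult_gen_lin_restrict[OF carr[OF that(1)] carr[OF that(2)]] by (auto simp: fun_eq_iff)
  have nil: "\<one>\<^bsub>gen_lin V\<^esub> = restrict (refls F []) V"
    by (auto simp: one_gen_lin fun_eq_iff)
  have inv: "x \<otimes>\<^bsub>gen_lin V\<^esub> x = \<one>\<^bsub>gen_lin V\<^esub>" if x: "x \<in> reflection V F ` R" for x
  proof -
    obtain b where b: "b \<in> R" "x = restrict (refls F [b]) V"
      using x single by auto
    then have "x \<otimes>\<^bsub>gen_lin V\<^esub> x = restrict (refls F [b, b]) V"
      using comp[of "[b]" "[b]"] by simp
    also have "\<dots> = \<one>\<^bsub>gen_lin V\<^esub>"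
      using R(2)[OF b(1)] by (auto simp: one_gen_lin fun_eq_iff)
    finally show ?thesis .
  qed
  have words: "word_value (gen_lin V) (map (reflection V F) bs) = restrict (refls F bs) V"
    if "set bs \<subseteq> R" for bs
    using that
  proof (induction bs)
    case Nil
    show ?case unfolding list.map nil[symmetric] by (simp add: word_value_def)
  next
    case (Cons b bs)
    have "word_value (gen_lin V) (map (reflection V F) (b # bs)) =
        reflection V F b \<otimes>\<^bsub>gen_lin V\<^esub> word_value (gen_lin V) (map (reflection V F) bs)"
      by (simp add: word_value_def)
    also have "\<dots> = restrict (refls F ([b] @ bs)) V"
      using single[of b] Cons comp[of "[b]" bs] by (metis list.set_intros(1) set_subset_Cons subset_trans
        subsetD empty_subsetI insert_subset list.set(1) list.simps(15))
    finally show ?case by (simp only: append.simps)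
  qed
  have "generate (gen_lin V) (reflection V F ` R) =
      word_value (gen_lin V) ` lists (reflection V F ` R)"
    by (rule generate_involutions[OF X inv])
  also have "lists (reflection V F ` R) = map (reflection V F) ` lists R"
    by (rule lists_image)
  finally show ?thesis
    using words by (force simp: image_image lists_eq_set)
qed

lemma root_system_of_eq:
  assumes F: "sym_form F" and \<Delta>: "\<And>b. b \<in> \<Delta> \<Longrightarrow> F b b = 2"
  shows "root_system_of F \<Delta> = {refls F bs \<beta> | bs \<beta>. set bs \<subseteq> \<Delta> \<and> \<beta> \<in> \<Delta>}"
proof -
  let ?W = "\<lambda>bs. restrict (refls F bs) (span \<Delta>)"
  have gen: "generate (gen_lin (span \<Delta>)) (reflection (span \<Delta>) F ` \<Delta>) = {?W bs | bs. set bs \<subseteq> \<Delta>}"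
    by (rule reflections_generate[OF F]) (simp_all add: span_superset \<Delta>)
  have W: "?W bs \<beta> = refls F bs \<beta>" if "\<beta> \<in> \<Delta>" for bs \<beta>
    using span_base[OF that] by simp
  show ?thesis
  proof (intro subset_antisym subsetI)
    fix v assume "v \<in> root_system_of F \<Delta>"
    then obtain w \<beta> where v: "v = w \<beta>" "w \<in> {?W bs | bs. set bs \<subseteq> \<Delta>}" "\<beta> \<in> \<Delta>"
      unfolding root_system_of_def gen by blast
    then obtain bs where bs: "w = ?W bs" "set bs \<subseteq> \<Delta>" by blast
    have "v = refls F bs \<beta>" unfolding v(1) bs(1) by (rule W[OF v(3)])
    then show "v \<in> {refls F bs \<beta> | bs \<beta>. set bs \<subseteq> \<Delta> \<and> \<beta> \<in> \<Delta>}"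
      using bs(2) v(3) by blast
  next
    fix v assume "v \<in> {refls F bs \<beta> | bs \<beta>. set bs \<subseteq> \<Delta> \<and> \<beta> \<in> \<Delta>}"
    then obtain bs \<beta> where v: "v = refls F bs \<beta>" "set bs \<subseteq> \<Delta>" "\<beta> \<in> \<Delta>" by blast
    have "?W bs \<in> {?W bs | bs. set bs \<subseteq> \<Delta>}" using v(2) by blast
    moreover have "v = ?W bs \<beta>" unfolding v(1) by (rule W[OF v(3), symmetric])
    ultimately show "v \<in> root_system_of F \<Delta>"
      unfolding root_system_of_def gen using v(3) by blast
  qed
qed

lemma root_system_of_subset_span:
  assumes F: "sym_form F" and \<Delta>: "\<And>b. b \<in> \<Delta> \<Longrightarrow> F b b = 2"
  shows "root_system_of F \<Delta> \<subseteq> span \<Delta>"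
proof -
  interpret sym_form F by (rule F)
  show ?thesis
  proof
    fix v assume "v \<in> root_system_of F \<Delta>"
    then obtain bs \<beta> where "v = refls F bs \<beta>" "set bs \<subseteq> \<Delta>" "\<beta> \<in> \<Delta>"
      using root_system_of_eq[OF assms] by auto
    then show "v \<in> span \<Delta>"
      using word_refl_in_subspace[of "span \<Delta>" bs "\<lambda>b. b" \<beta>] span_base[of _ \<Delta>] by auto
  qed
qed

text \<open>Pairing with (0, 1) reads off the coordinate at k. In contrast to the form in
  \<open>is_cover_form\<close>, which is constrained only on the cover space, this one is bilinear
  on the whole ambient type.\<close>

definition cover_form :: "vertex \<Rightarrow> cover_vec \<Rightarrow> cover_vec \<Rightarrow> real" where
  "cover_form k x y = weyl_form (fst x) (fst y)
     + snd x * lookup (fst y) k + snd y * lookup (fst x) k"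

interpretation cover: sym_form "cover_form k" for k
proof unfold_locales
  show "bilinear (cover_form k)"
    unfolding bilinear_def
    by (auto intro!: linearI simp: cover_form_def weyl.form_simps lookup_add algebra_simps)
  show "cover_form k u v = cover_form k v u" for u v
    using weyl.sym[of "fst u" "fst v"] by (simp add: cover_form_def)
qed

lemma subspace_cover_space: "subspace (cover_space p)"
  unfolding cover_space_def weyl_space_def by (auto simp: subspace_def span_add span_scale span_zero zero_prod_def)

text \<open>By bilinearity only the functional u \<mapsto> F (u, 0) (0, 1) is left to find.
  Subtracting a multiple of a removes the starred coordinate; in the tubular alternative a multiple
  of \<alpha>_x + \<theta> then removes the coordinate at x. As \<theta> has no coordinate at x, the
  functional is the coordinate at x for every choice of \<theta>.\<close>

lemma cover_form_determined:
  assumes F: "is_cover_form p F" and p: "\<forall>k\<in>set p. 1 \<le> k"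
  obtains k where "k = CentreStar \<or> (\<exists>i<length p. k = Arm i (p ! i))"
    "\<And>x y. x \<in> cover_space p \<Longrightarrow> y \<in> cover_space p \<Longrightarrow> F x y = cover_form k x y"
proof -
  have sym: "F u v = F v u" and add: "F (u + v) w = F u w + F v w" and scale: "F (c *\<^sub>R u) v = c * F u v"
    if "u \<in> cover_space p" "v \<in> cover_space p" "w \<in> cover_space p" for u v w c
    using F that by (auto simp: is_cover_form_def sym_bilinear_on_def)
  have FV: "F (u, 0) (v, 0) = weyl_form u v" if "u \<in> weyl_space p" "v \<in> weyl_space p" for u v
    using F that by (auto simp: is_cover_form_def)
  have F11: "F (0, 1) (0, 1) = 0" using F by (simp add: is_cover_form_def)
  let ?e = "(0, 1) :: cover_vec"
  have V: "subspace (weyl_space p)" by (simp add: weyl_space_def)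
  have e: "?e \<in> cover_space p" using V by (auto simp: cover_space_def subspace_0)
  have in_cover: "(u, s) \<in> cover_space p \<longleftrightarrow> u \<in> weyl_space p" for u s by (simp add: cover_space_def)
  define f where "f u = F (u, 0) ?e" for u
  have f_add: "f (u + v) = f u + f v" if "u \<in> weyl_space p" "v \<in> weyl_space p" for u v
    using add[of "(u, 0)" "(v, 0)" ?e] that e by (simp add: f_def in_cover)
  have f_scale: "f (c *\<^sub>R u) = c * f u" if "u \<in> weyl_space p" for u c
    using scale[of "(u, 0)" ?e ?e c] that e by (simp add: f_def in_cover)
  have expand: "F (u, s) (v, t) = weyl_form u v + s * f v + t * f u"
    if uv: "u \<in> weyl_space p" "v \<in> weyl_space p" for u v s t
  proof -
    have split: "(w, r) = (w, 0) + r *\<^sub>R ?e" for w :: "vertex \<Rightarrow>\<^sub>0 real" and r by simp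
    have left: "F (w, r) z = F (w, 0) z + r * F ?e z"
      if "w \<in> weyl_space p" "z \<in> cover_space p" for w r z
    proof -
      have "F (w, r) z = F ((w, 0) + r *\<^sub>R ?e) z" by simp
      also have "\<dots> = F (w, 0) z + F (r *\<^sub>R ?e) z"
        using that V by (intro add) (auto simp: in_cover subspace_0)
      also have "F (r *\<^sub>R ?e) z = r * F ?e z" by (rule scale[OF e that(2) e])
      finally show ?thesis .
    qed
    have right: "F z (w, r) = F z (w, 0) + r * F z ?e"
      if "w \<in> weyl_space p" "z \<in> cover_space p" for w r z
      using left[OF that, of r] sym[of z "(w, r)" z] sym[of z "(w, 0)" z] sym[of z ?e z] that e
      by (simp add: in_cover)
    have "F ?e (v, 0) = f v" using sym[of ?e "(v, 0)" ?e] e uv by (simp add: f_def in_cover)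
    then show ?thesis
      using left[of u "(v, t)" s] right[of v "(u, 0)" t] right[of v ?e t] uv e FV F11
      by (simp add: in_cover f_def algebra_simps)
  qed
  have bar: "span (weyl_basis_bar p) \<subseteq> weyl_space p"
    unfolding weyl_space_def weyl_basis_bar_def by (rule span_mono) auto
  have a: "radical_a \<in> weyl_space p"
    unfolding radical_a_def weyl_space_def weyl_basis_def diagram_vertices_def diagram_vertices_bar_def
    by (intro span_diff span_base) auto
  have minus_a: "u - lookup u CentreStar *\<^sub>R radical_a \<in> span (weyl_basis_bar p)"
    if "u \<in> weyl_space p" for u
  proof -
    have "keys (u - lookup u CentreStar *\<^sub>R radical_a) \<subseteq> bar p"
    proof
      fix y assume y: "y \<in> keys (u - lookup u CentreStar *\<^sub>R radical_a)"
      then have "y \<noteq> CentreStar"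
        by (auto simp: in_keys_iff lookup_minus radical_a_def lookup_simple_vec)
      moreover from this y have "y \<in> keys u \<or> y = Centre"
        by (auto simp: in_keys_iff lookup_minus radical_a_def lookup_simple_vec split: if_splits)
      ultimately show "y \<in> bar p"
        using that by (auto simp: weyl_space_iff diagram_vertices_def)
    qed
    then show ?thesis by (simp add: weyl_space_bar_iff)
  qed
  have split_a: "f u = f (u - lookup u CentreStar *\<^sub>R radical_a)
      + lookup u CentreStar * f radical_a" if "u \<in> weyl_space p" for u
    using f_add[of "u - lookup u CentreStar *\<^sub>R radical_a" "lookup u CentreStar *\<^sub>R radical_a"]
      f_scale[OF a] minus_a[OF that] bar V a by (auto simp: subspace_scale)
  have "(\<forall>v\<in>span (weyl_basis_bar p). F (v, 0) (0, 1) = 0) \<and> F (radical_a, 0) (0, 1) = 1 \<or>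
      (\<exists>x \<theta>. is_affine_node p x \<and>
           is_highest_root weyl_form (weyl_basis_bar p - {simple_vec x}) \<theta> \<and>
           (\<forall>v\<in>span (weyl_basis_bar p - {simple_vec x}). F (v, 0) (0, 1) = 0) \<and>
           F (radical_a, 0) (0, 1) = 0 \<and>
           F (simple_vec x + \<theta>, 0) (0, 1) = 1)"
    using F unfolding is_cover_form_def by blast
  then have "\<exists>k. (k = CentreStar \<or> (\<exists>i<length p. k = Arm i (p ! i))) \<and>
      (\<forall>u\<in>weyl_space p. f u = lookup u k)"
  proof (elim conjE disjE)
    assume 0: "\<forall>v\<in>span (weyl_basis_bar p). F (v, 0) (0, 1) = 0" "F (radical_a, 0) (0, 1) = 1"
    have "f u = lookup u CentreStar" if "u \<in> weyl_space p" for u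
      using split_a[OF that] 0 minus_a[OF that] by (simp add: f_def)
    then show ?thesis by blast
  next
    assume "\<exists>x \<theta>. is_affine_node p x \<and>
           is_highest_root weyl_form (weyl_basis_bar p - {simple_vec x}) \<theta> \<and>
           (\<forall>v\<in>span (weyl_basis_bar p - {simple_vec x}). F (v, 0) (0, 1) = 0) \<and>
           F (radical_a, 0) (0, 1) = 0 \<and>
           F (simple_vec x + \<theta>, 0) (0, 1) = 1"
    then obtain x \<theta> where x: "is_affine_node p x"
      and \<theta>: "is_highest_root weyl_form (weyl_basis_bar p - {simple_vec x}) \<theta>"
      and f0: "\<And>v. v \<in> span (weyl_basis_bar p - {simple_vec x}) \<Longrightarrow> f v = 0"
      and fa: "f radical_a = 0" and fb: "f (simple_vec x + \<theta>) = 1"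
      by (auto simp: f_def)
    obtain i where i: "i < length p" "x = Arm i (p ! i)" using x by (auto simp: is_affine_node_def)
    have x_bar: "x \<in> bar p" using i p by simp
    have \<Delta>: "weyl_basis_bar p - {simple_vec x} = simple_vec ` (bar p - {x})"
      by (auto simp: weyl_basis_bar_eq)
    have "weyl_form b b = 2" if "b \<in> weyl_basis_bar p - {simple_vec x}" for b
      using that by (auto simp: \<Delta> weyl_form_simple)
    then have "\<theta> \<in> span (weyl_basis_bar p - {simple_vec x})"
      using \<theta> root_system_of_subset_span[OF weyl.sym_form_axioms, of "weyl_basis_bar p - {simple_vec x}"]
      unfolding is_highest_root_def by blast
    then have \<theta>_keys: "keys \<theta> \<subseteq> bar p - {x}"
      by (simp only: \<Delta> in_span_simple_vec)
    have b: "simple_vec x + \<theta> \<in> weyl_space p"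
      using \<theta>_keys x_bar bar
      by (intro subspace_add[OF V]) (auto simp: weyl_space_iff diagram_vertices_def in_keys_iff lookup_simple_vec split: if_splits)
    have "f u = lookup u x" if u: "u \<in> weyl_space p" for u
    proof -
      let ?u = "u - lookup u CentreStar *\<^sub>R radical_a"
      have lx: "lookup ?u x = lookup u x"
        using i by (simp add: lookup_minus radical_a_def lookup_simple_vec)
      \<comment> \<open>The vector \<alpha>_x + \<theta> has coefficient 1 at x, so ?w lies in the
        span of the finite simple system, where the functional vanishes.\<close>
      let ?w = "?u - lookup u x *\<^sub>R (simple_vec x + \<theta>)"
      have "lookup \<theta> x = 0" using \<theta>_keys by (auto simp: in_keys_iff)
      then have "lookup ?w x = 0"
        using lx by (simp add: lookup_minus lookup_add lookup_simple_vec)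
      moreover have "simple_vec x \<in> span (weyl_basis_bar p)" "\<theta> \<in> span (weyl_basis_bar p)"
        using \<theta>_keys x_bar by (auto simp: weyl_space_bar_iff in_keys_iff lookup_simple_vec split: if_splits)
      then have "?w \<in> span (weyl_basis_bar p)"
        by (intro span_diff[OF minus_a[OF u] span_scale[OF span_add]])
      ultimately have "keys ?w \<subseteq> bar p - {x}"
        by (auto simp: weyl_space_bar_iff in_keys_iff)
      then have "f ?w = 0" by (intro f0) (simp only: \<Delta> in_span_simple_vec)
      moreover have "f ?u = f ?w + lookup u x * f (simple_vec x + \<theta>)"
        using f_add[of ?w "lookup u x *\<^sub>R (simple_vec x + \<theta>)"] f_scale[OF b]
          \<open>?w \<in> span (weyl_basis_bar p)\<close> bar V b by (auto simp: subspace_scale)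
      ultimately show ?thesis using split_a[OF u] fa fb by simp
    qed
    then show ?thesis using i by blast
  qed
  then obtain k where k: "k = CentreStar \<or> (\<exists>i<length p. k = Arm i (p ! i))"
    "\<And>u. u \<in> weyl_space p \<Longrightarrow> f u = lookup u k" by blast
  have "F x y = cover_form k x y" if "x \<in> cover_space p" "y \<in> cover_space p" for x y
    using that expand[of "fst x" "fst y" "snd x" "snd y"] k(2)
    by (auto simp: cover_space_def cover_form_def)
  then show ?thesis using that k(1) by blast
qed

subsection \<open>An orthogonal basis and the trichotomy\<close>

text \<open>Gram-Schmidt from the tips towards the centre. The vector at an arm vertex has
  coefficient 1 there and decreases linearly to 0 just past the tip, hence pairs to 0 with all later
  simple roots of the arm; the vector at the centre decreases in this way along all arms at once.
  The values at the starred vertex are fillers, as \<open>orth_vec\<close> sums over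
  \<open>bar p\<close>.\<close>

definition orth_coeff :: "nat list \<Rightarrow> vertex \<Rightarrow> vertex \<Rightarrow> real" where
  "orth_coeff p x y = (case x of
     Centre \<Rightarrow> (case y of Arm i k \<Rightarrow> (real (p ! i) + 1 - real k) / (real (p ! i) + 1) | _ \<Rightarrow> 1)
   | Arm i j \<Rightarrow> (case y of Arm i' k \<Rightarrow>
       if i' = i \<and> j \<le> k then (real (p ! i) + 1 - real k) / (real (p ! i) + 1 - real j) else 0 | _ \<Rightarrow> 0)
   | CentreStar \<Rightarrow> 0)"

definition orth_vec :: "nat list \<Rightarrow> vertex \<Rightarrow> (vertex \<Rightarrow>\<^sub>0 real)" where
  "orth_vec p x = (\<Sum>y\<in>bar p. orth_coeff p x y *\<^sub>R simple_vec y)"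

text \<open>The norm of the orthogonal basis vector at the centre: 2 minus the coefficients of that
  vector next to the centre. With m_i = p_i + 1 it is 2 - \<Sum> (1 - 1/m_i), the orbifold Euler
  characteristic of a sphere with cone points of orders m_i.\<close>

definition curvature :: "nat list \<Rightarrow> real" where
  "curvature p = 2 - (\<Sum>i<length p. real (p ! i) / (real (p ! i) + 1))"

lemma lookup_orth_vec:
  "lookup (orth_vec p x) y = (if y \<in> bar p then orth_coeff p x y else 0)"
  by (simp add: orth_vec_def lookup_sum_simple_vec finite_bar)

lemma keys_orth_vec: "keys (orth_vec p x) \<subseteq> bar p"
  unfolding orth_vec_def by (rule keys_sum_simple_vec)

lemma arm_coord_orth_vec_Centre:
  assumes "i < length p" "k \<le> p ! i + 1"
  shows "arm_coord (orth_vec p Centre) i k = (real (p ! i) + 1 - real k) / (real (p ! i) + 1)"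
  using assms by (cases "k = p ! i + 1") (auto simp: arm_coord_def lookup_orth_vec orth_coeff_def)

lemma arm_coord_orth_vec_Arm:
  assumes "i < length p" "1 \<le> j" "j \<le> p ! i" "k \<le> p ! i + 1" "i' < length p"
  shows "arm_coord (orth_vec p (Arm i j)) i' k =
    (if i' = i \<and> j \<le> k then (real (p ! i) + 1 - real k) / (real (p ! i) + 1 - real j) else 0)"
  using assms by (cases "k = p ! i + 1") (auto simp: arm_coord_def lookup_orth_vec orth_coeff_def)

lemma weyl_form_orth_Centre:
  assumes "i < length p" "1 \<le> k" "k \<le> p ! i"
  shows "weyl_form (simple_vec (Arm i k)) (orth_vec p Centre) = 0"
proof -
  have "2 / (real (p ! i) + 1) + 2 * real (p ! i) / (real (p ! i) + 1) = 2"
    by (simp add: divide_simps add_nonneg_eq_0_iff) (simp add: algebra_simps)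
  then show ?thesis
    using assms weyl_form_arm[where v = "orth_vec p Centre" and p = p and i = i and j = k, OF keys_orth_vec]
    by (simp add: arm_coord_orth_vec_Centre of_nat_diff diff_divide_distrib add_divide_distrib)
qed

lemma weyl_form_orth_Centre_Centre:
  assumes "\<forall>k\<in>set p. 1 \<le> k"
  shows "weyl_form (simple_vec Centre) (orth_vec p Centre) = curvature p"
proof -
  have "lookup (orth_vec p Centre) (Arm i 1) = real (p ! i) / (real (p ! i) + 1)"
    if "i < length p" for i
    using that assms by (simp add: lookup_orth_vec orth_coeff_def)
  then show ?thesis
    using weyl_form_Centre[where v = "orth_vec p Centre" and p = p, OF keys_orth_vec]
    by (simp add: curvature_def lookup_orth_vec orth_coeff_def)
qed

lemma weyl_form_orth_Arm:
  assumes ij: "i < length p" "1 \<le> j" "j \<le> p ! i" and k: "i' < length p" "1 \<le> k" "k \<le> p ! i'"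
    and out: "i' \<noteq> i \<or> j < k"
  shows "weyl_form (simple_vec (Arm i' k)) (orth_vec p (Arm i j)) = 0"
proof (cases "i' = i")
  case True
  then have "j < k" using out by simp
  then have *: "j \<le> k" "j \<le> k - 1" "j \<le> k + 1" by simp_all
  have "real j < real (p ! i) + 1" using ij by simp
  then show ?thesis
    using assms True * weyl_form_arm[where v = "orth_vec p (Arm i j)" and p = p and i = i' and j = k, OF keys_orth_vec]
    by (simp add: arm_coord_orth_vec_Arm of_nat_diff diff_divide_distrib add_divide_distrib)
next
  case False
  have "arm_coord (orth_vec p (Arm i j)) i' l = 0" for l
    using False by (auto simp: arm_coord_def lookup_orth_vec orth_coeff_def)
  then show ?thesis
    using weyl_form_arm[where v = "orth_vec p (Arm i j)" and p = p and i = i' and j = k, OF keys_orth_vec] k by simp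
qed

lemma weyl_form_orth_Arm_Arm:
  assumes ij: "i < length p" "1 \<le> j" "j \<le> p ! i"
  shows "weyl_form (simple_vec (Arm i j)) (orth_vec p (Arm i j)) > 0"
proof -
  have pos: "real (p ! i) + 1 - real j > 0" using ij by simp
  have "weyl_form (simple_vec (Arm i j)) (orth_vec p (Arm i j)) =
      2 - (real (p ! i) - real j) / (real (p ! i) + 1 - real j)"
    using ij pos weyl_form_arm[where v = "orth_vec p (Arm i j)" and p = p and i = i and j = j, OF keys_orth_vec]
    by (simp add: arm_coord_orth_vec_Arm)
  moreover have "(real (p ! i) - real j) / (real (p ! i) + 1 - real j) < 1"
    using pos by simp
  ultimately show ?thesis by simp
qed

lemma weyl_form_orth_vec_left:
  "weyl_form (orth_vec p x) v = (\<Sum>y\<in>bar p. orth_coeff p x y * weyl_form (simple_vec y) v)"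
  unfolding orth_vec_def by (rule weyl.form_sum_left)

text \<open>The vector of an arm vertex is a combination of simple roots from that vertex outwards,
  and each of these is orthogonal to the vectors of the centre, of other arms and of vertices
  further in. So the vector lying further out is the one to expand.\<close>

lemma orth_vec_orthogonal:
  assumes "x \<in> bar p" "y \<in> bar p" "x \<noteq> y"
  shows "weyl_form (orth_vec p x) (orth_vec p y) = 0"
proof -
  have arm_centre: "weyl_form (orth_vec p (Arm i j)) (orth_vec p Centre) = 0"
    if "Arm i j \<in> bar p" for i j
    unfolding weyl_form_orth_vec_left
  proof (rule sum.neutral, rule ballI)
    fix z assume "z \<in> bar p"
    then show "orth_coeff p (Arm i j) z * weyl_form (simple_vec z) (orth_vec p Centre) = 0"
      by (cases z) (auto simp: orth_coeff_def weyl_form_orth_Centre)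
  qed
  have arm_arm: "weyl_form (orth_vec p (Arm i j)) (orth_vec p (Arm i' j')) = 0"
    if "Arm i j \<in> bar p" "Arm i' j' \<in> bar p" "i \<noteq> i' \<or> j' < j" for i j i' j'
    unfolding weyl_form_orth_vec_left
  proof (rule sum.neutral, rule ballI)
    fix z assume "z \<in> bar p"
    then show "orth_coeff p (Arm i j) z * weyl_form (simple_vec z) (orth_vec p (Arm i' j')) = 0"
      using that by (cases z) (auto simp: orth_coeff_def weyl_form_orth_Arm)
  qed
  show ?thesis
  proof (cases x)
    case x: Centre
    then show ?thesis
      using arm_centre assms weyl.sym[of "orth_vec p x" "orth_vec p y"] by (cases y) auto
  next
    case x: (Arm i j)
    show ?thesis
    proof (cases y)
      case Centre
      then show ?thesis using arm_centre x assms by simp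
    next
      case (Arm i' j')
      then show ?thesis
        using arm_arm[of i j i' j'] arm_arm[of i' j' i j] x assms
          weyl.sym[of "orth_vec p x" "orth_vec p y"] by (cases "i = i'"; cases j j' rule: linorder_cases) auto
    qed (use assms in auto)
  qed (use assms in auto)
qed

definition orth_norm :: "nat list \<Rightarrow> vertex \<Rightarrow> real" where
  "orth_norm p x = weyl_form (orth_vec p x) (orth_vec p x)"

lemma orth_norm_Centre:
  assumes "\<forall>k\<in>set p. 1 \<le> k"
  shows "orth_norm p Centre = curvature p"
proof -
  have "orth_norm p Centre = (\<Sum>y\<in>{Centre}. orth_coeff p Centre y * weyl_form (simple_vec y) (orth_vec p Centre))"
    unfolding orth_norm_def weyl_form_orth_vec_left
  proof (rule sum.mono_neutral_right)
    show "\<forall>y\<in>bar p - {Centre}.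
        orth_coeff p Centre y * weyl_form (simple_vec y) (orth_vec p Centre) = 0"
    proof
      fix y assume "y \<in> bar p - {Centre}"
      then show "orth_coeff p Centre y * weyl_form (simple_vec y) (orth_vec p Centre) = 0"
        by (cases y) (auto simp: weyl_form_orth_Centre)
    qed
  qed (auto simp: finite_bar)
  also have "\<dots> = curvature p"
    using weyl_form_orth_Centre_Centre[OF assms] by (simp add: orth_coeff_def)
  finally show ?thesis .
qed

lemma orth_norm_Arm:
  assumes "Arm i j \<in> bar p"
  shows "orth_norm p (Arm i j) > 0"
proof -
  have "orth_norm p (Arm i j) = (\<Sum>y\<in>{Arm i j}. orth_coeff p (Arm i j) y * weyl_form (simple_vec y) (orth_vec p (Arm i j)))"
    unfolding orth_norm_def weyl_form_orth_vec_left
  proof (rule sum.mono_neutral_right)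
    show "\<forall>y\<in>bar p - {Arm i j}.
        orth_coeff p (Arm i j) y * weyl_form (simple_vec y) (orth_vec p (Arm i j)) = 0"
    proof
      fix y assume y: "y \<in> bar p - {Arm i j}"
      then show "orth_coeff p (Arm i j) y * weyl_form (simple_vec y) (orth_vec p (Arm i j)) = 0"
        using assms by (cases y) (auto simp: orth_coeff_def weyl_form_orth_Arm)
    qed
  qed (use assms in \<open>auto simp: finite_bar\<close>)
  also have "\<dots> = weyl_form (simple_vec (Arm i j)) (orth_vec p (Arm i j))"
  proof -
    have "real (p ! i) + 1 - real j > 0" using assms by simp
    then show ?thesis by (simp add: orth_coeff_def)
  qed
  finally show ?thesis using weyl_form_orth_Arm_Arm assms by simp
qed

lemma orth_vec_Arm_split:
  assumes "Arm i j \<in> bar p"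
  shows "orth_vec p (Arm i j) - simple_vec (Arm i j) \<in> span (simple_vec ` Arm i ` {j<..p ! i})"
  unfolding in_span_simple_vec
proof
  fix y assume y: "y \<in> keys (orth_vec p (Arm i j) - simple_vec (Arm i j))"
  have "real (p ! i) + 1 - real j \<noteq> 0" using assms by simp
  then show "y \<in> Arm i ` {j<..p ! i}"
    using y assms by (cases y) (auto simp: in_keys_iff lookup_minus lookup_orth_vec lookup_simple_vec orth_coeff_def
      split: if_splits)
qed

text \<open>The change of basis is unitriangular if the vertices are ordered from the tips inwards,
  with the centre last.\<close>

lemma simple_vec_in_span_orth:
  assumes "x \<in> bar p"
  shows "simple_vec x \<in> span (orth_vec p ` bar p)"
proof -
  let ?O = "span (orth_vec p ` bar p)"
  have arm: "simple_vec (Arm i j) \<in> ?O" if "Arm i j \<in> bar p" for i j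
    using that
  proof (induction "p ! i - j" arbitrary: j rule: less_induct)
    case less
    have "simple_vec ` Arm i ` {j<..p ! i} \<subseteq> ?O"
      using less by auto
    then have "span (simple_vec ` Arm i ` {j<..p ! i}) \<subseteq> ?O"
      by (intro span_minimal subspace_span)
    then have "orth_vec p (Arm i j) - simple_vec (Arm i j) \<in> ?O"
      using orth_vec_Arm_split[OF less.prems] by blast
    from span_diff[OF span_base[OF imageI[OF less.prems]] this] show ?case by simp
  qed
  have "simple_vec Centre \<in> ?O"
  proof -
    let ?A = "bar p - {Centre}"
    have "keys (orth_vec p Centre - simple_vec Centre) \<subseteq> ?A"
      by (auto simp: in_keys_iff lookup_minus lookup_orth_vec lookup_simple_vec orth_coeff_def split: if_splits)
    then have "orth_vec p Centre - simple_vec Centre \<in> span (simple_vec ` ?A)"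
      by (simp add: in_span_simple_vec)
    moreover have "simple_vec ` ?A \<subseteq> ?O"
    proof (rule image_subsetI)
      fix y assume "y \<in> ?A"
      then show "simple_vec y \<in> ?O" using arm by (cases y) auto
    qed
    then have "span (simple_vec ` ?A) \<subseteq> ?O" by (intro span_minimal subspace_span)
    ultimately have 1: "orth_vec p Centre - simple_vec Centre \<in> ?O" by blast
    have "orth_vec p Centre \<in> ?O" by (intro span_base imageI) simp
    from span_diff[OF this 1] show ?thesis by simp
  qed
  then show ?thesis using arm assms by (cases x) auto
qed

definition full_basis :: "nat list \<Rightarrow> vertex \<Rightarrow> (vertex \<Rightarrow>\<^sub>0 real)" where
  "full_basis p x = (if x = CentreStar then radical_a else orth_vec p x)"

lemma radical_a_weyl_space: "radical_a \<in> weyl_space p"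
  unfolding radical_a_def weyl_space_def weyl_basis_def diagram_vertices_def diagram_vertices_bar_def
  by (intro span_diff span_base) auto

lemma span_full_basis: "span (full_basis p ` diagram_vertices p) = weyl_space p"
proof
  have "full_basis p x \<in> weyl_space p" for x
    using keys_orth_vec[of p x] radical_a_weyl_space
    by (auto simp: full_basis_def weyl_space_iff diagram_vertices_def)
  then show "span (full_basis p ` diagram_vertices p) \<subseteq> weyl_space p"
    by (intro span_minimal) (auto simp: weyl_space_def)
  let ?S = "span (full_basis p ` diagram_vertices p)"
  have "orth_vec p ` bar p \<subseteq> full_basis p ` diagram_vertices p"
  proof (rule image_subsetI)
    fix x assume x: "x \<in> bar p"
    then have "x \<noteq> CentreStar" by auto
    then show "orth_vec p x \<in> full_basis p ` diagram_vertices p"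
      using x by (intro image_eqI[of _ _ x]) (auto simp: full_basis_def diagram_vertices_def)
  qed
  then have bar: "simple_vec x \<in> ?S" if "x \<in> bar p" for x
    using simple_vec_in_span_orth[OF that] span_mono by blast
  have "radical_a \<in> ?S"
    by (intro span_base image_eqI[of _ _ CentreStar]) (auto simp: full_basis_def diagram_vertices_def)
  then have "radical_a + simple_vec Centre \<in> ?S" by (intro span_add bar) auto
  then have "simple_vec CentreStar \<in> ?S" by (simp add: radical_a_def)
  then have "weyl_basis p \<subseteq> ?S"
    using bar by (auto simp: weyl_basis_def diagram_vertices_def)
  then show "weyl_space p \<subseteq> ?S"
    unfolding weyl_space_def by (intro span_minimal subspace_span)
qed

lemma spanning_card_le_basis:
  fixes B D :: "'v::real_vector set"
  assumes B: "independent B" "finite D" "B \<subseteq> span D" and card: "card D \<le> card B"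
  shows "independent D \<and> card D = card B"
proof -
  obtain D' where D': "D' \<subseteq> D" "independent D'" "D \<subseteq> span D'"
    using maximal_independent_subset[of D] by blast
  then have "B \<subseteq> span D'" using B(3) span_minimal[OF D'(3) subspace_span] by blast
  moreover have fin: "finite D'" using D'(1) B(2) by (rule finite_subset)
  ultimately have "card B \<le> card D'" using independent_span_bound[of D' B] B(1) by blast
  moreover have "card D' \<le> card D" using D'(1) B(2) by (rule card_mono[rotated])
  ultimately have "D' = D" "card D = card B" using card card_subset_eq[OF B(2) D'(1)] by simp_all
  then show ?thesis using D' by simp
qed

text \<open>Orthogonality alone cannot give independence, as a is isotropic and the centre vector
  may be. The argument counts instead: the family spans and is indexed by as many vertices as the
  space has dimensions.\<close>

lemma full_basis_inj_independent:
  "inj_on (full_basis p) (diagram_vertices p)" "independent (full_basis p ` diagram_vertices p)"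
proof -
  let ?D = "full_basis p ` diagram_vertices p"
  have cardB: "card (weyl_basis p) = card (diagram_vertices p)"
    unfolding weyl_basis_def by (rule card_image) (simp add: inj_on_def)
  have "weyl_basis p \<subseteq> span ?D"
    unfolding span_full_basis weyl_space_def by (rule span_superset)
  moreover have "card ?D \<le> card (weyl_basis p)"
    unfolding cardB by (rule card_image_le) (rule finite_diagram_vertices)
  ultimately have *: "independent ?D \<and> card ?D = card (weyl_basis p)"
    using independent_simple_vec finite_diagram_vertices
    by (intro spanning_card_le_basis) (auto simp: weyl_basis_def)
  then show "independent ?D" by blast
  show "inj_on (full_basis p) (diagram_vertices p)"
    using * cardB finite_diagram_vertices by (intro eq_card_imp_inj_on) auto
qed

text \<open>Read off from \<open>full_basis\<close>; the summand 1 in the last entry is the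
  contribution of a.\<close>

lemma has_signature_weyl:
  assumes p: "\<forall>k\<in>set p. 1 \<le> k"
  shows "has_signature (weyl_space p) weyl_form
    (card {x \<in> bar p. orth_norm p x > 0},
     card {x \<in> bar p. orth_norm p x < 0},
     card {x \<in> bar p. orth_norm p x = 0} + 1)"
proof -
  let ?D = "full_basis p ` diagram_vertices p"
  have norm: "weyl_form (full_basis p x) (full_basis p x) = (if x = CentreStar then 0 else orth_norm p x)" for x
    by (simp add: full_basis_def orth_norm_def weyl_form_radical_a)
  have orth: "weyl_form u v = 0" if "u \<in> ?D" "v \<in> ?D" "u \<noteq> v" for u v
  proof -
    obtain x y where xy0: "u = full_basis p x" "v = full_basis p y" "x \<in> diagram_vertices p" "y \<in> diagram_vertices p"
      using \<open>u \<in> ?D\<close> \<open>v \<in> ?D\<close> by blast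
    have "x \<noteq> y" using \<open>u \<noteq> v\<close> xy0 by auto
    note xy = xy0 this
    show ?thesis
    proof (cases "x = CentreStar \<or> y = CentreStar")
      case True
      then show ?thesis
        using xy weyl_form_radical_a weyl.sym[of u v] by (auto simp: full_basis_def)
    next
      case False
      then show ?thesis
        using xy orth_vec_orthogonal[of x p y] by (auto simp: full_basis_def diagram_vertices_def)
    qed
  qed
  have card: "card {u \<in> ?D. P (weyl_form u u)} =
      card {x \<in> bar p. P (orth_norm p x)} + (if P 0 then 1 else 0)" for P
  proof -
    have "{u \<in> ?D. P (weyl_form u u)} =
        full_basis p ` {x \<in> diagram_vertices p. P (if x = CentreStar then 0 else orth_norm p x)}"
      using norm by auto
    then have "card {u \<in> ?D. P (weyl_form u u)} =
        card {x \<in> diagram_vertices p. P (if x = CentreStar then 0 else orth_norm p x)}"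
      using card_image[OF inj_on_subset[OF full_basis_inj_independent(1)]] by simp
    also have "{x \<in> diagram_vertices p. P (if x = CentreStar then 0 else orth_norm p x)} =
        {x \<in> bar p. P (orth_norm p x)} \<union> (if P 0 then {CentreStar} else {})"
      by (auto simp: diagram_vertices_def)
    also have "card \<dots> = card {x \<in> bar p. P (orth_norm p x)} + (if P 0 then 1 else 0)"
      using finite_bar[of p] by auto
    finally show ?thesis .
  qed
  show ?thesis
    unfolding has_signature_def prod.case
  proof (intro exI[of _ ?D] conjI ballI impI)
    show "finite ?D" using finite_diagram_vertices by simp
    show "independent ?D" by (rule full_basis_inj_independent)
    show "span ?D = weyl_space p" by (rule span_full_basis)
    show "weyl_form u v = 0" if "u \<in> ?D" "v \<in> ?D" "u \<noteq> v" for u v using orth that by blast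
  qed (simp_all add: card[of "\<lambda>r. r > 0"] card[of "\<lambda>r. r < 0"] card[of "\<lambda>r. r = 0"])
qed

text \<open>The arm vectors always have positive norm and a has norm 0, so the sign of the remaining
  norm, that of the centre vector, decides the type.\<close>

lemma weyl_type_trichotomy:
  assumes p: "\<forall>k\<in>set p. 1 \<le> k"
  shows "curvature p > 0 \<Longrightarrow> domestic_type p"
    and "curvature p = 0 \<Longrightarrow> tubular_type p"
    and "curvature p < 0 \<Longrightarrow> wild_type p"
proof -
  let ?A = "bar p - {Centre}"
  have arm: "orth_norm p x > 0" if "x \<in> ?A" for x
    using that orth_norm_Arm by (cases x) auto
  have "card (weyl_basis p) = card (diagram_vertices p)"
    unfolding weyl_basis_def by (rule card_image) (simp add: inj_on_def)
  then have B: "card (weyl_basis p) = card ?A + 2"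
    using finite_bar[of p] card_Suc_Diff1[of "bar p" Centre]
    by (simp add: diagram_vertices_def)
  have set: "{x \<in> bar p. P (orth_norm p x)} =
      {x \<in> ?A. P (orth_norm p x)} \<union> (if P (curvature p) then {Centre} else {})" for P
    using orth_norm_Centre[OF p] by auto
  have A: "{x \<in> ?A. orth_norm p x > 0} = ?A" "{x \<in> ?A. orth_norm p x < 0} = {}" "{x \<in> ?A. orth_norm p x = 0} = {}"
    using arm by (auto, force+)
  have *: "card {x \<in> bar p. orth_norm p x > 0} = card ?A + (if curvature p > 0 then 1 else 0)"
    "card {x \<in> bar p. orth_norm p x < 0} = (if curvature p < 0 then 1 else 0)"
    "card {x \<in> bar p. orth_norm p x = 0} = (if curvature p = 0 then 1 else 0)"
    using finite_bar[of p] card_Suc_Diff1[of "bar p" Centre]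
      insert_absorb[OF diagram_vertices_bar_simps(1), of p]
    unfolding set[of "\<lambda>r. r > 0"] set[of "\<lambda>r. r < 0"] set[of "\<lambda>r. r = 0"] A by auto
  note sig = has_signature_weyl[OF p, unfolded *]
  show "curvature p > 0 \<Longrightarrow> domestic_type p" "curvature p = 0 \<Longrightarrow> tubular_type p"
    "curvature p < 0 \<Longrightarrow> wild_type p"
    using sig by (simp_all add: domestic_type_def tubular_type_def wild_type_def B numeral_2_eq_2)
qed

subsection \<open>Tubular diagrams\<close>

text \<open>The equation is 1/a + 1/b + 1/c = 1 without denominators. For a \<le> b \<le> c each
  term on the left is at most b c, so a \<le> 3, and the solutions are (2,3,6), (2,4,4) and
  (3,3,3).\<close>

lemma three_unit_fractions:
  fixes a b c :: nat
  assumes "2 \<le> a" "2 \<le> b" "a \<le> c" "b \<le> c" and eq: "b * c + a * c + a * b = a * b * c"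
  shows "a dvd c \<and> b dvd c"
proof -
  have *: "a dvd c \<and> b dvd c"
    if "2 \<le> a" "a \<le> b" "b \<le> c" and eq: "b * c + a * c + a * b = a * b * c" for a b c :: nat
  proof -
    have "c > 0" "b > 0" using that by simp_all
    have "a * c \<le> b * c" "a * b \<le> c * b" using that by (intro mult_mono; simp)+
    moreover have "a * (b * c) = b * c + a * c + a * b" using eq by (simp add: mult.assoc)
    moreover have "c * b = b * c" by (rule mult.commute)
    ultimately have "a * (b * c) \<le> 3 * (b * c)" by linarith
    then have "a \<le> 3" using \<open>c > 0\<close> \<open>b > 0\<close> by simp
    then have "a = 2 \<or> a = 3" using that(1) by linarith
    then consider "a = 2" | "a = 3" by blast
    then show ?thesis
    proof cases
      case 1
      then have e: "b * c = 2 * c + 2 * b" using eq by simp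
      then have "b * c \<le> 4 * c" using that by simp
      then have "b \<le> 4" using \<open>c > 0\<close> by simp
      then have "b = 2 \<or> b = 3 \<or> b = 4" using that(1,2) by linarith
      then consider "b = 2" | "b = 3" | "b = 4" by blast
      then show ?thesis
      proof cases
        case 2
        then have "c = 6" using e by simp
        then show ?thesis using 1 2 by simp
      next
        case 3
        then have "c = 4" using e by simp
        then show ?thesis using 1 3 by simp
      qed (use e \<open>b > 0\<close> in simp)
    next
      case 2
      then have e: "2 * (b * c) = 3 * c + 3 * b" using eq by simp
      then have "2 * (b * c) \<le> 6 * c" using that by simp
      then have "b \<le> 3" using \<open>c > 0\<close> by simp
      then have "b = 3" using that 2 by simp
      then show ?thesis using e 2 by simp
    qed
  qed
  show ?thesis
  proof (cases "a \<le> b")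
    case True
    then show ?thesis using *[of a b c] assms by simp
  next
    case False
    then show ?thesis using *[of b a c] assms by (simp add: ac_simps)
  qed
qed

text \<open>Every summand p_i / (p_i + 1) lies between 1/2 and 1, so the sum 2 requires three or
  four arms. Four arms must all have length 1; three arms give the unit fraction equation for p_i +
  1. These are the affine diagrams D4, E6, E7, E8. The divisibility is what makes a multiple of the
  centre vector integral.\<close>

lemma zero_curvature_dvd:
  assumes p: "\<forall>k\<in>set p. 1 \<le> k" and zero: "curvature p = 0" and k: "k \<in> set p"
  shows "k + 1 dvd Max (set p) + 1"
proof -
  let ?t = "\<lambda>i. real (p ! i) / (real (p ! i) + 1)"
  have sum: "(\<Sum>i<length p. ?t i) = 2" using zero by (simp add: curvature_def)
  have t: "1 / 2 \<le> ?t i" "?t i < 1" if "i < length p" for i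
  proof -
    have "1 \<le> p ! i" using p that by simp
    then show "1 / 2 \<le> ?t i" "?t i < 1" by (simp_all add: field_simps)
  qed
  have "(\<Sum>i<length p. 1 / 2) \<le> (\<Sum>i<length p. ?t i)" using t by (intro sum_mono) auto
  then have le: "length p \<le> 4" using sum by simp
  have "(\<Sum>i<length p. ?t i) < (\<Sum>i<length p. 1)"
    using t length_pos_if_in_set[OF k] by (intro sum_strict_mono) auto
  then have "length p > 2" using sum by simp
  then consider "length p = 3" | "length p = 4" using le by linarith
  then show ?thesis
  proof cases
    case 1
    then obtain x y z where xyz: "p = [x, y, z]"
      by (auto simp: length_Suc_conv numeral_eq_Suc)
    let ?a = "x + 1" and ?b = "y + 1" and ?c = "z + 1"
    have ge: "2 \<le> ?a" "2 \<le> ?b" "2 \<le> ?c" using p xyz by auto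
    have "real x / (real x + 1) + real y / (real y + 1) + real z / (real z + 1) = 2"
      using sum xyz by (simp add: lessThan_Suc numeral_eq_Suc algebra_simps)
    then have "real (?b * ?c + ?a * ?c + ?a * ?b) = real (?a * ?b * ?c)"
      by (simp add: divide_simps add_pos_nonneg add_nonneg_eq_0_iff split: if_splits) (simp add: algebra_simps)
    then have eq: "?b * ?c + ?a * ?c + ?a * ?b = ?a * ?b * ?c" by (simp only: of_nat_eq_iff)
    have max: "Max (set p) = max x (max y z)" using xyz by simp
    consider "x \<le> z" "y \<le> z" | "x \<le> y" "z \<le> y" | "y \<le> x" "z \<le> x" by linarith
    then show ?thesis
    proof cases
      case 1
      then have "Max (set p) = z" using max by simp
      then show ?thesis using three_unit_fractions[of ?a ?b ?c] 1 ge eq k xyz by auto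
    next
      case 2
      then have "Max (set p) = y" using max by simp
      moreover have "?c * ?b + ?a * ?b + ?a * ?c = ?a * ?c * ?b" using eq by (simp add: algebra_simps)
      ultimately show ?thesis using three_unit_fractions[of ?a ?c ?b] 2 ge k xyz by auto
    next
      case 3
      then have "Max (set p) = x" using max by simp
      moreover have "?c * ?a + ?b * ?a + ?b * ?c = ?b * ?c * ?a" using eq by (simp add: algebra_simps)
      ultimately show ?thesis using three_unit_fractions[of ?b ?c ?a] 3 ge k xyz by auto
    qed
  next
    case 2
    have "(\<Sum>i<length p. ?t i - 1 / 2) = 0" using sum 2 by (simp add: sum_subtractf)
    then have eq0: "?t i - 1 / 2 = 0" if "i < length p" for i
      using t that sum_nonneg_eq_0_iff[of "{..<length p}" "\<lambda>i. ?t i - 1 / 2"] by auto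
    have "p ! i = 1" if "i < length p" for i
      using eq0[OF that] by (simp add: divide_simps add_nonneg_eq_0_iff)
    then have "set p \<subseteq> {1}" by (auto simp: in_set_conv_nth)
    then have "set p = {1}" using k by auto
    then show ?thesis using k by simp
  qed
qed

section \<open>Integral vectors and evenness of the form\<close>

lemma keys_minus_subset:
  "keys (u - v :: 'q \<Rightarrow>\<^sub>0 real) \<subseteq> keys u \<union> keys v"
  by (auto simp: in_keys_iff lookup_minus)

definition int_vec :: "(vertex \<Rightarrow>\<^sub>0 real) \<Rightarrow> bool" where
  "int_vec v \<longleftrightarrow> (\<forall>x. lookup v x \<in> \<int>)"

lemma int_vec_simple: "int_vec (simple_vec x)"
  by (simp add: int_vec_def lookup_simple_vec)

lemma int_vec_diff: "int_vec u \<Longrightarrow> int_vec v \<Longrightarrow> int_vec (u - v)"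
  by (simp add: int_vec_def lookup_minus)

lemma int_vec_scale: "c \<in> \<int> \<Longrightarrow> int_vec v \<Longrightarrow> int_vec (c *\<^sub>R v)"
  by (simp add: int_vec_def)

lemma weyl_form_int:
  assumes "int_vec v" shows "weyl_form (simple_vec x) v \<in> \<int>"
proof -
  have "weyl_gram x y \<in> \<int>" for y by (simp add: weyl_gram_def)
  then show ?thesis
    using assms by (auto simp: gram_form_simple_vec_left[of "keys v"] int_vec_def intro!: Ints_sum Ints_mult)
qed

text \<open>The Gram matrix is integral with diagonal 2: adding n \<alpha>_x to u changes half the
  norm by n^2 + n (\<alpha>_x | u).\<close>

lemma weyl_form_even:
  assumes "int_vec v" shows "weyl_form v v / 2 \<in> \<int>"
proof -
  have "int_vec (\<Sum>x\<in>A. lookup v x *\<^sub>R simple_vec x) \<and>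
      weyl_form (\<Sum>x\<in>A. lookup v x *\<^sub>R simple_vec x)
        (\<Sum>x\<in>A. lookup v x *\<^sub>R simple_vec x) / 2 \<in> \<int>" if "finite A" for A
    using that
  proof (induction A rule: finite_induct)
    case empty
    then show ?case by (simp add: weyl.form_simps int_vec_def)
  next
    case (insert x A)
    let ?u = "\<Sum>x\<in>A. lookup v x *\<^sub>R simple_vec x" and ?n = "lookup v x"
    have n: "?n \<in> \<int>" using assms by (simp add: int_vec_def)
    have "weyl_form ?u (simple_vec x) = weyl_form (simple_vec x) ?u" by (rule weyl.sym)
    then have "weyl_form (?n *\<^sub>R simple_vec x + ?u) (?n *\<^sub>R simple_vec x + ?u) / 2 =
        ?n * ?n + ?n * weyl_form (simple_vec x) ?u + weyl_form ?u ?u / 2"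
      by (simp add: weyl.form_simps weyl_form_simple field_simps)
    moreover have "int_vec (?n *\<^sub>R simple_vec x + ?u)"
      using insert n by (simp add: int_vec_def lookup_add lookup_simple_vec)
    moreover have "?n * ?n + ?n * weyl_form (simple_vec x) ?u + weyl_form ?u ?u / 2 \<in> \<int>"
      using insert n weyl_form_int[of ?u x] by (intro Ints_add Ints_mult) auto
    ultimately show ?case by (simp only: sum.insert[OF insert(1,2)])
  qed
  from this[OF finite_keys, of v] show ?thesis
    using simple_vec_expansion[of "keys v" v] by simp
qed

locale tubular_diagram =
  fixes p :: "nat list"
  assumes pos: "\<forall>k\<in>set p. 1 \<le> k" and zero_curvature: "curvature p = 0"
begin

abbreviation I where "I \<equiv> bar p"
abbreviation q where "q v \<equiv> weyl_form v v"

lemma orth_vec_Centre_pos: "x \<in> I \<Longrightarrow> lookup (orth_vec p Centre) x > 0"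
  by (cases x) (auto simp: lookup_orth_vec orth_coeff_def)

lemma orth_vec_Centre_radical:
  assumes "keys v \<subseteq> I" shows "weyl_form v (orth_vec p Centre) = 0"
proof -
  have "weyl_form (simple_vec x) (orth_vec p Centre) = 0" if "x \<in> I" for x
    using that weyl_form_orth_Centre weyl_form_orth_Centre_Centre[OF pos] zero_curvature
    by (cases x) auto
  then have "weyl_form (\<Sum>x\<in>I. lookup v x *\<^sub>R simple_vec x) (orth_vec p Centre) = 0"
    by (simp add: weyl.form_sum_left)
  then show ?thesis
    using simple_vec_expansion[OF finite_bar assms] by simp
qed

lemma orth_expansion:
  assumes "keys v \<subseteq> I"
  obtains b where "v = (\<Sum>x\<in>I. b x *\<^sub>R orth_vec p x)" "q v = (\<Sum>x\<in>I. b x * b x * orth_norm p x)"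
proof -
  have inj: "inj_on (orth_vec p) I"
  proof (rule inj_onI)
    fix x y assume xy: "x \<in> I" "y \<in> I" "orth_vec p x = orth_vec p y"
    then have "x \<noteq> CentreStar" "y \<noteq> CentreStar" by auto
    then have "full_basis p x = full_basis p y" using xy(3) by (simp add: full_basis_def)
    then show "x = y"
      by (rule inj_onD[OF full_basis_inj_independent(1)]) (simp_all add: diagram_vertices_def xy)
  qed
  have "simple_vec ` I \<subseteq> span (orth_vec p ` I)" using simple_vec_in_span_orth by blast
  then have "span (simple_vec ` I) \<subseteq> span (orth_vec p ` I)" by (intro span_minimal subspace_span)
  then have "v \<in> span (orth_vec p ` I)" using assms in_span_simple_vec by blast
  then obtain u where "v = (\<Sum>w\<in>orth_vec p ` I. u w *\<^sub>R w)"
    using span_finite[of "orth_vec p ` I"] finite_bar by auto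
  also have "\<dots> = (\<Sum>x\<in>I. u (orth_vec p x) *\<^sub>R orth_vec p x)"
    by (simp add: sum.reindex[OF inj])
  finally have v: "v = (\<Sum>x\<in>I. u (orth_vec p x) *\<^sub>R orth_vec p x)" .
  define b where "b x = u (orth_vec p x)" for x
  have v': "v = (\<Sum>x\<in>I. b x *\<^sub>R orth_vec p x)" using v by (simp add: b_def)
  have "weyl_form (orth_vec p x) v = b x * orth_norm p x" if "x \<in> I" for x
  proof -
    have "weyl_form (orth_vec p x) v = (\<Sum>y\<in>I. b y * weyl_form (orth_vec p x) (orth_vec p y))"
      by (subst v') (rule weyl.form_sum_right)
    also have "\<dots> = (\<Sum>y\<in>I. if y = x then b x * orth_norm p x else 0)"
      using orth_vec_orthogonal[OF that] by (intro sum.cong) (auto simp: orth_norm_def)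
    finally show ?thesis using that finite_bar by simp
  qed
  moreover have "q v = (\<Sum>x\<in>I. b x * weyl_form (orth_vec p x) v)"
    by (subst (1) v') (rule weyl.form_sum_left)
  ultimately have "q v = (\<Sum>x\<in>I. b x * b x * orth_norm p x)" by (simp add: mult.assoc)
  with v' show ?thesis by (rule that)
qed

lemma orth_norm_nonneg: "x \<in> I \<Longrightarrow> orth_norm p x \<ge> 0"
  using orth_norm_Centre[OF pos] zero_curvature orth_norm_Arm[of _ _ p] by (cases x) (auto simp: less_imp_le)

lemma form_nonneg:
  assumes "keys v \<subseteq> I" shows "q v \<ge> 0"
proof -
  obtain b where "q v = (\<Sum>x\<in>I. b x * b x * orth_norm p x)"
    using orth_expansion[OF assms] by metis
  then show ?thesis using orth_norm_nonneg by (simp add: sum_nonneg)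
qed

text \<open>In the orthogonal basis the form is a sum of nonnegative terms, and the only basis
  vector of norm 0 is the one at the centre, whose norm is the curvature.\<close>

lemma form_zero:
  assumes "keys v \<subseteq> I" "q v = 0"
  obtains c where "v = c *\<^sub>R orth_vec p Centre"
proof -
  obtain b where b: "v = (\<Sum>x\<in>I. b x *\<^sub>R orth_vec p x)" "q v = (\<Sum>x\<in>I. b x * b x * orth_norm p x)"
    using orth_expansion[OF assms(1)] by metis
  have "b x * b x * orth_norm p x = 0" if "x \<in> I" for x
    using b(2) assms(2) that finite_bar orth_norm_nonneg
      sum_nonneg_eq_0_iff[of I "\<lambda>x. b x * b x * orth_norm p x"] by auto
  then have "b x = 0" if "x \<in> I - {Centre}" for x
    using that orth_norm_Arm[of _ _ p] by (cases x) force+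
  then have "v = (\<Sum>x\<in>{Centre}. b x *\<^sub>R orth_vec p x)"
    unfolding b(1) by (intro sum.mono_neutral_right) (auto simp: finite_bar)
  then show ?thesis using that[of "b Centre"] by simp
qed

text \<open>
  The positive and the negative part of an integral vector have disjoint supports, hence
  nonpositive inner product. Their norms are even, so one of the parts is isotropic and thus a
  multiple of a vector of full support.
\<close>

lemma int_root_sign:
  assumes v: "int_vec v" "keys v \<subseteq> I" "q v = 2"
  shows "(\<forall>x. 0 \<le> lookup v x) \<or> (\<forall>x. lookup v x \<le> 0)"
proof (rule ccontr)
  assume "\<not> ?thesis"
  then obtain x1 x2 where x12: "lookup v x1 < 0" "lookup v x2 > 0"
    by (auto simp: not_le)
  define P where "P = (\<Sum>x\<in>I. max (lookup v x) 0 *\<^sub>R simple_vec x)"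
  define N where "N = (\<Sum>x\<in>I. max (- lookup v x) 0 *\<^sub>R simple_vec x)"
  have lP: "lookup P x = (if x \<in> I then max (lookup v x) 0 else 0)"
    and lN: "lookup N x = (if x \<in> I then max (- lookup v x) 0 else 0)" for x
    by (simp_all add: P_def N_def lookup_sum_simple_vec finite_bar)
  have kP: "keys P \<subseteq> I" and kN: "keys N \<subseteq> I"
    unfolding P_def N_def by (rule keys_sum_simple_vec)+
  have x12I: "x1 \<in> I" "x2 \<in> I" using x12 v(2) by (auto simp: in_keys_iff)
  have vPN: "v = P - N"
    using v(2) by (intro poly_mapping_eqI) (auto simp: lookup_minus lP lN in_keys_iff max_def)
  have int: "int_vec P" "int_vec N"
    using v(1) by (auto simp: int_vec_def lP lN max_def)
  have PN: "weyl_form P N \<le> 0"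
  proof -
    have "weyl_form P N = (\<Sum>x\<in>I. \<Sum>y\<in>I. lookup P x * lookup N y * weyl_gram x y)"
      by (rule gram_form_superset) (simp_all add: finite_bar kP kN)
    also have "\<dots> \<le> 0"
    proof (intro sum_nonpos)
      fix x y assume xy: "x \<in> I" "y \<in> I"
      show "lookup P x * lookup N y * weyl_gram x y \<le> 0"
      proof (cases "x = y")
        case True
        then show ?thesis by (simp add: lP lN max_def)
      next
        case False
        then have "weyl_gram x y \<le> 0" using weyl_gram_bar[OF xy] by simp
        then show ?thesis by (simp add: mult_nonneg_nonpos lP lN)
      qed
    qed
    finally show ?thesis .
  qed
  have "q v = q P + q N - 2 * weyl_form P N"
    using weyl.sym[of N P] by (simp add: vPN weyl.form_simps)
  then have le: "q P + q N \<le> 2" using PN v(3) by simp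
  obtain m n where mn: "q P / 2 = of_int m" "q N / 2 = of_int n"
    using weyl_form_even[OF int(1)] weyl_form_even[OF int(2)] by (auto elim!: Ints_cases)
  then have "of_int m + of_int n \<le> (1::real)" "of_int m \<ge> (0::real)" "of_int n \<ge> (0::real)"
    using le form_nonneg[OF kP] form_nonneg[OF kN] by simp_all
  then have "m + n \<le> 1" "m \<ge> 0" "n \<ge> 0" by (simp_all flip: of_int_add)
  then consider "m = 0" | "n = 0" by linarith
  then show False
  proof cases
    case 1
    then have "q P = 0" using mn by simp
    then obtain c where c: "P = c *\<^sub>R orth_vec p Centre" using form_zero[OF kP] by metis
    have "lookup P x1 = 0" using x12 x12I by (simp add: lP)
    then have "c = 0" using c orth_vec_Centre_pos[OF x12I(1)] by simp
    then show False using c x12 x12I lP[of x2] by simp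
  next
    case 2
    then have "q N = 0" using mn by simp
    then obtain c where c: "N = c *\<^sub>R orth_vec p Centre" using form_zero[OF kN] by metis
    have "lookup N x2 = 0" using x12 x12I by (simp add: lN)
    then have "c = 0" using c orth_vec_Centre_pos[OF x12I(2)] by simp
    then show False using c x12 x12I lN[of x1] by simp
  qed
qed

text \<open>Descent on the sum of coefficients. As v has positive norm, some simple root of its
  support pairs positively with it, and reflecting there lowers the sum by an integer of at least 1.
  By the sign lemma the result is again nonnegative, or else nonpositive; in the latter case v is a
  multiple of that simple root, and its norm makes it equal to it.\<close>

lemma int_root_in_root_system:
  assumes v: "int_vec v" "keys v \<subseteq> J" "q v = 2" "\<And>x. 0 \<le> lookup v x"
    and J: "J \<subseteq> I"
  shows "v \<in> {refls weyl_form bs \<beta> | bs \<beta>. set bs \<subseteq> simple_vec ` J \<and> \<beta> \<in> simple_vec ` J}"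
  using v
proof (induction "nat \<lfloor>\<Sum>x\<in>J. lookup v x\<rfloor>" arbitrary: v rule: less_induct)
  case less
  have finJ: "finite J" using J finite_bar by (rule finite_subset)
  have expand: "weyl_form (\<Sum>x\<in>J. lookup v x *\<^sub>R simple_vec x) v =
      (\<Sum>x\<in>J. lookup v x * weyl_form (simple_vec x) v)"
    by (rule weyl.form_sum_left)
  have "\<exists>x\<in>J. lookup v x * weyl_form (simple_vec x) v > 0"
  proof (rule ccontr)
    assume "\<not> ?thesis"
    then have "(\<Sum>x\<in>J. lookup v x * weyl_form (simple_vec x) v) \<le> 0"
      by (intro sum_nonpos) (auto simp: not_less)
    then show False
      using expand less.prems(3) simple_vec_expansion[OF finJ less.prems(2)] by simp
  qed
  then obtain x where x: "x \<in> J" "lookup v x * weyl_form (simple_vec x) v > 0" by blast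
  let ?m = "weyl_form (simple_vec x) v"
  have vx: "lookup v x > 0" and m: "?m > 0"
    using x(2) less.prems(4)[of x] by (auto simp: zero_less_mult_iff)
  have "?m \<in> \<int>" using weyl_form_int[OF less.prems(1)] .
  then obtain n where n: "?m = of_int n" by (auto elim: Ints_cases)
  then have m1: "?m \<ge> 1" using m by simp
  define v' where "v' = root_refl weyl_form (simple_vec x) v"
  have v'_eq: "v' = v - ?m *\<^sub>R simple_vec x" by (simp add: v'_def root_refl_def)
  have norm: "weyl_form (simple_vec x) (simple_vec x) = 2" by (simp add: weyl_form_simple)
  have v': "int_vec v'" "keys v' \<subseteq> J" "q v' = 2"
  proof -
    show "int_vec v'"
      unfolding v'_eq using less.prems(1) weyl_form_int by (intro int_vec_diff int_vec_scale int_vec_simple)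
    show "keys v' \<subseteq> J"
      using less.prems(2) x(1)
      by (auto simp: v'_eq in_keys_iff lookup_minus lookup_simple_vec subset_iff split: if_splits)
    show "q v' = 2"
      unfolding v'_def using less.prems(3) weyl.root_refl_isometry[OF norm, of v v] by simp
  qed
  have undo: "root_refl weyl_form (simple_vec x) v' = v"
    unfolding v'_def using norm by (rule weyl.root_refl_involution)
  show ?case
  proof (cases "\<forall>y. 0 \<le> lookup v' y")
    case True
    have "(\<Sum>y\<in>J. lookup v' y) = (\<Sum>y\<in>J. lookup v y) - ?m"
      using x(1) finJ by (simp add: v'_eq lookup_minus lookup_simple_vec sum_subtractf if_distrib[of "(*) _"] cong: if_cong)
    moreover have "(\<Sum>y\<in>J. lookup v' y) \<ge> 0" using True by (simp add: sum_nonneg)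
    ultimately have "nat \<lfloor>\<Sum>y\<in>J. lookup v' y\<rfloor> < nat \<lfloor>\<Sum>y\<in>J. lookup v y\<rfloor>"
      using m1 by linarith
    from less.hyps[OF this v'] True obtain bs \<beta>
      where *: "v' = refls weyl_form bs \<beta>" "set bs \<subseteq> simple_vec ` J" "\<beta> \<in> simple_vec ` J" by blast
    then have "v = refls weyl_form (simple_vec x # bs) \<beta>" using undo by simp
    moreover have "set (simple_vec x # bs) \<subseteq> simple_vec ` J" using * x(1) by simp
    ultimately show ?thesis using *(3) by blast
  next
    case False
    then have np: "lookup v' y \<le> 0" for y
      using int_root_sign[OF v'(1) _ v'(3)] v'(2) J by blast
    have other: "lookup v y = 0" if "y \<noteq> x" for y
      using np[of y] less.prems(4)[of y] that by (simp add: v'_eq lookup_minus lookup_simple_vec)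
    then have v_eq: "v = lookup v x *\<^sub>R simple_vec x"
      by (intro poly_mapping_eqI) (auto simp: lookup_simple_vec)
    have "q (c *\<^sub>R simple_vec x) = c * c * 2" for c
      by (simp add: weyl.form_simps norm)
    from HOL.trans[OF arg_cong[OF v_eq, of "\<lambda>u. q u"] this]
    have "q v = lookup v x * lookup v x * 2" .
    then have "lookup v x * lookup v x = 1" using less.prems(3) by simp
    then have "lookup v x = 1" using vx by (simp add: square_eq_1_iff)
    then have "v = simple_vec x" using v_eq by simp
    then have "v = refls weyl_form [] (simple_vec x)" by simp
    moreover have "set [] \<subseteq> simple_vec ` J" by simp
    ultimately show ?thesis using x(1) by blast
  qed
qed

lemma word_refl_int_root:
  assumes "set bs \<subseteq> simple_vec ` J" "int_vec v" "keys v \<subseteq> J"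
  shows "int_vec (refls weyl_form bs v) \<and> keys (refls weyl_form bs v) \<subseteq> J
    \<and> q (refls weyl_form bs v) = q v"
  using assms
proof (induction bs)
  case (Cons b bs)
  then obtain x where x: "x \<in> J" "b = simple_vec x" by auto
  let ?w = "refls weyl_form bs v"
  have w: "int_vec ?w" "keys ?w \<subseteq> J" "q ?w = q v" using Cons by simp_all
  have norm: "weyl_form (simple_vec x) (simple_vec x) = 2" by (simp add: weyl_form_simple)
  have "q (root_refl weyl_form b ?w) = q v"
    using weyl.root_refl_isometry[OF norm] w(3) x(2) by simp
  moreover have "int_vec (root_refl weyl_form b ?w)"
    unfolding root_refl_def x(2) by (intro int_vec_diff int_vec_scale int_vec_simple w weyl_form_int)
  moreover have "keys (root_refl weyl_form b ?w) \<subseteq> J"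
    using w(2) x by (auto simp: root_refl_def in_keys_iff lookup_minus lookup_simple_vec split: if_splits)
  ultimately show ?case by simp
qed simp

text \<open>Here \<delta> is the null root, an integral radical vector with coefficient 1 at x.
  Subtracting from \<delta> preserves norms, so \<theta> = \<delta> - \<alpha>_x is a root of the
  finite system. For any root \<beta> of that system \<delta> - \<beta> is integral of norm 2 with
  coefficient 1 at x, hence nonnegative by the sign lemma, and away from x its coefficients are
  those of \<theta> - \<beta>.\<close>

theorem highest_root_exists:
  obtains x \<theta> where "is_affine_node p x" "x \<in> I"
    "is_highest_root weyl_form (weyl_basis_bar p - {simple_vec x}) \<theta>"
    "keys \<theta> \<subseteq> I - {x}"
proof -
  have ne: "p \<noteq> []" using zero_curvature by (auto simp: curvature_def)
  then have "Max (set p) \<in> set p" by simp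
  then obtain i0 where i0: "i0 < length p" "p ! i0 = Max (set p)" by (metis in_set_conv_nth)
  define x where "x = Arm i0 (p ! i0)"
  \<comment> \<open>The centre vector has coefficient 1 / M at the tip x of a longest arm, so M
    times it has coefficient 1 there; by divisibility M clears the denominators of all other arms
    too.\<close>
  define M where "M = p ! i0 + 1"
  define \<delta> where "\<delta> = real M *\<^sub>R orth_vec p Centre"
  define \<theta> where "\<theta> = \<delta> - simple_vec x"
  have aff: "is_affine_node p x" using i0 by (auto simp: is_affine_node_def x_def)
  have xI: "x \<in> I" using i0 pos \<open>Max (set p) \<in> set p\<close> by (simp add: x_def)
  have \<delta>_keys: "keys \<delta> \<subseteq> I"
    using keys_orth_vec[of p Centre] by (auto simp: \<delta>_def in_keys_iff)
  have \<delta>_x: "lookup \<delta> x = 1"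
    using xI by (simp add: \<delta>_def x_def M_def lookup_orth_vec orth_coeff_def)
  have \<delta>_nonneg: "0 \<le> lookup \<delta> y" for y
    using orth_vec_Centre_pos[of y] by (cases "y \<in> I") (auto simp: \<delta>_def lookup_orth_vec)
  have \<delta>_int: "int_vec \<delta>"
    unfolding int_vec_def
  proof
    fix y
    show "lookup \<delta> y \<in> \<int>"
    proof (cases y)
      case (Arm i k)
      show ?thesis
      proof (cases "y \<in> I")
        case True
        then have ik: "i < length p" "k \<le> p ! i" using Arm by auto
        then have "p ! i + 1 dvd M"
          using zero_curvature_dvd[OF pos zero_curvature, of "p ! i"] i0 by (simp add: M_def)
        then obtain d where d: "M = (p ! i + 1) * d" by (elim dvdE)
        have "lookup \<delta> y = real M * ((real (p ! i) + 1 - real k) / (real (p ! i) + 1))"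
          using True Arm by (simp add: \<delta>_def lookup_orth_vec orth_coeff_def)
        also have "real M = (real (p ! i) + 1) * real d" by (simp add: d algebra_simps)
        also have "(real (p ! i) + 1) * real d * ((real (p ! i) + 1 - real k) / (real (p ! i) + 1)) =
            real d * (real (p ! i) + 1 - real k)"
          by (simp add: add_nonneg_eq_0_iff)
        finally show ?thesis by simp
      qed (simp add: \<delta>_def lookup_orth_vec)
    qed (simp_all add: \<delta>_def lookup_orth_vec orth_coeff_def)
  qed
  have \<delta>_rad: "weyl_form v \<delta> = 0" if "keys v \<subseteq> I" for v
    using orth_vec_Centre_radical[OF that] by (simp add: \<delta>_def weyl.form_simps)
  have q_diff: "q (\<delta> - v) = q v" if "keys v \<subseteq> I" for v
    using \<delta>_rad[OF that] \<delta>_rad[OF \<delta>_keys] weyl.sym[of \<delta> v] by (simp add: weyl.form_simps)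
  have x_keys: "keys (simple_vec x) \<subseteq> I"
    using xI by (auto simp: in_keys_iff lookup_simple_vec split: if_splits)
  let ?J = "I - {x}"
  have \<Delta>: "weyl_basis_bar p - {simple_vec x} = simple_vec ` ?J" by (auto simp: weyl_basis_bar_eq)
  have \<theta>_keys: "keys \<theta> \<subseteq> ?J"
    using \<delta>_keys \<delta>_x by (auto simp: \<theta>_def in_keys_iff lookup_minus lookup_simple_vec split: if_splits)
  have \<theta>_nonneg: "0 \<le> lookup \<theta> y" for y
    using \<delta>_nonneg[of y] \<delta>_x by (auto simp: \<theta>_def lookup_minus lookup_simple_vec)
  have roots: "root_system_of weyl_form (simple_vec ` ?J) =
      {refls weyl_form bs \<beta> | bs \<beta>. set bs \<subseteq> simple_vec ` ?J \<and> \<beta> \<in> simple_vec ` ?J}"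
    by (rule root_system_of_eq[OF weyl.sym_form_axioms]) (auto simp: weyl_form_simple)
  have "is_highest_root weyl_form (simple_vec ` ?J) \<theta>"
    unfolding is_highest_root_def
  proof (intro conjI ballI)
    have "q \<theta> = 2" unfolding \<theta>_def by (simp add: q_diff[OF x_keys] weyl_form_simple)
    moreover have "int_vec \<theta>" unfolding \<theta>_def by (intro int_vec_diff \<delta>_int int_vec_simple)
    ultimately show "\<theta> \<in> root_system_of weyl_form (simple_vec ` ?J)"
      unfolding roots using \<theta>_keys \<theta>_nonneg by (intro int_root_in_root_system) auto
  next
    fix \<beta> assume "\<beta> \<in> root_system_of weyl_form (simple_vec ` ?J)"
    then obtain bs y where y: "\<beta> = refls weyl_form bs (simple_vec y)" "set bs \<subseteq> simple_vec ` ?J" "y \<in> ?J"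
      unfolding roots by blast
    have "keys (simple_vec y) \<subseteq> ?J"
      using y(3) by (auto simp: in_keys_iff lookup_simple_vec split: if_splits)
    then have \<beta>: "int_vec \<beta>" "keys \<beta> \<subseteq> ?J" "q \<beta> = 2"
      using word_refl_int_root[OF y(2) int_vec_simple] y(1) by (auto simp: weyl_form_simple)
    then have \<beta>I: "keys \<beta> \<subseteq> I" by blast
    have \<beta>x: "lookup \<beta> x = 0" using \<beta>(2) by (auto simp: in_keys_iff)
    have "q (\<delta> - \<beta>) = 2" using q_diff[OF \<beta>I] \<beta>(3) by simp
    moreover have "int_vec (\<delta> - \<beta>)" by (intro int_vec_diff \<delta>_int \<beta>)
    moreover have "keys (\<delta> - \<beta>) \<subseteq> I"
      using \<delta>_keys \<beta>I by (intro order.trans[OF keys_minus_subset]) simp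
    ultimately have sign: "(\<forall>z. 0 \<le> lookup (\<delta> - \<beta>) z) \<or> (\<forall>z. lookup (\<delta> - \<beta>) z \<le> 0)"
      by (intro int_root_sign)
    have "\<not> lookup (\<delta> - \<beta>) x \<le> 0" using \<delta>_x \<beta>x by (simp add: lookup_minus)
    then have nonneg: "0 \<le> lookup (\<delta> - \<beta>) z" for z
      using sign by blast
    \<comment> \<open>\<open>is_highest_root\<close> indexes coefficients by simple roots, so the
      vertex is recovered by inverting \<open>simple_vec\<close>.\<close>
    let ?c = "\<lambda>\<gamma>. lookup (\<theta> - \<beta>) (inv_into UNIV simple_vec \<gamma>)"
    have "keys (\<theta> - \<beta>) \<subseteq> ?J"
      using \<theta>_keys \<beta>(2) by (intro order.trans[OF keys_minus_subset]) simp
    then have "\<theta> - \<beta> = (\<Sum>z\<in>?J. lookup (\<theta> - \<beta>) z *\<^sub>R simple_vec z)"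
      using finite_bar by (intro simple_vec_expansion) auto
    also have "\<dots> = (\<Sum>\<gamma>\<in>simple_vec ` ?J. ?c \<gamma> *\<^sub>R \<gamma>)"
      by (subst sum.reindex) (auto simp: inj_on_def inv_f_f[OF inj_simple_vec])
    finally have "\<theta> - \<beta> = (\<Sum>\<gamma>\<in>simple_vec ` ?J. ?c \<gamma> *\<^sub>R \<gamma>)" .
    moreover have "\<forall>\<gamma>\<in>simple_vec ` ?J. 0 \<le> ?c \<gamma>"
    proof
      fix \<gamma> assume "\<gamma> \<in> simple_vec ` ?J"
      then obtain z where "\<gamma> = simple_vec z" "z \<noteq> x" by blast
      then show "0 \<le> ?c \<gamma>"
        using nonneg[of z] by (simp add: inv_f_f[OF inj_simple_vec] \<theta>_def lookup_minus lookup_simple_vec)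
    qed
    ultimately show "\<exists>c. (\<forall>\<gamma>\<in>simple_vec ` ?J. 0 \<le> c \<gamma>) \<and> \<theta> - \<beta> = (\<Sum>\<gamma>\<in>simple_vec ` ?J. c \<gamma> *\<^sub>R \<gamma>)"
      by (intro exI[of _ ?c] conjI)
  qed
  then show ?thesis using that[OF aff xI _ \<theta>_keys] \<Delta> by simp
qed

end

text \<open>The form is \<open>cover_form k\<close> with k the affine node for curvature 0 and the
  starred vertex otherwise. The sign of the curvature supplies the type predicate that goes with
  it.\<close>

theorem hyperbolic_cover_exists:
  assumes p: "\<forall>k\<in>set p. 1 \<le> k"
  shows "\<exists>F. is_cover_form p F"
proof -
  have bil: "sym_bilinear_on (cover_space p) (cover_form k)" for k
    unfolding sym_bilinear_on_def using cover.sym[of k] by (simp add: cover.form_simps)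
  have base: "cover_form k (u, 0) (v, 0) = weyl_form u v" "cover_form k (0, 1) (0, 1) = 0"
    "cover_form k (v, 0) (0, 1) = lookup v k" for k u v
    by (simp_all add: cover_form_def weyl.form_simps)
  show ?thesis
  proof (cases "curvature p = 0")
    case True
    then interpret tubular_diagram p using p by unfold_locales
    obtain x \<theta> where x: "is_affine_node p x" "x \<in> I"
      "is_highest_root weyl_form (weyl_basis_bar p - {simple_vec x}) \<theta>" "keys \<theta> \<subseteq> I - {x}"
      by (rule highest_root_exists)
    have \<Delta>: "weyl_basis_bar p - {simple_vec x} = simple_vec ` (I - {x})" by (auto simp: weyl_basis_bar_eq)
    have "x \<noteq> Centre" "x \<noteq> CentreStar" using x(1) by (auto simp: is_affine_node_def)
    then have a: "lookup radical_a x = 0"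
      by (simp add: radical_a_def lookup_minus lookup_simple_vec)
    have fin0: "lookup v x = 0" if "v \<in> span (weyl_basis_bar p - {simple_vec x})" for v
      using that unfolding \<Delta> in_span_simple_vec by (auto simp: in_keys_iff)
    have b: "lookup (simple_vec x + \<theta>) x = 1"
      using x(4) by (auto simp: lookup_add lookup_simple_vec in_keys_iff)
    have "is_cover_form p (cover_form x)"
      unfolding is_cover_form_def base using bil weyl_type_trichotomy(2)[OF p True] x(1,3) a fin0 b by blast
    then show ?thesis by blast
  next
    case False
    then have "domestic_type p \<or> wild_type p" using weyl_type_trichotomy[OF p] by linarith
    moreover have "lookup v CentreStar = 0" if "v \<in> span (weyl_basis_bar p)" for v
      using that by (auto simp: weyl_space_bar_iff in_keys_iff)
    moreover have "lookup radical_a CentreStar = 1"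
      by (simp add: radical_a_def lookup_minus lookup_simple_vec)
    ultimately have "is_cover_form p (cover_form CentreStar)"
      unfolding is_cover_form_def base using bil by blast
    then show ?thesis by blast
  qed
qed

subsection \<open>Covers of star-shaped Coxeter systems\<close>

lemma (in simply_laced_gens) lookup_realise_simple:
  assumes \<phi>: "bij_betw \<phi> A S"
  shows "lookup (realise (\<lambda>s. simple_vec (inv_into A \<phi> s)) v) y =
    (if y \<in> A then lookup v (\<phi> y) else 0)"
proof -
  have finA: "finite A" using \<phi> finite_gens bij_betw_finite by blast
  have "realise (\<lambda>s. simple_vec (inv_into A \<phi> s)) v = (\<Sum>y\<in>A. lookup v (\<phi> y) *\<^sub>R simple_vec y)"
    unfolding realise_def
    by (rule sum.reindex_bij_witness[where i = \<phi> and j = "inv_into A \<phi>"])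
      (use \<phi> in \<open>auto simp: bij_betw_def inv_into_into f_inv_into_f\<close>)
  then show ?thesis by (simp add: lookup_sum_simple_vec[OF finA])
qed

lemma (in simply_laced_gens) realise_simple_inj:
  assumes \<phi>: "bij_betw \<phi> A S" and v: "v \<in> geom_space S"
    and zero: "realise (\<lambda>s. simple_vec (inv_into A \<phi> s)) v = 0"
  shows "v = 0"
proof (intro poly_mapping_eqI)
  fix s
  show "lookup v s = lookup 0 s"
  proof (cases "s \<in> S")
    case True
    then obtain y where "y \<in> A" "s = \<phi> y" using \<phi> by (auto simp: bij_betw_def)
    then show ?thesis using lookup_realise_simple[OF \<phi>, of v y] zero by simp
  next
    case False
    then show ?thesis using v by (auto simp: geom_space_iff in_keys_iff)
  qed
qed

lemma weyl_gram_embedding: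
  fixes G (structure)
  assumes emb: "diagram_embedding p \<phi> S (coxeter_edge G)" and st: "s \<in> S" "t \<in> S"
  shows "weyl_gram (inv_into (bar p) \<phi> s) (inv_into (bar p) \<phi> t) = geom_gram G s t"
proof -
  let ?\<psi> = "inv_into (bar p) \<phi>"
  have bij: "bij_betw \<phi> (bar p) S"
    and edges: "\<And>x y. x \<in> bar p \<Longrightarrow> y \<in> bar p \<Longrightarrow>
      coxeter_edge G (\<phi> x) (\<phi> y) \<longleftrightarrow> single_edge x y"
    using emb by (auto simp: diagram_embedding_def)
  have \<psi>: "?\<psi> s \<in> bar p" "?\<psi> t \<in> bar p" "\<phi> (?\<psi> s) = s" "\<phi> (?\<psi> t) = t"
    using bij st by (auto simp: bij_betw_def inv_into_into f_inv_into_f)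
  have "?\<psi> s = ?\<psi> t \<longleftrightarrow> s = t" using \<psi> by metis
  moreover have "single_edge (?\<psi> s) (?\<psi> t) \<longleftrightarrow> coxeter_edge G s t" using edges[OF \<psi>(1,2)] \<psi>(3,4) by simp
  ultimately show ?thesis using weyl_gram_bar[OF \<psi>(1,2)] by (simp add: geom_gram_def)
qed

text \<open>The vector \<beta> s is the simple root at the diagram vertex of s, placed in the cover,
  and \<beta> c + a is the simple root at the starred vertex. So the generators of the transvection
  locale, formed with the total form that agrees with F on the cover space, are the reflections of
  the cover.\<close>

theorem hyperbolic_cover_isomorphic:
  fixes G :: "('g, 'm) monoid_scheme"
  assumes G: "coxeter_system G S" "simply_laced G S"
    and emb: "diagram_embedding p \<phi> S (coxeter_edge G)"
    and H: "hyperbolic_cover p H X"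
  shows "pair_isomorphic H X (extended_coxeter_group G S) (extended_coxeter_gens S (\<phi> Centre))"
proof -
  let ?I = "bar p" and ?c = "\<phi> Centre"
  let ?\<psi> = "inv_into ?I \<phi>"
  have pos: "\<forall>k\<in>set p. 1 \<le> k" and bij: "bij_betw \<phi> ?I S"
    using emb by (auto simp: diagram_embedding_def)
  have finS: "finite S" using bij finite_bar bij_betw_finite by blast
  interpret simply_laced_coxeter G S using G finS by unfold_locales
  obtain F where F: "is_cover_form p F"
    and X: "X = (\<lambda>\<alpha>. reflection (cover_space p) F (\<alpha>, 0)) ` weyl_basis p"
    and Heq: "H = gen_lin (cover_space p) \<lparr>carrier := generate (gen_lin (cover_space p)) X\<rparr>"
    using H by (auto simp: hyperbolic_cover_def)
  obtain k where k: "k = CentreStar \<or> (\<exists>i<length p. k = Arm i (p ! i))"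
    and Fk: "\<And>x y. x \<in> cover_space p \<Longrightarrow> y \<in> cover_space p \<Longrightarrow> F x y = cover_form k x y"
    using cover_form_determined[OF F pos] by metis
  let ?U = "cover_space p" and ?a = "(radical_a, 0) :: cover_vec"
  define \<beta> where "\<beta> s = (simple_vec (?\<psi> s), 0 :: real)" for s
  have \<psi>I: "?\<psi> s \<in> ?I" if "s \<in> S" for s
    using bij that by (auto simp: bij_betw_def inv_into_into)
  have simple_U: "(simple_vec x, 0) \<in> ?U" if "x \<in> diagram_vertices p" for x
    using that by (auto simp: cover_space_def weyl_space_iff in_keys_iff lookup_simple_vec split: if_splits)
  have a_U: "?a \<in> ?U" by (simp add: cover_space_def radical_a_weyl_space)
  have realise_\<beta>: "realise \<beta> v = (realise (\<lambda>s. simple_vec (?\<psi> s)) v, 0)" for v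
    by (simp add: realise_def \<beta>_def prod_eq_iff fst_sum snd_sum)
  let ?T = "realise (\<lambda>s. simple_vec (?\<psi> s))"
  have T_keys: "keys (?T v) \<subseteq> ?I" for v
    by (auto simp: in_keys_iff lookup_realise_simple[OF bij] split: if_splits)
  have indep: "v = 0" if v: "v \<in> geom_space S" "realise \<beta> v = r *\<^sub>R ?a" for v r
  proof -
    have eq: "?T v = r *\<^sub>R radical_a" using v(2) by (simp add: realise_\<beta>)
    \<comment> \<open>The starred coordinate of a is 1, while vectors in the image of ?T have
      none.\<close>
    have "r = lookup (?T v) CentreStar"
      by (simp add: eq radical_a_def lookup_minus lookup_simple_vec)
    also have "\<dots> = 0" by (simp add: lookup_realise_simple[OF bij])
    finally show ?thesis using eq realise_simple_inj[OF bij v(1)] by simp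
  qed
  have a_ne: "?a \<noteq> 0"
  proof
    assume "?a = 0"
    then have "lookup radical_a CentreStar = 0" by (simp add: prod_eq_iff)
    then show False by (simp add: radical_a_def lookup_minus lookup_simple_vec)
  qed
  have tree: "is_tree S (coxeter_edge G)" by (rule diagram_is_tree[OF emb])
  have cS: "?c \<in> S" using bij by (auto simp: bij_betw_def)
  interpret ext: transvection_extension G S "cover_form k" \<beta> ?a ?U ?c
  proof
    show "subspace ?U" by (rule subspace_cover_space)
    show "\<beta> s \<in> ?U" if "s \<in> S" for s
      using simple_U[of "?\<psi> s"] \<psi>I[OF that] by (simp add: \<beta>_def diagram_vertices_def)
    show "?a \<in> ?U" by (rule a_U)
    show "cover_form k ?a ?a = 0" by (simp add: cover_form_def weyl_form_radical_a)
    show "cover_form k ?a (\<beta> s) = 0" for s by (simp add: cover_form_def weyl_form_radical_a \<beta>_def)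
    show "cover_form k (\<beta> s) (\<beta> t) = geom_gram G s t" if "s \<in> S" "t \<in> S" for s t
      using weyl_gram_embedding[OF emb that] by (simp add: cover_form_def \<beta>_def weyl_form_simple)
    show "?c \<in> S" by (rule cS)
    show "(?c, s) \<in> {(u, v). u \<in> S \<and> v \<in> S \<and> coxeter_edge G u v}\<^sup>*" if "s \<in> S" for s
      using tree cS that by (simp add: is_tree_def)
    show "v = 0" if "v \<in> geom_space S" "realise \<beta> v = r *\<^sub>R ?a" for v r
      using indep that by blast
    fix v assume v: "v \<in> geom_space S"
      and all: "\<And>x. x \<in> ?U \<Longrightarrow> \<exists>r. cover_form k ?a x *\<^sub>R realise \<beta> v =
        (cover_form k (realise \<beta> v) x + r * cover_form k ?a x) *\<^sub>R ?a"
    have e: "(0, 1) \<in> ?U" by (auto simp: cover_space_def weyl_space_iff)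
    show "v = 0"
    proof (cases "k = CentreStar")
      case True
      \<comment> \<open>The extra vector pairs to 1 with a; tested on it, the hypothesis makes the
        image of v a multiple of a.\<close>
      have "lookup radical_a k = 1"
        by (simp add: True radical_a_def lookup_minus lookup_simple_vec)
      then have "cover_form k ?a (0, 1) = 1"
        by (simp add: cover_form_def weyl_form_radical_a)
      then show ?thesis using all[OF e] indep[OF v] by auto
    next
      \<comment> \<open>Here a is orthogonal to the whole cover, so the hypothesis says that the
        image of v is orthogonal to it as well. Testing on simple roots makes it radical, and
        testing on the extra vector kills its coefficient at the tip k.\<close>
      case False
      then obtain i where i: "i < length p" "k = Arm i (p ! i)" using k by blast
      then have "lookup radical_a k = 0"
        by (simp add: radical_a_def lookup_minus lookup_simple_vec)
      then have "cover_form k ?a x = 0" for x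
        by (simp add: cover_form_def weyl_form_radical_a)
      then have zero: "cover_form k (realise \<beta> v) x = 0" if "x \<in> ?U" for x
        using all[OF that] a_ne by (auto simp: zero_prod_def)
      have "?T v = 0"
      proof (rule weyl_radical_vanishes[OF T_keys _ i(1)])
        show "weyl_form (simple_vec y) (?T v) = 0" if "y \<in> ?I" for y
        proof -
          have "(simple_vec y, 0) \<in> ?U" using simple_U[of y] that by (simp add: diagram_vertices_def)
          then show ?thesis
            using zero gram_form_commute[of weyl_gram, OF weyl_gram_commute]
            by (fastforce simp: realise_\<beta> cover_form_def)
        qed
        show "1 \<le> p ! i" using pos i(1) by simp
        show "lookup (?T v) (Arm i (p ! i)) = 0"
          using zero[OF e] i(2) by (simp add: realise_\<beta> cover_form_def weyl.form_simps)
      qed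
      then show ?thesis by (rule realise_simple_inj[OF bij v])
    qed
  qed
  have \<beta>c: "\<beta> ?c + ?a = (simple_vec CentreStar, 0)"
    using bij by (simp add: \<beta>_def radical_a_def bij_betw_def)
  have refl: "reflection ?U F (simple_vec x, 0) = restrict (root_refl (cover_form k) (simple_vec x, 0)) ?U"
    if "x \<in> diagram_vertices p" for x
  proof -
    have n: "F (simple_vec x, 0) (simple_vec x, 0) = 2"
      using Fk simple_U[OF that] by (simp add: cover_form_def weyl_form_simple)
    show ?thesis
      using Fk[OF simple_U[OF that]] n by (auto simp: reflection_def root_refl_def fun_eq_iff)
  qed
  have "X = (\<lambda>x. restrict (root_refl (cover_form k) (simple_vec x, 0)) ?U) ` diagram_vertices p"
    unfolding X weyl_basis_def image_image using refl by (intro image_cong HOL.refl)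
  also have "\<dots> = insert (restrict (root_refl (cover_form k) (simple_vec CentreStar, 0)) ?U)
      ((\<lambda>x. restrict (root_refl (cover_form k) (simple_vec x, 0)) ?U) ` ?I)"
    by (simp add: diagram_vertices_def)
  also have "?I = ?\<psi> ` S"
    using bij_betw_inv_into[OF bij] by (simp add: bij_betw_def)
  finally have "X = ext.X"
    unfolding ext.X_def \<beta>c unfolding \<beta>_def image_image .
  then show ?thesis using ext.pair_isomorphic_extension Heq by simp
qed

subsection \<open>A Coxeter system with prescribed diagram\<close>

lemma concat_replicate_snoc: "concat (replicate n xs) @ xs = concat (replicate (Suc n) xs)"
  by (induction n) simp_all

lemma (in group) ord_eq_2_or_3:
  assumes "x \<in> carrier G" "x \<noteq> \<one>" "x [^] q = \<one>" "q = 2 \<or> q = (3::nat)"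
  shows "ord x = q"
proof -
  have "ord x dvd q" using assms pow_eq_id by blast
  moreover have "ord x \<noteq> 1" using assms ord_eq_1 by blast
  moreover have "d = 1 \<or> d = q" if "d dvd q" for d
  proof -
    have "d \<le> 3" using that assms(4) dvd_imp_le[of d q] by auto
    then have "d = 0 \<or> d = 1 \<or> d = 2 \<or> d = 3" by linarith
    then show ?thesis using that assms(4) by auto
  qed
  ultimately show ?thesis by blast
qed

text \<open>
  The reflection group of the diagram, with an element represented by the set of all words for it.
\<close>

definition weyl_act :: "vertex list \<Rightarrow> (vertex \<Rightarrow>\<^sub>0 real) \<Rightarrow> (vertex \<Rightarrow>\<^sub>0 real)" where
  "weyl_act = word_refl weyl_form simple_vec"

definition word_class :: "nat list \<Rightarrow> vertex list \<Rightarrow> vertex list set" where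
  "word_class p u = {v. set v \<subseteq> bar p \<and> weyl_act v = weyl_act u}"

definition diagram_group :: "nat list \<Rightarrow> vertex list set monoid" where
  "diagram_group p =
     \<lparr>carrier = word_class p ` {u. set u \<subseteq> bar p},
      mult = (\<lambda>A B. word_class p ((SOME u. u \<in> A) @ (SOME v. v \<in> B))),
      one = word_class p []\<rparr>"

context
  fixes p :: "nat list"
  assumes pos: "\<forall>k\<in>set p. 1 \<le> k"
begin

abbreviation I where "I \<equiv> bar p"
abbreviation cl where "cl \<equiv> word_class p"
abbreviation D where "D \<equiv> diagram_group p"
abbreviation gen_of where "gen_of x \<equiv> word_class p [x]"

lemma weyl_act_append: "weyl_act (u @ v) x = weyl_act u (weyl_act v x)"
  by (simp add: weyl_act_def)

lemma weyl_norm: "weyl_form (simple_vec x) (simple_vec x) = 2"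
  by (simp add: weyl_form_simple)

lemma word_class_eq_iff:
  assumes "set u \<subseteq> I" shows "cl u = cl v \<longleftrightarrow> weyl_act u = weyl_act v"
proof
  assume "cl u = cl v"
  moreover have "u \<in> cl u" using assms by (simp add: word_class_def)
  ultimately have "u \<in> cl v" by simp
  then show "weyl_act u = weyl_act v" by (simp add: word_class_def)
qed (simp add: word_class_def)

text \<open>The representatives picked by the product do not matter, since a class consists of all
  words with the same action.\<close>

lemma D_mult:
  assumes "set u \<subseteq> I" "set v \<subseteq> I"
  shows "cl u \<otimes>\<^bsub>D\<^esub> cl v = cl (u @ v)"
proof -
  have rep: "weyl_act (SOME w. w \<in> cl u) = weyl_act u" if "set u \<subseteq> I" for u
  proof -
    have "u \<in> cl u" using that by (simp add: word_class_def)
    then have "(SOME w. w \<in> cl u) \<in> cl u" by (rule someI)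
    then show ?thesis by (simp add: word_class_def)
  qed
  have "weyl_act ((SOME w. w \<in> cl u) @ (SOME w. w \<in> cl v)) = weyl_act (u @ v)"
    using rep assms by (simp add: fun_eq_iff weyl_act_append)
  then show ?thesis by (simp add: diagram_group_def word_class_def)
qed

lemma D_carrier: "carrier D = cl ` {u. set u \<subseteq> I}"
  by (simp add: diagram_group_def)

lemma D_one: "\<one>\<^bsub>D\<^esub> = cl []"
  by (simp add: diagram_group_def)

lemma group_D: "group D"
proof (rule groupI)
  show "\<one>\<^bsub>D\<^esub> \<in> carrier D" by (simp add: D_carrier D_one)
  fix A assume "A \<in> carrier D"
  then obtain u where u: "A = cl u" "set u \<subseteq> I" by (auto simp: D_carrier)
  show "\<one>\<^bsub>D\<^esub> \<otimes>\<^bsub>D\<^esub> A = A" using u by (simp add: D_one D_mult)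
  have "weyl_act (rev u @ u) = weyl_act []"
    by (rule ext) (simp add: weyl_act_def weyl.word_refl_rev weyl_norm)
  then have "cl (rev u) \<otimes>\<^bsub>D\<^esub> A = \<one>\<^bsub>D\<^esub>"
    using u word_class_eq_iff[of "rev u @ u" "[]"] by (simp add: D_one D_mult)
  then show "\<exists>B\<in>carrier D. B \<otimes>\<^bsub>D\<^esub> A = \<one>\<^bsub>D\<^esub>"
    using u by (intro bexI[of _ "cl (rev u)"]) (auto simp: D_carrier)
  fix B assume "B \<in> carrier D"
  then obtain v where v: "B = cl v" "set v \<subseteq> I" by (auto simp: D_carrier)
  show "A \<otimes>\<^bsub>D\<^esub> B \<in> carrier D" using u v by (auto simp: D_carrier D_mult)
  fix C assume "C \<in> carrier D"
  then obtain w where w: "C = cl w" "set w \<subseteq> I" by (auto simp: D_carrier)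
  show "A \<otimes>\<^bsub>D\<^esub> B \<otimes>\<^bsub>D\<^esub> C = A \<otimes>\<^bsub>D\<^esub> (B \<otimes>\<^bsub>D\<^esub> C)" using u v w by (simp add: D_mult)
qed

interpretation D: group D by (rule group_D)

lemma word_value_D: "set xs \<subseteq> I \<Longrightarrow> word_value D (map gen_of xs) = cl xs"
proof (induction xs)
  case Nil
  then show ?case by (simp add: word_value_def D_one)
next
  case (Cons x xs)
  then have "word_value D (map gen_of (x # xs)) = gen_of x \<otimes>\<^bsub>D\<^esub> cl xs" by (simp add: word_value_def)
  then show ?case using Cons.prems D_mult[of "[x]" xs] by simp
qed

lemma gen_of_carrier: "x \<in> I \<Longrightarrow> gen_of x \<in> carrier D"
  by (auto simp: D_carrier)

text \<open>Applying x changes only the coefficient at x, so the coefficient at y stays -1, whereas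
  the identity has 1 there. This separates single letters and products of two distinct letters from
  the unit.\<close>

lemma weyl_act_pair:
  "x \<noteq> y \<Longrightarrow> lookup (weyl_act [x, y] (simple_vec y)) y = - 1"
  "lookup (weyl_act [y] (simple_vec y)) y = - 1"
  by (simp_all add: weyl_act_def root_refl_def weyl_form_simple lookup_minus lookup_simple_vec)

lemma gen_of_nontrivial:
  assumes "x \<in> I" "y \<in> I"
  shows "gen_of x \<noteq> \<one>\<^bsub>D\<^esub>" "x \<noteq> y \<Longrightarrow> gen_of x \<otimes>\<^bsub>D\<^esub> gen_of y \<noteq> \<one>\<^bsub>D\<^esub>" "x \<noteq> y \<Longrightarrow> gen_of x \<noteq> gen_of y"
proof -
  have nil: "lookup (weyl_act [] (simple_vec z)) z = 1" for z
    by (simp add: weyl_act_def lookup_simple_vec)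
  show "gen_of x \<noteq> \<one>\<^bsub>D\<^esub>"
    using word_class_eq_iff[of "[x]" "[]"] assms weyl_act_pair(2)[of x] nil[of x] by (auto simp: D_one)
  show 1: "gen_of x \<otimes>\<^bsub>D\<^esub> gen_of y \<noteq> \<one>\<^bsub>D\<^esub>" if "x \<noteq> y"
    using D_mult[of "[x]" "[y]"] word_class_eq_iff[of "[x, y]" "[]"] assms weyl_act_pair(1)[OF that] nil[of y]
    by (auto simp: D_one)
  have "gen_of y \<otimes>\<^bsub>D\<^esub> gen_of y = \<one>\<^bsub>D\<^esub>"
    using D_mult[of "[y]" "[y]"] word_class_eq_iff[of "[y, y]" "[]"] assms
    by (auto simp: D_one weyl_act_def weyl_norm fun_eq_iff)
  then show "x \<noteq> y \<Longrightarrow> gen_of x \<noteq> gen_of y" using 1 by auto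
qed

text \<open>The braid or commutation relation bounds the order of the product by 3 or 2; since these
  are prime and the product is not the unit, the order is exact.\<close>

lemma entry_D:
  assumes xy: "x \<in> I" "y \<in> I" "x \<noteq> y"
  shows "coxeter_entry D (gen_of x) (gen_of y) = (if single_edge x y then 3 else 2)"
proof -
  have prod: "gen_of x \<otimes>\<^bsub>D\<^esub> gen_of y = cl [x, y]" using D_mult[of "[x]" "[y]"] xy by simp
  have carr: "cl [x, y] \<in> carrier D" using xy by (auto simp: D_carrier)
  have pow: "cl [x, y] [^]\<^bsub>D\<^esub> (n::nat) = cl (concat (replicate n [x, y]))" for n
  proof (induction n)
    case (Suc n)
    have "set (concat (replicate n [x, y])) \<subseteq> I" using xy by (auto simp: set_replicate_conv_if)
    then have "cl [x, y] [^]\<^bsub>D\<^esub> Suc n = cl (concat (replicate n [x, y]) @ [x, y])"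
      using Suc xy D_mult[of "concat (replicate n [x, y])" "[x, y]"] by simp
    also have "concat (replicate n [x, y]) @ [x, y] = concat (replicate (Suc n) [x, y])"
      by (rule concat_replicate_snoc)
    finally show ?case .
  qed (simp add: D_one)
  have one: "cl [x, y] [^]\<^bsub>D\<^esub> n = \<one>\<^bsub>D\<^esub>" if "weyl_act (concat (replicate n [x, y])) = weyl_act []" for n :: nat
    unfolding pow D_one using that by (simp add: word_class_def)
  have ne: "cl [x, y] \<noteq> \<one>\<^bsub>D\<^esub>" using gen_of_nontrivial(2)[OF xy] prod by simp
  show ?thesis
  proof (cases "single_edge x y")
    case True
    then have g: "weyl_form (simple_vec x) (simple_vec y) = - 1"
      using weyl_gram_bar[OF xy(1,2)] xy(3) by (simp add: weyl_form_simple)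
    have "weyl_act (concat (replicate 3 [x, y])) = weyl_act []"
      using weyl.root_refl_braid[OF weyl_norm weyl_norm g]
      by (simp add: fun_eq_iff weyl_act_def numeral_eq_Suc weyl_norm)
    then have "D.ord (cl [x, y]) = 3" using ne carr one by (intro D.ord_eq_2_or_3) auto
    then show ?thesis using True prod by (simp add: coxeter_entry_def)
  next
    case False
    then have g: "weyl_form (simple_vec x) (simple_vec y) = 0"
      using weyl_gram_bar[OF xy(1,2)] xy(3) by (simp add: weyl_form_simple)
    have "weyl_act (concat (replicate 2 [x, y])) = weyl_act []"
      using weyl.root_refl_commute[OF g]
      by (simp add: fun_eq_iff weyl_act_def numeral_eq_Suc weyl_norm)
    then have "D.ord (cl [x, y]) = 2" using ne carr one by (intro D.ord_eq_2_or_3) auto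
    then show ?thesis using False prod by (simp add: coxeter_entry_def)
  qed
qed

lemma embedding_D: "diagram_embedding p gen_of (gen_of ` I) (coxeter_edge D)"
  unfolding diagram_embedding_def
proof (intro conjI ballI)
  show "bij_betw gen_of I (gen_of ` I)"
    using gen_of_nontrivial(3) by (auto simp: bij_betw_def inj_on_def)
  fix x y assume xy: "x \<in> I" "y \<in> I"
  show "coxeter_edge D (gen_of x) (gen_of y) \<longleftrightarrow> single_edge x y"
  proof (cases "x = y")
    case True
    then show ?thesis by (cases y) (auto simp: coxeter_edge_def single_edge_def doubleton_eq_iff)
  next
    case False
    then show ?thesis using entry_D[OF xy] gen_of_nontrivial(3)[OF xy] by (simp add: coxeter_edge_def)
  qed
qed (use pos in simp)

lemma simply_laced_D: "simply_laced D (gen_of ` I)"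
  unfolding simply_laced_def
proof (intro ballI impI)
  fix s t assume st: "s \<in> gen_of ` I" "t \<in> gen_of ` I" "s \<noteq> t"
  then obtain x y where xy: "x \<in> I" "y \<in> I" "s = gen_of x" "t = gen_of y" by blast
  then have "x \<noteq> y" using st(3) by auto
  then show "coxeter_entry D s t \<in> {2, 3}" using entry_D[OF xy(1,2)] xy(3,4) by simp
qed

lemma gens_order_D:
  assumes "s \<in> gen_of ` I" shows "D.ord s = 2"
proof -
  obtain x where x: "x \<in> I" "s = gen_of x" using assms by auto
  have "gen_of x \<otimes>\<^bsub>D\<^esub> gen_of x = \<one>\<^bsub>D\<^esub>"
    using D_mult[of "[x]" "[x]"] word_class_eq_iff[of "[x, x]" "[]"] x
    by (auto simp: D_one weyl_act_def weyl_norm fun_eq_iff)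
  then have "gen_of x [^]\<^bsub>D\<^esub> (2::nat) = \<one>\<^bsub>D\<^esub>"
    using gen_of_carrier[OF x(1)] by (simp add: numeral_2_eq_2)
  then show ?thesis
    using x gen_of_nontrivial(1) gen_of_carrier by (intro D.ord_eq_2_or_3) auto
qed

interpretation gens: simply_laced_gens D "gen_of ` I"
  using group_D gen_of_carrier gens_order_D simply_laced_D finite_bar
  by (intro simply_laced_gens.intro) auto

text \<open>Equality in D means equal action on the space of the diagram. The simple roots there
  have the Gram matrix of the geometric representation and are independent, so the two actions agree
  via \<open>realise\<close>, and faithfulness turns equal action into congruence of words.
  Conversely the Coxeter relations hold for the reflections.\<close>

lemma coxeter_system_D: "coxeter_system D (gen_of ` I)"
proof -
  let ?S = "gen_of ` I" and ?\<psi> = "inv_into I gen_of"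
  have bij: "bij_betw gen_of I ?S" using embedding_D by (simp add: diagram_embedding_def)
  define \<beta> where "\<beta> s = (simple_vec (?\<psi> s) :: vertex \<Rightarrow>\<^sub>0 real)" for s
  have gram: "weyl_form (\<beta> s) (\<beta> t) = geom_gram D s t" if "s \<in> ?S" "t \<in> ?S" for s t
    unfolding \<beta>_def weyl_form_simple by (rule weyl_gram_embedding[OF embedding_D that])
  have \<beta>_gen: "\<beta> (gen_of x) = simple_vec x" if "x \<in> I" for x
    using inv_into_f_f[OF bij_betw_imp_inj_on[OF bij] that] by (simp add: \<beta>_def)
  have W: "word_refl weyl_form \<beta> (map gen_of xs) v = weyl_act xs v" if "set xs \<subseteq> I" for xs v
    using that by (induction xs) (simp_all add: weyl_act_def \<beta>_gen)
  have words: "word_value D us = word_value D vs \<longleftrightarrow> coxeter_equiv D ?S us vs"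
    if uv: "set us \<subseteq> ?S" "set vs \<subseteq> ?S" for us vs
  proof -
    have "us \<in> lists ?S" "vs \<in> lists ?S" using uv by (auto simp: lists_eq_set)
    then have "us \<in> map gen_of ` lists I" "vs \<in> map gen_of ` lists I"
      by (simp_all only: lists_image)
    then obtain xs ys where "us = map gen_of xs" "xs \<in> lists I" "vs = map gen_of ys" "ys \<in> lists I"
      by blast
    then have xs: "us = map gen_of xs" "set xs \<subseteq> I" and ys: "vs = map gen_of ys" "set ys \<subseteq> I"
      by (auto simp: lists_eq_set)
    have "word_value D us = word_value D vs \<longleftrightarrow> weyl_act xs = weyl_act ys"
      using word_value_D xs ys word_class_eq_iff[OF xs(2)] by simp
    also have "\<dots> \<longleftrightarrow> coxeter_equiv D ?S us vs"
    proof
      assume eq: "weyl_act xs = weyl_act ys"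
      show "coxeter_equiv D ?S us vs"
      proof (rule gens.act_faithful[OF uv])
        fix s assume s: "s \<in> ?S"
        let ?v = "simple_vec s" and ?T = "gens.realise \<beta>"
        have v: "?v \<in> geom_space ?S" using s by (rule gens.simple_in_geom_space)
        have T: "?T (gens.act ws ?v) = word_refl weyl_form \<beta> ws (?T ?v)" if "set ws \<subseteq> ?S" for ws
          by (rule gens.realise_act[OF weyl.sym_form_axioms gram v that])
        have "?T (gens.act us ?v) = ?T (gens.act vs ?v)"
          using T[OF uv(1)] T[OF uv(2)] W[OF xs(2)] W[OF ys(2)] xs(1) ys(1) eq by simp
        then have "?T (gens.act us ?v - gens.act vs ?v) = 0"
          by (simp add: linear_diff[OF gens.linear_realise])
        moreover have "gens.act us ?v - gens.act vs ?v \<in> geom_space ?S"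
          using gens.act_in_geom_space uv v by (intro subspace_diff gens.subspace_geom_space)
        ultimately have "gens.act us ?v - gens.act vs ?v = 0"
          using gens.realise_simple_inj[OF bij] unfolding \<beta>_def by blast
        then show "gens.act us ?v = gens.act vs ?v" by simp
      qed
    next
      assume "coxeter_equiv D ?S us vs"
      from gens.word_refl_respects_equiv[OF weyl.sym_form_axioms gram this]
      show "weyl_act xs = weyl_act ys"
        using W[OF xs(2)] W[OF ys(2)] xs(1) ys(1) by (simp add: fun_eq_iff)
    qed
    finally show ?thesis .
  qed
  have "generate D ?S = word_value D ` lists ?S"
    by (rule D.generate_involutions[OF gens.gens_carrier gens.gen_square])
  also have "lists ?S = map gen_of ` lists I" by (rule lists_image)
  also have "word_value D ` map gen_of ` lists I = carrier D"
    using word_value_D by (auto simp: D_carrier lists_eq_set image_image intro!: image_eqI)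
  finally have "generate D ?S = carrier D" .
  then show ?thesis
    using group_D gens.gens_carrier gens_order_D words
    by (auto simp: coxeter_system_def lists_eq_set)
qed

text \<open>All vertices other than the centre have degree at most 2. So the diagram is a path if
  the centre has such a degree as well, and otherwise the centre has maximal degree.\<close>

lemma star_coxeter_datum_D: "star_coxeter_datum D (gen_of ` I) (gen_of Centre)"
proof -
  let ?S = "gen_of ` I" and ?E = "coxeter_edge D"
  have deg: "degree_in ?S ?E x \<le> 2" if "x \<in> ?S" "x \<noteq> gen_of Centre" for x
    using diagram_degree[OF embedding_D] that by blast
  have tree: "is_tree ?S ?E" by (rule diagram_is_tree[OF embedding_D])
  have "{x \<in> ?S. 2 < degree_in ?S ?E x} \<subseteq> {gen_of Centre}" using deg by (auto simp: not_less[symmetric])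
  then have "card {x \<in> ?S. 2 < degree_in ?S ?E x} \<le> card {gen_of Centre}" by (intro card_mono) auto
  then have star: "is_star ?S ?E" using tree by (simp add: is_star_def)
  have "is_path ?S ?E \<or> (\<forall>s\<in>?S. degree_in ?S ?E s \<le> degree_in ?S ?E (gen_of Centre))"
  proof (cases "degree_in ?S ?E (gen_of Centre) \<le> 2")
    case True
    then have "degree_in ?S ?E x \<le> 2" if "x \<in> ?S" for x
      using deg[OF that] by (cases "x = gen_of Centre") simp_all
    then have "is_path ?S ?E" using tree unfolding is_path_def by (intro conjI ballI)
    then show ?thesis ..
  next
    case False
    have "degree_in ?S ?E s \<le> degree_in ?S ?E (gen_of Centre)" if "s \<in> ?S" for s
      using deg[OF that] False by (cases "s = gen_of Centre") simp_all
    then show ?thesis by (intro disjI2 ballI)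
  qed
  moreover have "gen_of Centre \<in> ?S" by (intro imageI) simp
  ultimately show ?thesis
    unfolding star_coxeter_datum_def using coxeter_system_D simply_laced_D star by (intro conjI)
qed

end

text \<open>A vertex other than c of degree above 2 rules out a path, so c would have at least the
  same degree, giving two such vertices in a star.\<close>

lemma star_coxeter_datum_diagram:
  assumes "star_coxeter_datum G S c"
  obtains p \<phi> where "diagram_embedding p \<phi> S (coxeter_edge G)" "\<phi> Centre = c"
proof -
  let ?E = "coxeter_edge G"
  have cox: "coxeter_system G S" "simply_laced G S" and star: "is_star S ?E" and c: "c \<in> S"
    and alt: "is_path S ?E \<or> (\<forall>s\<in>S. degree_in S ?E s \<le> degree_in S ?E c)"
    using assms by (auto simp: star_coxeter_datum_def)
  have tree: "is_tree S ?E" using star by (simp add: is_star_def)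
  have finS: "finite S" using tree by (simp add: is_tree_def)
  interpret simply_laced_coxeter G S using cox finS by unfold_locales
  have deg: "degree_in S ?E x \<le> 2" if x: "x \<in> S" "x \<noteq> c" for x
  proof (rule ccontr)
    assume big: "\<not> degree_in S ?E x \<le> 2"
    then have "\<not> is_path S ?E" using x by (auto simp: is_path_def)
    then have "degree_in S ?E x \<le> degree_in S ?E c" using alt x by blast
    then have "{x, c} \<subseteq> {y \<in> S. 2 < degree_in S ?E y}" using big x c by auto
    then have "card {x, c} \<le> card {y \<in> S. 2 < degree_in S ?E y}"
      using finS by (intro card_mono) auto
    moreover have "card {y \<in> S. 2 < degree_in S ?E y} \<le> 1" using star by (simp add: is_star_def)
    ultimately show False using x(2) by simp
  qed
  show ?thesis
  proof (rule star_tree_is_diagram[OF tree])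
    show "coxeter_edge G x y \<longleftrightarrow> coxeter_edge G y x" if "x \<in> S" "y \<in> S" for x y
      using that by (rule edge_commute)
    show "\<not> coxeter_edge G x x" for x by (simp add: coxeter_edge_def)
  qed (use c deg that in auto)
qed

text \<open>Several arms of maximal length allow several covers, so the first half speaks of all of
  them, and asserts separately that one exists. In the second half the reflection group of the star
  of p serves as the Coxeter group.\<close>

theorem theorem5p3:
  shows "(\<forall>(G :: 'g monoid) S c. star_coxeter_datum G S c \<longrightarrow>
            (\<exists>p W S'. extended_Weyl_system p W S' \<and>
               (\<exists>H X. hyperbolic_cover p H X) \<and>
               (\<forall>H X. hyperbolic_cover p H X \<longrightarrow>
                  pair_isomorphic H X (extended_coxeter_group G S) (extended_coxeter_gens S c))))
       \<and> (\<forall>p W S' H X. extended_Weyl_system p W S' \<and> hyperbolic_cover p H X \<longrightarrow>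
            (\<exists>(G :: vertex list set monoid) S c. star_coxeter_datum G S c \<and>
               pair_isomorphic H X (extended_coxeter_group G S) (extended_coxeter_gens S c)))"
proof (intro conjI allI impI)
  fix G :: "'g monoid" and S c assume datum: "star_coxeter_datum G S c"
  obtain p \<phi> where emb: "diagram_embedding p \<phi> S (coxeter_edge G)" "\<phi> Centre = c"
    using star_coxeter_datum_diagram[OF datum] by metis
  then have pos: "\<forall>k\<in>set p. 1 \<le> k" by (simp add: diagram_embedding_def)
  have "pair_isomorphic H X (extended_coxeter_group G S) (extended_coxeter_gens S c)"
    if "hyperbolic_cover p H X" for H X
    using hyperbolic_cover_isomorphic[OF _ _ emb(1) that] datum emb(2) by (auto simp: star_coxeter_datum_def)
  moreover have "\<exists>H X. hyperbolic_cover p H X"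
    using hyperbolic_cover_exists[OF pos] unfolding hyperbolic_cover_def by blast
  moreover have "\<exists>W S'. extended_Weyl_system p W S'"
    using pos unfolding extended_Weyl_system_def by blast
  ultimately show "\<exists>p W S'. extended_Weyl_system p W S' \<and> (\<exists>H X. hyperbolic_cover p H X) \<and>
      (\<forall>H X. hyperbolic_cover p H X \<longrightarrow>
         pair_isomorphic H X (extended_coxeter_group G S) (extended_coxeter_gens S c))"
    by blast
next
  fix p W S' H X assume asm: "extended_Weyl_system p W S' \<and> hyperbolic_cover p H X"
  then have pos: "\<forall>k\<in>set p. 1 \<le> k" by (simp add: extended_Weyl_system_def)
  let ?D = "diagram_group p" and ?g = "\<lambda>x. word_class p [x]"
  let ?S = "?g ` bar p"
  have datum: "star_coxeter_datum ?D ?S (?g Centre)" by (rule star_coxeter_datum_D[OF pos])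
  moreover have "pair_isomorphic H X (extended_coxeter_group ?D ?S) (extended_coxeter_gens ?S (?g Centre))"
    using hyperbolic_cover_isomorphic[OF _ _ embedding_D[OF pos]] asm datum
    by (auto simp: star_coxeter_datum_def)
  ultimately show "\<exists>(G :: vertex list set monoid) S c. star_coxeter_datum G S c \<and>
      pair_isomorphic H X (extended_coxeter_group G S) (extended_coxeter_gens S c)" by blast
qed

end
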